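(* Let $\tilde\mu$ be a full, strictly operator-stable distribution on $\mathbb{R}^{2m}$ with exponent $B\oplus B$ for some $B\in \mathrm{L}(\mathbb{R}^m)$. Let $M$ be the $\mathbb{R}^{2m}$-valued independently scattered random measure generated by $\tilde\mu$ and the Lebesgue measure on $\mathbb{R}^d$, and let $\widetilde M$ be the $\mathbb{C}^m$-valued random measure identified with $M$. Let $D\in Q(\mathbb{R}^m)$ and $E\in Q(\mathbb{R}^d)$ with $q:=\mathrm{trace}(E)$ and $\lambda_E>\Lambda_D$, and let $\phi:\mathbb{R}^d\to[0,\infty)$ be a continuous and $E^*$-homogeneous function with $\phi(x)>0$ for $x\neq0$. Let $\widetilde{\mathbb{X}}_{\phi,D}=\{\widetilde X_{\phi,D}(t):t\in\mathbb{R}^d\}$ be the $\mathbb{R}^m$-valued random field $$\widetilde X_{\phi,D}(t)=\mathrm{Re}\int_{\mathbb{R}^d}\left(e^{\mathrm{i}\langle t,s\rangle}-1\right)\phi(s)^{-D}\phi(s)^{-qB}\,\widetilde M(ds).$$ Then: (a) If $DB=BD$, then $\widetilde{\mathbb{X}}_{\phi,D}$ is $(E,D)$-operator-self-similar and strictly operator-stable with exponent $B$. (b) If $(A\tilde\mu)=\tilde\mu$ for every $A\in\mathcal{T}(2m)$, then $\widetilde{\mathbb{X}}_{\phi,D}$ has stationary increments. (c) $\widetilde{\mathbb{X}}_{\phi,D}$ is full and stochastically continuous.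
   Context: Matrices: $\mathrm{L}(\mathbb{R}^m)$ is the set of real $m\times m$ matrices, $\mathrm{GL}(\mathbb{R}^m)$ the invertible ones; $s^A:=\exp((\ln s)A)$ for $s>0$, and $0^A:=0$ by convention. $A^*$ is the adjoint. $B\oplus B=\begin{pmatrix}B&0\\0&B\end{pmatrix}\in \mathrm{L}(\mathbb{R}^{2m})$. $\lambda_A$ and $\Lambda_A$ denote the minimum and maximum of the real parts of the complex eigenvalues of $A$. $Q(\mathbb{R}^m):=\{A\in \mathrm{L}(\mathbb{R}^m):\lambda_A>0\}$. $\phi$ is $E^*$-homogeneous if $\phi(c^{E^*}x)=c\,\phi(x)$ for all $c>0$, $x\ne0$. Moreover $$\mathcal{T}(2m):=\left\{\begin{pmatrix}(\cos\beta)I_m&(\sin\beta)I_m\\-(\sin\beta)I_m&(\cos\beta)I_m\end{pmatrix}:\beta\in[0,2\pi)\right\},$$ where $I_m$ is the identity matrix. $(A\mu)$ denotes the image of the measure $\mu$ under $A$. Distributions: a probability measure on $\mathbb{R}^k$ is full if it is not concentrated on any hyperplane. A random vector $X$ in $\mathbb{R}^k$ (or its law) is operator-stable if, for i.i.d. copies $X_1,X_2,\dots$ of $X$, there are $A_n\in \mathrm{GL}(\mathbb{R}^k)$, $a_n\in\mathbb{R}^k$ with $A_n(X_1+\dots+X_n)+a_n\overset{d}{=}X$ for all $n\in\mathbb{N}$; strictly operator-stable if this is possible with $a_n=0$. It is operator-stable with exponent $A$ if one may take $A_n=n^{-A}$; equivalently, it is infinitely divisible and its log-characteristic function $\psi$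 (the unique continuous function with $\psi(0)=0$ and characteristic function $e^{\psi}$) satisfies $s\,\psi(u)=\psi(s^{A^*}u)+\mathrm{i}\langle a_s,u\rangle$ for all $s>0$ and all $u$, with vectors $a_s$. A distribution is strictly operator-stable with exponent $A$ if this holds with $a_s=0$ for all $s>0$. Random measure: let $\mathcal{S}$ be the Borel sets of $\mathbb{R}^d$ of finite Lebesgue measure $|A|$. The independently scattered random measure $M$ generated by $\tilde\mu$ (with log-characteristic function $\tilde\psi$) and Lebesgue measure is a family $\{M(A):A\in\mathcal{S}\}$ of $\mathbb{R}^{2m}$-valued random vectors on some probability space such that for pairwise disjoint $A_1,A_2,\dots\in\mathcal{S}$ the $M(A_n)$ are independent, $M(\bigcup_nA_n)=\sum_nM(A_n)$ a.s. if $\bigcup_nA_n\in\mathcal{S}$, and $\mathbb{E}e^{\mathrm{i}\langle M(A),u\rangle}=\exp(|A|\tilde\psi(u))$. $\widetilde M$ is the $\mathbb{C}^m$-valued random measure with $M(A)=(\mathrm{Re}\,\widetilde M(A),\mathrm{Im}\,\widetilde M(A))$. Integral: for simple $g=\sum_{j=1}^nR_j\mathbf{1}_{A_j}$ ($R_j\in \mathrm{L}(\mathbb{R}^{2m})$, $A_j\in\mathcal{S}$ disjoint) put $I_M(g)=\sum_jR_jM(A_j)$. A measurable $g:\mathbb{R}^d\to \mathrm{L}(\mathbb{R}^{2m})$ is integrable w.r.t. $M$ if there are simple $g_n\to g$ a.e. such that $I_M(g_n\mathbf{1}_A)$ converges in probability for every Borel $A$; then $I_M(g)$ is the limit for $A=\mathbb{R}^d$.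 A measurable $f:\mathbb{R}^d\to \mathrm{L}(\mathbb{C}^m)$ is partially integrable w.r.t. $\widetilde M$ if $g_f:=\begin{pmatrix}\mathrm{Re}f&-\mathrm{Im}f\\0&0\end{pmatrix}$ is integrable w.r.t. $M$; then $\mathrm{Re}\int f\,d\widetilde M$ denotes the vector of the first $m$ coordinates of $I_M(g_f)$. Under the stated hypotheses the integrals defining $\widetilde X_{\phi,D}(t)$ exist in this sense. Random fields $\mathbb{X}=\{X(t):t\in\mathbb{R}^d\}$ with values in $\mathbb{R}^m$: $\mathbb{X}$ is $(E,D)$-operator-self-similar if $\{X(r^Et):t\in\mathbb{R}^d\}\overset{fdd}{=}\{r^DX(t):t\in\mathbb{R}^d\}$ for every $r>0$ (equality of all finite-dimensional distributions). $\mathbb{X}$ is (strictly) operator-stable if all its finite-dimensional distributions are (strictly) operator-stable; $B$ is an exponent of $\mathbb{X}$ if every linear combination $\sum_{j=1}^kc_jX(t_j)$ ($k\in\mathbb{N}$, $c_j\in\mathbb{R}$, $t_j\in\mathbb{R}^d$) is operator-stable with exponent $B$. $\mathbb{X}$ is full if the law of $X(t)$ is full for each $t\ne0$. Stationary increments: $\{X(t+h)-X(h):t\in\mathbb{R}^d\}\overset{fdd}{=}\{X(t)-X(0):t\in\mathbb{R}^d\}$ for every $h\in\mathbb{R}^d$. Stochastically continuous: $X(t_n)\to X(t)$ in probability whenever $t_n\to t$. *)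

theory Defs
  imports "HOL-Probability.Probability"
begin

section \<open>Matrices\<close>

text \<open>
  The type constructor \<^typ>\<open>real^'n^'n\<close> is not an instance of the class of normed algebras
  (its multiplication is componentwise), so the matrix exponential is not the library function
  \<^const>\<open>exp\<close> but is given by its power series.
\<close>

definition mat_power :: "real^'n^'n \<Rightarrow> nat \<Rightarrow> real^'n^'n" where
  "mat_power A k = ((\<lambda>C. A ** C) ^^ k) (mat 1)"

definition mat_exp :: "real^'n^'n \<Rightarrow> real^'n^'n" where
  "mat_exp A = (\<Sum>k. (1 / fact k) *\<^sub>R mat_power A k)"

text \<open>The power \<open>s\<^sup>A = exp ((ln s) A)\<close> for \<open>s > 0\<close>, with the convention \<open>0\<^sup>A = 0\<close>.\<close>

definition mat_powr :: "real \<Rightarrow> real^'n^'n \<Rightarrow> real^'n^'n" where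
  "mat_powr s A = (if s > 0 then mat_exp (ln s *\<^sub>R A) else 0)"

definition complex_eigenvalues :: "real^'n^'n \<Rightarrow> complex set" where
  "complex_eigenvalues A =
     {z. \<exists>v :: complex^'n. v \<noteq> 0 \<and> map_matrix complex_of_real A *v v = z *s v}"

definition min_Re_eigenvalue :: "real^'n^'n \<Rightarrow> real" where
  "min_Re_eigenvalue A = Min (Re ` complex_eigenvalues A)"

definition max_Re_eigenvalue :: "real^'n^'n \<Rightarrow> real" where
  "max_Re_eigenvalue A = Max (Re ` complex_eigenvalues A)"

definition Q_matrices :: "(real^'n^'n) set" where
  "Q_matrices = {A. min_Re_eigenvalue A > 0}"

text \<open>
  The space \<open>\<real>\<^sup>2\<^sup>m\<close> is \<^typ>\<open>real^('m + 'm)\<close>: the indices \<open>Inl j\<close> are the first \<open>m\<close> coordinates,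
  the indices \<open>Inr j\<close> the last \<open>m\<close>.
\<close>

definition block_matrix ::
  "'a^'m::finite^'m \<Rightarrow> 'a^'m^'m \<Rightarrow> 'a^'m^'m \<Rightarrow> 'a^'m^'m \<Rightarrow> 'a^('m + 'm)^('m + 'm)" where
  "block_matrix A B C D = (\<chi> i j.
     case i of
       Inl p \<Rightarrow> (case j of Inl q \<Rightarrow> A $ p $ q | Inr q \<Rightarrow> B $ p $ q)
     | Inr p \<Rightarrow> (case j of Inl q \<Rightarrow> C $ p $ q | Inr q \<Rightarrow> D $ p $ q))"

definition direct_sum :: "real^'m::finite^'m \<Rightarrow> real^('m + 'm)^('m + 'm)" where
  "direct_sum B = block_matrix B 0 0 B"

definition phase_rotations :: "(real^('m::finite + 'm)^('m + 'm)) set" where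
  "phase_rotations =
     {block_matrix (cos \<beta> *\<^sub>R mat 1) (sin \<beta> *\<^sub>R mat 1) (- (sin \<beta> *\<^sub>R mat 1)) (cos \<beta> *\<^sub>R mat 1)
      | \<beta>. 0 \<le> \<beta> \<and> \<beta> < 2 * pi}"

definition homogeneous :: "real^'n^'n \<Rightarrow> (real^'n \<Rightarrow> real) \<Rightarrow> bool" where
  "homogeneous A \<phi> \<longleftrightarrow> (\<forall>c>0. \<forall>x. x \<noteq> 0 \<longrightarrow> \<phi> (mat_powr c A *v x) = c * \<phi> x)"


section \<open>Probability distributions\<close>

definition distribution :: "(real^'n) measure \<Rightarrow> bool" where
  "distribution \<mu> \<longleftrightarrow> prob_space \<mu> \<and> sets \<mu> = sets borel"

definition full :: "(real^'n) measure \<Rightarrow> bool" where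
  "full \<mu> \<longleftrightarrow> (\<forall>a c. a \<noteq> 0 \<longrightarrow> \<not> (AE x in \<mu>. a \<bullet> x = c))"

definition char_fun :: "(real^'n) measure \<Rightarrow> real^'n \<Rightarrow> complex" where
  "char_fun \<mu> u = (CLINT x|\<mu>. iexp (x \<bullet> u))"

definition log_char :: "(real^'n) measure \<Rightarrow> real^'n \<Rightarrow> complex" where
  "log_char \<mu> = (THE \<psi>. continuous_on UNIV \<psi> \<and> \<psi> 0 = 0 \<and> (\<forall>u. char_fun \<mu> u = exp (\<psi> u)))"

text \<open>
  In the following definitions the coordinates \<open>x 0, \<dots>, x (n - 1)\<close> of the product space
  \<open>\<Pi>\<^sub>M i\<in>{..<n}. \<mu>\<close> are \<open>n\<close> independent copies of a random vector with law \<open>\<mu>\<close>.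
\<close>

definition infinitely_divisible :: "(real^'n) measure \<Rightarrow> bool" where
  "infinitely_divisible \<mu> \<longleftrightarrow>
     (\<forall>n::nat. n \<ge> 1 \<longrightarrow> (\<exists>\<nu>. distribution \<nu> \<and> distr (\<Pi>\<^sub>M i\<in>{..<n}. \<nu>) borel (\<lambda>x. \<Sum>i<n. x i) = \<mu>))"

definition operator_stable_exponent :: "(real^'n) measure \<Rightarrow> real^'n^'n \<Rightarrow> bool" where
  "operator_stable_exponent \<mu> A \<longleftrightarrow>
     (\<forall>n::nat. n \<ge> 1 \<longrightarrow> (\<exists>a. distr (\<Pi>\<^sub>M i\<in>{..<n}. \<mu>) borel
        (\<lambda>x. mat_powr (real n) (- A) *v (\<Sum>i<n. x i) + a) = \<mu>))"

definition strictly_operator_stable_exponent :: "(real^'n) measure \<Rightarrow> real^'n^'n \<Rightarrow> bool" where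
  "strictly_operator_stable_exponent \<mu> A \<longleftrightarrow> infinitely_divisible \<mu> \<and>
     (\<forall>s>0. \<forall>u. complex_of_real s * log_char \<mu> u = log_char \<mu> (mat_powr s (transpose A) *v u))"

text \<open>
  Strict operator-stability of a law on \<open>\<real>\<^sup>k\<^sup>m = (\<real>\<^sup>m)\<^sup>k\<close>, where \<open>k\<close> is a number rather than a type:
  the space is the product \<open>\<Pi>\<^sub>M j\<in>{..<k}. borel\<close>, and an element of \<open>L(\<real>\<^sup>k\<^sup>m)\<close> is given by
  its \<open>m \<times> m\<close> blocks \<open>L i j\<close> for \<open>i, j < k\<close>.
\<close>

definition block_apply ::
  "nat \<Rightarrow> (nat \<Rightarrow> nat \<Rightarrow> real^'m^'m) \<Rightarrow> (nat \<Rightarrow> real^'m) \<Rightarrow> (nat \<Rightarrow> real^'m)" where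
  "block_apply k L x = (\<lambda>i\<in>{..<k}. \<Sum>j<k. L i j *v x j)"

definition block_invertible :: "nat \<Rightarrow> (nat \<Rightarrow> nat \<Rightarrow> real^'m^'m) \<Rightarrow> bool" where
  "block_invertible k L \<longleftrightarrow> (\<exists>L'. \<forall>i<k. \<forall>j<k.
     (\<Sum>l<k. L i l ** L' l j) = (if i = j then mat 1 else 0) \<and>
     (\<Sum>l<k. L' i l ** L l j) = (if i = j then mat 1 else 0))"

definition strictly_operator_stable :: "nat \<Rightarrow> (nat \<Rightarrow> real^'m) measure \<Rightarrow> bool" where
  "strictly_operator_stable k \<nu> \<longleftrightarrow>
     (\<forall>n::nat. n \<ge> 1 \<longrightarrow> (\<exists>L. block_invertible k L \<and>
        distr (\<Pi>\<^sub>M l\<in>{..<n}. \<nu>) (\<Pi>\<^sub>M j\<in>{..<k}. borel)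
          (\<lambda>x. block_apply k L (\<lambda>j. \<Sum>l<n. x l j)) = \<nu>))"

definition tendsto_in_prob ::
  "'w measure \<Rightarrow> (nat \<Rightarrow> 'w \<Rightarrow> real^'n) \<Rightarrow> ('w \<Rightarrow> real^'n) \<Rightarrow> bool" where
  "tendsto_in_prob P Y Z \<longleftrightarrow>
     (\<forall>\<epsilon>>0. (\<lambda>k. measure P {\<omega> \<in> space P. dist (Y k \<omega>) (Z \<omega>) > \<epsilon>}) \<longlonglongrightarrow> 0)"


section \<open>Random measures and stochastic integrals\<close>

definition finite_measure_sets :: "(real^'d) set set" where
  "finite_measure_sets = {A \<in> sets borel. emeasure lborel A < \<infinity>}"

text \<open>Only the values \<open>M A\<close> with \<open>A\<close> in \<^const>\<open>finite_measure_sets\<close> are meaningful.\<close>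

definition indep_scattered_random_measure ::
  "'w measure \<Rightarrow> (real^'n) measure \<Rightarrow> ((real^'d) set \<Rightarrow> 'w \<Rightarrow> real^'n) \<Rightarrow> bool" where
  "indep_scattered_random_measure P \<mu> M \<longleftrightarrow> prob_space P \<and>
     (\<forall>A\<in>finite_measure_sets. M A \<in> borel_measurable P) \<and>
     (\<forall>A :: nat \<Rightarrow> (real^'d) set. range A \<subseteq> finite_measure_sets \<and> disjoint_family A \<longrightarrow>
        prob_space.indep_vars P (\<lambda>_. borel) (\<lambda>n. M (A n)) UNIV \<and>
        ((\<Union>n. A n) \<in> finite_measure_sets \<longrightarrow>
           (AE \<omega> in P. (\<lambda>n. M (A n) \<omega>) sums M (\<Union>n. A n) \<omega>))) \<and>
     (\<forall>A\<in>finite_measure_sets. \<forall>u.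
        (CLINT \<omega>|P. iexp (M A \<omega> \<bullet> u)) = exp (complex_of_real (measure lborel A) * log_char \<mu> u))"

text \<open>
  A simple function is given by a representation \<open>\<Sum>j<n. R j \<cdot> 1\<^bsub>A j\<^esub>\<close> with disjoint \<open>A j\<close>.
\<close>

definition simple_sets :: "nat \<Rightarrow> (nat \<Rightarrow> (real^'d) set) \<Rightarrow> bool" where
  "simple_sets n A \<longleftrightarrow> (\<forall>j<n. A j \<in> finite_measure_sets) \<and> disjoint_family_on A {..<n}"

definition simple_fun ::
  "nat \<Rightarrow> (nat \<Rightarrow> real^'n^'n) \<Rightarrow> (nat \<Rightarrow> (real^'d) set) \<Rightarrow> real^'d \<Rightarrow> real^'n^'n" where
  "simple_fun n R A s = (\<Sum>j<n. indicator (A j) s *\<^sub>R R j)"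

definition simple_integral ::
  "((real^'d) set \<Rightarrow> 'w \<Rightarrow> real^'n) \<Rightarrow> nat \<Rightarrow> (nat \<Rightarrow> real^'n^'n) \<Rightarrow> (nat \<Rightarrow> (real^'d) set)
     \<Rightarrow> 'w \<Rightarrow> real^'n" where
  "simple_integral M n R A \<omega> = (\<Sum>j<n. R j *v M (A j) \<omega>)"

text \<open>
  \<open>g\<close> is integrable with respect to \<open>M\<close> and \<open>Y\<close> is a version of the integral, which is determined
  only almost surely. The product of the simple function given by \<open>N k, R k, A k\<close> with the indicator
  of \<open>C\<close> is the simple function given by \<open>N k\<close>, \<open>R k\<close> and the sets \<open>A k j \<inter> C\<close>.
\<close>

definition has_random_integral ::
  "'w measure \<Rightarrow> ((real^'d) set \<Rightarrow> 'w \<Rightarrow> real^'n) \<Rightarrow> (real^'d \<Rightarrow> real^'n^'n) \<Rightarrow> ('w \<Rightarrow> real^'n) \<Rightarrow> bool"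
  where
  "has_random_integral P M g Y \<longleftrightarrow>
     g \<in> borel_measurable borel \<and> Y \<in> borel_measurable P \<and>
     (\<exists>N R A. (\<forall>k. simple_sets (N k) (A k)) \<and>
        (AE s in lborel. (\<lambda>k. simple_fun (N k) (R k) (A k) s) \<longlonglongrightarrow> g s) \<and>
        (\<forall>C\<in>sets borel. \<exists>Z\<in>borel_measurable P.
           tendsto_in_prob P (\<lambda>k. simple_integral M (N k) (R k) (\<lambda>j. A k j \<inter> C)) Z) \<and>
        tendsto_in_prob P (\<lambda>k. simple_integral M (N k) (R k) (A k)) Y)"

definition Re_Im_vec :: "complex^'m::finite \<Rightarrow> real^('m + 'm)" where
  "Re_Im_vec z = (\<chi> i. case i of Inl j \<Rightarrow> Re (z $ j) | Inr j \<Rightarrow> Im (z $ j))"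

definition Re_part_matrix :: "complex^'m::finite^'m \<Rightarrow> real^('m + 'm)^('m + 'm)" where
  "Re_part_matrix F = block_matrix (map_matrix Re F) (- map_matrix Im F) 0 0"

text \<open>
  \<open>f\<close> is partially integrable with respect to the \<open>\<complex>\<^sup>m\<close>-valued random measure \<open>Mt\<close>, and \<open>Y\<close> is a
  version of the real part of its integral.
\<close>

definition has_Re_integral ::
  "'w measure \<Rightarrow> ((real^'d) set \<Rightarrow> 'w \<Rightarrow> complex^'m) \<Rightarrow> (real^'d \<Rightarrow> complex^'m^'m)
     \<Rightarrow> ('w \<Rightarrow> real^'m) \<Rightarrow> bool" where
  "has_Re_integral P Mt f Y \<longleftrightarrow>
     (\<exists>Z. has_random_integral P (\<lambda>A \<omega>. Re_Im_vec (Mt A \<omega>)) (\<lambda>s. Re_part_matrix (f s)) Z \<and>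
          Y = (\<lambda>\<omega>. \<chi> j. Z \<omega> $ Inl j))"

definition harmonizable_kernel ::
  "(real^'d \<Rightarrow> real) \<Rightarrow> real^'d^'d \<Rightarrow> real^'m^'m \<Rightarrow> real^'m^'m \<Rightarrow> real^'d \<Rightarrow> real^'d \<Rightarrow> complex^'m^'m"
  where
  "harmonizable_kernel \<phi> E D B t s =
     map_matrix (\<lambda>x. (iexp (t \<bullet> s) - 1) * complex_of_real x)
       (mat_powr (\<phi> s) (- D) ** mat_powr (\<phi> s) (- (trace E *\<^sub>R B)))"


section \<open>Random fields\<close>

definition fdd_eq ::
  "'w measure \<Rightarrow> (real^'d \<Rightarrow> 'w \<Rightarrow> real^'m) \<Rightarrow> (real^'d \<Rightarrow> 'w \<Rightarrow> real^'m) \<Rightarrow> bool" where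
  "fdd_eq P X Y \<longleftrightarrow> (\<forall>J. finite J \<longrightarrow>
     distr P (\<Pi>\<^sub>M t\<in>J. borel) (\<lambda>\<omega>. \<lambda>t\<in>J. X t \<omega>) = distr P (\<Pi>\<^sub>M t\<in>J. borel) (\<lambda>\<omega>. \<lambda>t\<in>J. Y t \<omega>))"

definition operator_self_similar ::
  "'w measure \<Rightarrow> (real^'d \<Rightarrow> 'w \<Rightarrow> real^'m) \<Rightarrow> real^'d^'d \<Rightarrow> real^'m^'m \<Rightarrow> bool" where
  "operator_self_similar P X E D \<longleftrightarrow>
     (\<forall>r>0. fdd_eq P (\<lambda>t. X (mat_powr r E *v t)) (\<lambda>t \<omega>. mat_powr r D *v X t \<omega>))"

definition strictly_operator_stable_field ::
  "'w measure \<Rightarrow> (real^'d \<Rightarrow> 'w \<Rightarrow> real^'m) \<Rightarrow> bool" where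
  "strictly_operator_stable_field P X \<longleftrightarrow> (\<forall>k::nat. k \<ge> 1 \<longrightarrow> (\<forall>t :: nat \<Rightarrow> real^'d.
     strictly_operator_stable k (distr P (\<Pi>\<^sub>M j\<in>{..<k}. borel) (\<lambda>\<omega>. \<lambda>j\<in>{..<k}. X (t j) \<omega>))))"

definition field_exponent ::
  "'w measure \<Rightarrow> (real^'d \<Rightarrow> 'w \<Rightarrow> real^'m) \<Rightarrow> real^'m^'m \<Rightarrow> bool" where
  "field_exponent P X B \<longleftrightarrow> (\<forall>k::nat. k \<ge> 1 \<longrightarrow> (\<forall>(c :: nat \<Rightarrow> real) (t :: nat \<Rightarrow> real^'d).
     operator_stable_exponent (distr P borel (\<lambda>\<omega>. \<Sum>j<k. c j *\<^sub>R X (t j) \<omega>)) B))"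

definition full_field :: "'w measure \<Rightarrow> (real^'d \<Rightarrow> 'w \<Rightarrow> real^'m) \<Rightarrow> bool" where
  "full_field P X \<longleftrightarrow> (\<forall>t. t \<noteq> 0 \<longrightarrow> full (distr P borel (X t)))"

definition stationary_increments :: "'w measure \<Rightarrow> (real^'d \<Rightarrow> 'w \<Rightarrow> real^'m) \<Rightarrow> bool" where
  "stationary_increments P X \<longleftrightarrow>
     (\<forall>h. fdd_eq P (\<lambda>t \<omega>. X (t + h) \<omega> - X h \<omega>) (\<lambda>t \<omega>. X t \<omega> - X 0 \<omega>))"

definition stochastically_continuous :: "'w measure \<Rightarrow> (real^'d \<Rightarrow> 'w \<Rightarrow> real^'m) \<Rightarrow> bool" where
  "stochastically_continuous P X \<longleftrightarrow>
     (\<forall>t \<tau>. \<tau> \<longlonglongrightarrow> t \<longrightarrow> tendsto_in_prob P (\<lambda>n. X (\<tau> n)) (X t))"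

end

theory Submission
  imports Defs
begin

text \<open>
  The law of an integral \<open>\<integral> v dM\<close> is determined by \<open>E exp (i \<integral> v dM) = exp (\<integral> \<psi> (v s) ds)\<close>, where \<open>\<psi>\<close> is the
  log-characteristic function of \<open>\<mu>\<close>. The function \<open>h = - Re \<psi>\<close> satisfies \<open>h (x + y) \<le> 2 h x + 2 h y\<close>,
  is homogeneous under the flow \<open>s\<^sup>A\<close>, where \<open>A\<close> is the adjoint of \<open>B \<oplus> B\<close>, and is positive off \<open>0\<close> by
  fullness. Hence it dominates \<open>|\<psi>|\<close>, and convergence of the approximating integrals in probability
  becomes convergence of the integrands with respect to \<open>\<integral> h\<close>. All claims are then statements about
  integrals of \<open>\<psi>\<close>: self-similarity is a linear substitution by a power of the adjoint of \<open>E\<close>,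
  stability is the homogeneity of \<open>\<psi>\<close>, stationarity of the increments its rotation invariance, and
  fullness the positivity of \<open>h\<close>. For stochastic continuity, the existence of the integral for every
  \<open>t\<close> already implies that the kernel without its oscillating factor \<open>exp (i (t \<bullet> s)) - 1\<close> is
  integrable at infinity, so that dominated convergence applies.
\<close>

section \<open>Matrix exponentials\<close>

text \<open>The inequality for \<open>h\<close> comes from infinite divisibility. The integral of 1
  - cos over a symmetrized law inherits it from the cosine; for the n-th convolution root of
  \<open>\<mu>\<close> this integral is 1 - exp (-2 h / n), and n times it tends to 2 h. The
  domination of |\<psi>| by \<open>h\<close> is a comparison on the unit sphere: both functions are
  multiplied by s under the flow s^A, and every orbit other than the origin crosses the sphere.

  Matrix-valued integrals are tested with a vector u, so that only real integrals of vector-valued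
  functions remain: the transposed kernel acts on (u, 0), its oscillating factor becomes a complex
  scalar and the two matrix powers act in reverse order. Their order in the kernel matters. The
  outer power \<phi>^(-D) absorbs r^D, while \<phi>^(-qB) stands next to the random measure, where
  homogeneity of \<psi> turns r^(-qB) into the scalar r^(-q), which cancels the Jacobian of the
  substitution. For stability, r^B arrives from outside and has to pass \<phi>^(-D), which is where
  DB = BD enters.\<close>

lemma mat_power_0 [simp]: "mat_power A 0 = mat 1"
  by (simp add: mat_power_def)

lemma mat_power_Suc: "mat_power A (Suc k) = A ** mat_power A k"
  by (simp add: mat_power_def)

lemma linear_matrix_mult_left: "linear (\<lambda>X :: real^'n^'m. A ** X)"
  by (rule linearI)
    (simp_all add: matrix_matrix_mult_def vec_eq_iff sum.distrib algebra_simps sum_distrib_left)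

lemma linear_matrix_mult_right: "linear (\<lambda>X :: real^'n^'m. X ** A)"
  by (rule linearI)
    (simp_all add: matrix_matrix_mult_def vec_eq_iff sum.distrib algebra_simps sum_distrib_left)

text \<open>Left multiplication by \<open>A\<close> is a bounded linear map. Its bound
  \<open>K\<close> takes the place of a submultiplicative norm, and the series is dominated by the
  scalar exponential series of \<open>K\<close>.\<close>

lemma mat_exp_sums: "(\<lambda>k. (1 / fact k) *\<^sub>R mat_power A k) sums mat_exp A"
proof -
  obtain K where K: "K > 0" "\<And>X :: real^'a^'a. norm (A ** X) \<le> K * norm X"
    using linear_bounded_pos[OF linear_matrix_mult_left[of A]] by metis
  have bound: "norm (mat_power A k) \<le> K ^ k * norm (mat 1 :: real^'a^'a)" for k
  proof (induction k)
    case (Suc k)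
    have "norm (mat_power A (Suc k)) \<le> K * norm (mat_power A k)"
      by (simp add: mat_power_Suc K)
    also have "\<dots> \<le> K * (K ^ k * norm (mat 1 :: real^'a^'a))"
      using Suc K by (intro mult_left_mono) auto
    finally show ?case by (simp add: mult.assoc)
  qed simp
  have "summable (\<lambda>k. (inverse (fact k) * K ^ k) * norm (mat 1 :: real^'a^'a))"
    by (intro summable_mult2 summable_exp)
  then have "summable (\<lambda>k. (1 / fact k) *\<^sub>R mat_power A k)"
    by (rule summable_comparison_test'[where N=0])
      (use bound in \<open>auto simp: field_simps\<close>)
  then show ?thesis
    unfolding mat_exp_def by (rule summable_sums)
qed

text \<open>Identities that are linear in the exponential (transposition, commutation, relabelling,
  block sums) thereby reduce to identities between powers.\<close>

lemma linear_mat_exp_sums: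
  fixes L :: "real^'n^'n \<Rightarrow> 'b::euclidean_space"
  assumes "linear L"
  shows "(\<lambda>k. (1 / fact k) *\<^sub>R L (mat_power A k)) sums L (mat_exp A)"
  using bounded_linear.sums[OF linear_conv_bounded_linear[THEN iffD1, OF assms] mat_exp_sums[of A]]
  by (simp add: linear_cmul[OF assms])

lemma mat_exp_cong_linear:
  assumes "linear L" "\<And>k. L (mat_power A k) = mat_power A' k"
  shows "L (mat_exp A) = mat_exp A'"
  using linear_mat_exp_sums[OF assms(1), of A] mat_exp_sums[of A'] assms(2)
  by (simp add: sums_unique2)

lemma mat_power_commute:
  assumes "A ** C = C ** A"
  shows "mat_power A k ** C = C ** mat_power A k"
proof (induction k)
  case (Suc k)
  then show ?case
    by (metis assms mat_power_Suc matrix_mul_assoc)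
qed simp

lemma mat_exp_commute:
  assumes "A ** C = C ** A"
  shows "mat_exp A ** C = C ** mat_exp A"
  using linear_mat_exp_sums[OF linear_matrix_mult_left[of C], of A]
    linear_mat_exp_sums[OF linear_matrix_mult_right[of C], of A]
  by (simp add: mat_power_commute[OF assms] sums_unique2)

lemma mat_power_scaleR: "mat_power (t *\<^sub>R A) k = t ^ k *\<^sub>R mat_power A k"
  by (induction k) (auto simp: mat_power_Suc matrix_matrix_mult_def vec_eq_iff sum_distrib_left
      algebra_simps)

lemma transpose_mat_exp: "transpose (mat_exp A) = mat_exp (transpose A)"
proof (rule mat_exp_cong_linear)
  show "linear (transpose :: real^'a^'a \<Rightarrow> _)"
    by (rule linearI) (auto simp: transpose_def vec_eq_iff)
  show "transpose (mat_power A k) = mat_power (transpose A) k" for k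
    by (induction k)
      (auto simp: mat_power_Suc matrix_transpose_mul mat_power_commute transpose_mat)
qed

lemma mat_exp_zero [simp]: "mat_exp 0 = mat 1"
proof -
  have "mat_power (0 :: real^'a^'a) k = (if k = 0 then mat 1 else 0)" for k
    by (cases k) (auto simp: mat_power_Suc)
  then have "(\<lambda>k. (1 / fact k) *\<^sub>R mat_power (0 :: real^'a^'a) k) = (\<lambda>k. if k = 0 then mat 1 else 0)"
    by auto
  then show ?thesis
    using mat_exp_sums[of "0 :: real^'a^'a"] sums_single[of 0 "\<lambda>_. mat 1 :: real^'a^'a"]
    by (auto intro: sums_unique2)
qed

text \<open>Each entry is a scalar power series in \<open>t\<close>, which may be differentiated
  term by term; the index shift in \<open>diffs\<close> produces the extra factor
  \<open>A\<close>.\<close>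

lemma mat_exp_entry_deriv:
  fixes A :: "real^'n^'n"
  shows "((\<lambda>t. mat_exp (t *\<^sub>R A) $ i $ j) has_real_derivative (A ** mat_exp (t *\<^sub>R A)) $ i $ j) (at t)"
proof -
  define c where "c k = mat_power A k $ i $ j / fact k" for k
  have lin: "linear (\<lambda>X :: real^'n^'n. X $ i $ j)" for i j by (rule linearI) auto
  have sums: "(\<lambda>k. c k * t ^ k) sums (mat_exp (t *\<^sub>R A) $ i $ j)" for t
    using linear_mat_exp_sums[OF lin, of "t *\<^sub>R A" i j] by (simp add: c_def mat_power_scaleR mult.commute)
  have "linear (\<lambda>X :: real^'n^'n. (A ** X) $ i $ j)"
    using linear_compose[OF linear_matrix_mult_left lin] by (simp add: o_def)
  from linear_mat_exp_sums[OF this, of "t *\<^sub>R A"]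
  have "(\<lambda>k. (1 / fact k) * (A ** mat_power (t *\<^sub>R A) k) $ i $ j) sums ((A ** mat_exp (t *\<^sub>R A)) $ i $ j)"
    by simp
  also have "(\<lambda>k. (1 / fact k) * (A ** mat_power (t *\<^sub>R A) k) $ i $ j) = (\<lambda>k. diffs c k * t ^ k)"
  proof
    fix k
    have "(A ** mat_power (t *\<^sub>R A) k) $ i $ j = t ^ k * (A ** mat_power A k) $ i $ j"
      by (simp add: mat_power_scaleR linear_cmul[OF linear_matrix_mult_left])
    then show "(1 / fact k) * (A ** mat_power (t *\<^sub>R A) k) $ i $ j = diffs c k * t ^ k"
      by (simp add: diffs_def c_def mat_power_Suc field_simps del: of_nat_Suc)
  qed
  finally have "(\<Sum>k. diffs c k * t ^ k) = (A ** mat_exp (t *\<^sub>R A)) $ i $ j"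
    by (simp add: sums_iff)
  moreover have "DERIV (\<lambda>x. \<Sum>k. c k * x ^ k) t :> (\<Sum>k. diffs c k * t ^ k)"
    using sums by (intro termdiffs_strong_converges_everywhere) (auto simp: sums_iff)
  moreover have "(\<lambda>x. \<Sum>k. c k * x ^ k) = (\<lambda>t. mat_exp (t *\<^sub>R A) $ i $ j)"
    using sums by (auto simp: sums_iff)
  ultimately show ?thesis by simp
qed

text \<open>The left side is constant in \<open>t\<close>: the derivatives of the two factors cancel
  because \<open>A\<close> commutes with its exponential. Carrying the shift \<open>s\<close> along
  yields inverses and the addition theorem at once.\<close>

lemma mat_exp_uminus_mult_add:
  "mat_exp (- t *\<^sub>R A) ** mat_exp ((t + s) *\<^sub>R A) = mat_exp (s *\<^sub>R A)"
proof -
  define P where "P t = mat_exp (- t *\<^sub>R A) ** mat_exp ((t + s) *\<^sub>R A)" for t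
  have comm: "A ** mat_exp (- t *\<^sub>R A) = mat_exp (- t *\<^sub>R A) ** A" for t
    by (rule mat_exp_commute[symmetric])
      (simp add: linear_neg[OF linear_matrix_mult_left] linear_neg[OF linear_matrix_mult_right]
        linear_cmul[OF linear_matrix_mult_left] linear_cmul[OF linear_matrix_mult_right])
  have "((\<lambda>t. P t $ i $ j) has_real_derivative 0) (at t)" for t i j
  proof -
    have neg: "((\<lambda>t. mat_exp (- t *\<^sub>R A) $ i $ k) has_real_derivative
        - (A ** mat_exp (- t *\<^sub>R A)) $ i $ k) (at t)" for k
      using DERIV_chain2[OF mat_exp_entry_deriv[where t="- t"] DERIV_minus[OF DERIV_ident], of A i k]
      by simp
    have shift: "((\<lambda>t. mat_exp ((t + s) *\<^sub>R A) $ k $ j) has_real_derivative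
        (A ** mat_exp ((t + s) *\<^sub>R A)) $ k $ j) (at t)" for k
      using mat_exp_entry_deriv[of A k j "t + s"] by (simp add: DERIV_shift)
    have "((\<lambda>t. P t $ i $ j) has_real_derivative
        - ((A ** mat_exp (- t *\<^sub>R A)) ** mat_exp ((t + s) *\<^sub>R A)) $ i $ j
        + (mat_exp (- t *\<^sub>R A) ** (A ** mat_exp ((t + s) *\<^sub>R A))) $ i $ j) (at t)"
    proof -
      have "((\<lambda>t. \<Sum>k\<in>UNIV. mat_exp (- t *\<^sub>R A) $ i $ k * mat_exp ((t + s) *\<^sub>R A) $ k $ j)
          has_real_derivative
          (\<Sum>k\<in>UNIV. - (A ** mat_exp (- t *\<^sub>R A)) $ i $ k * mat_exp ((t + s) *\<^sub>R A) $ k $ j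
            + (A ** mat_exp ((t + s) *\<^sub>R A)) $ k $ j * mat_exp (- t *\<^sub>R A) $ i $ k)) (at t)"
        by (intro DERIV_sum DERIV_mult neg shift)
      then show ?thesis
        unfolding P_def
        by (simp add: matrix_matrix_mult_def[of "mat_exp _"]
            matrix_matrix_mult_def[of "A ** mat_exp _"] sum.distrib sum_subtractf sum_negf mult.commute)
    qed
    then show ?thesis
      by (simp only: comm matrix_mul_assoc add.left_inverse)
  qed
  then have "P t $ i $ j = P 0 $ i $ j" for i j
    using DERIV_isconst_all by blast
  then show ?thesis
    by (simp add: P_def vec_eq_iff)
qed

lemma mat_exp_add: "mat_exp ((s + t) *\<^sub>R A) = mat_exp (s *\<^sub>R A) ** mat_exp (t *\<^sub>R A)"
  using mat_exp_uminus_mult_add[of "- s" A "s + t"] by simp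

lemma continuous_on_mat_exp: "continuous_on UNIV (\<lambda>t. mat_exp (t *\<^sub>R A))"
proof -
  have "isCont (\<lambda>t. mat_exp (t *\<^sub>R A) $ i $ j) t" for i j t
    by (rule DERIV_isCont[OF mat_exp_entry_deriv])
  then have "continuous_on UNIV (\<lambda>t. \<chi> i j. mat_exp (t *\<^sub>R A) $ i $ j)"
    by (intro continuous_on_vec_lambda) (simp add: continuous_at_imp_continuous_on)
  then show ?thesis by simp
qed

text \<open>In the Leibniz expansion a permutation other than the identity moves at least two
  points. After one factor has been differentiated, an off-diagonal entry of the identity matrix
  remains and kills the term.\<close>

lemma det_derivative_at_identity:
  fixes F :: "real \<Rightarrow> real^'n^'n"
  assumes F: "\<And>i j. ((\<lambda>t. F t $ i $ j) has_real_derivative A $ i $ j) (at x)"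
    and "F x = mat 1"
  shows "((\<lambda>t. det (F t)) has_real_derivative trace A) (at x)"
proof -
  define d where "d p = of_int (sign p) * (\<Sum>i\<in>UNIV. A $ i $ p i *
     (\<Prod>j\<in>UNIV - {i}. (mat 1 :: real^'n^'n) $ j $ p j))" for p
  have "((\<lambda>t. \<Prod>i\<in>UNIV. F t $ i $ p i) has_real_derivative
      (\<Sum>i\<in>UNIV. A $ i $ p i * (\<Prod>j\<in>UNIV - {i}. F x $ j $ p j))) (at x)" for p
    by (rule has_field_derivative_prod) (rule F)
  then have "((\<lambda>t. det (F t)) has_real_derivative (\<Sum>p | p permutes UNIV. d p)) (at x)"
    unfolding det_def d_def by (intro DERIV_sum DERIV_cmult) (simp add: assms(2))
  also have "(\<Sum>p | p permutes (UNIV :: 'n set). d p) = d id"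
  proof -
    have "d p = 0" if p: "p permutes (UNIV :: 'n set)" "p \<noteq> id" for p
    proof -
      have "(\<Prod>j\<in>UNIV - {i}. (mat 1 :: real^'n^'n) $ j $ p j) = 0" for i
      proof -
        obtain a where a: "p a \<noteq> a" using p(2) by (auto simp: fun_eq_iff)
        then have "p (p a) \<noteq> p a" using permutes_inj[OF p(1)] by (auto dest: injD)
        with a obtain j where "j \<noteq> i" "p j \<noteq> j" by metis
        then show ?thesis
          by (intro prod_zero) (auto simp: mat_def intro!: bexI[of _ j])
      qed
      then show ?thesis by (simp only: d_def mult_zero_right sum.neutral_const)
    qed
    then have "(\<Sum>p | p permutes (UNIV :: 'n set). d p) = (\<Sum>p\<in>{id}. d p)"
      by (intro sum.mono_neutral_right) (auto simp: permutes_id)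
    then show ?thesis by simp
  qed
  also have "d id = trace A"
    by (simp add: d_def trace_def mat_def)
  finally show ?thesis .
qed

text \<open>The determinant is multiplicative along the group, so its derivative at 0 determines it:
  g' = (trace A) g. This is the origin of the Jacobian r^q.\<close>

lemma det_mat_exp: "det (mat_exp (t *\<^sub>R A)) = exp (t * trace A)"
proof -
  define g where "g t = det (mat_exp (t *\<^sub>R A))" for t
  have add: "g (s + t) = g s * g t" for s t
    by (simp add: g_def mat_exp_add det_mul)
  have "((\<lambda>t. mat_exp (t *\<^sub>R A) $ i $ j) has_real_derivative A $ i $ j) (at 0)" for i j
    using mat_exp_entry_deriv[of A i j 0] by simp
  then have 0: "(g has_real_derivative trace A) (at 0)"
    unfolding g_def by (rule det_derivative_at_identity) simp
  have "((\<lambda>t. g t * exp (- (t * trace A))) has_real_derivative 0) (at t)" for t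
  proof -
    have "((\<lambda>s. g t * g (s - t)) has_real_derivative g t * trace A) (at t)"
      using DERIV_shift[of g "trace A" t "- t"] 0 by (intro DERIV_cmult) simp
    also have "(\<lambda>s. g t * g (s - t)) = g"
      by (simp flip: add)
    finally have "(g has_real_derivative g t * trace A) (at t)" .
    then show ?thesis by (auto intro!: derivative_eq_intros)
  qed
  then have "g t * exp (- (t * trace A)) = g 0 * exp (- (0 * trace A))"
    using DERIV_isconst_all by blast
  then show ?thesis
    by (simp add: g_def exp_minus field_simps)
qed

section \<open>The matrix powers s^A\<close>

lemma mat_powr_mult:
  "a > 0 \<Longrightarrow> b > 0 \<Longrightarrow> mat_powr (a * b) A = mat_powr a A ** mat_powr b A"
  by (simp add: mat_powr_def ln_mult mat_exp_add)

lemma mat_powr_one [simp]: "mat_powr 1 A = mat 1"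
  by (simp add: mat_powr_def)

lemma mat_powr_uminus: "a > 0 \<Longrightarrow> mat_powr a (- A) = mat_powr (inverse a) A"
  by (simp add: mat_powr_def ln_inverse)

lemma mat_powr_scaleR: "a > 0 \<Longrightarrow> mat_powr a (c *\<^sub>R A) = mat_powr (a powr c) A"
  by (simp add: mat_powr_def ln_powr mult.commute)

lemma mat_powr_inverse: "a > 0 \<Longrightarrow> mat_powr (inverse a) A ** mat_powr a A = mat 1"
  by (simp flip: mat_powr_mult)

lemma mat_powr_inverse': "a > 0 \<Longrightarrow> mat_powr a A ** mat_powr (inverse a) A = mat 1"
  by (simp flip: mat_powr_mult)

lemma mat_powr_commute:
  assumes "A ** C = C ** A"
  shows "mat_powr s A ** C = C ** mat_powr s A"
  unfolding mat_powr_def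
  by (auto intro!: mat_exp_commute simp: linear_cmul[OF linear_matrix_mult_left]
      linear_cmul[OF linear_matrix_mult_right] assms)

lemma transpose_mat_powr: "transpose (mat_powr s A) = mat_powr s (transpose A)"
proof -
  have "transpose (0 :: real^'a^'a) = 0" by (simp add: transpose_def vec_eq_iff)
  then show ?thesis
    by (simp add: mat_powr_def transpose_mat_exp transpose_scalar)
qed

lemma det_mat_powr: "s > 0 \<Longrightarrow> det (mat_powr s A) = s powr trace A"
  by (simp add: mat_powr_def det_mat_exp powr_def mult.commute)

lemma continuous_on_mat_powr: "continuous_on {0<..} (\<lambda>s. mat_powr s A)"
proof -
  have "continuous_on {0<..} (\<lambda>s. mat_exp (ln s *\<^sub>R A))"
    by (rule continuous_on_compose2[OF continuous_on_mat_exp]) (auto intro!: continuous_intros)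
  then show ?thesis
    by (rule continuous_on_cong[THEN iffD1, rotated -1]) (auto simp: mat_powr_def)
qed

lemma borel_measurable_mat_powr: "(\<lambda>s. mat_powr s A) \<in> borel_measurable borel"
proof -
  have "(\<lambda>s. mat_exp (ln s *\<^sub>R A)) \<in> borel_measurable borel"
    using borel_measurable_continuous_onI[OF continuous_on_mat_exp] by measurable
  then show ?thesis
    unfolding mat_powr_def by measurable
qed

section \<open>Linear change of variables\<close>

text \<open>The preimage of a box under \<open>T\<close> is its image under the inverse
  \<open>S\<close> and has volume |det S| times that of the box; the density |det T| compensates.
  Boxes determine Lebesgue measure.\<close>

lemma lborel_matrix_density_wellorder:
  fixes T :: "real^'n::{finite,wellorder}^'n::_"
  assumes "det T \<noteq> 0"
  shows "density (distr lborel borel ((*v) T)) (\<lambda>_. ennreal \<bar>det T\<bar>) = lborel"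
proof (rule lborel_eqI[symmetric])
  have meas: "(*v) T \<in> borel_measurable borel"
    by (intro borel_measurable_continuous_onI matrix_vector_mult_linear_continuous_on)
  obtain S where S: "S ** T = mat 1" "T ** S = mat 1"
    using assms invertible_det_nz unfolding invertible_def by blast
  then have det: "\<bar>det T\<bar> * \<bar>det S\<bar> = 1"
    by (metis abs_mult abs_one det_I det_mul)
  fix l u :: "real^'n::_"
  assume lu: "\<And>b. b \<in> Basis \<Longrightarrow> l \<bullet> b \<le> u \<bullet> b"
  have pre: "(*v) T -` box l u = (*v) S ` box l u"
  proof (intro set_eqI iffI)
    fix x assume "x \<in> (*v) T -` box l u"
    moreover have "x = S *v (T *v x)"
      by (simp add: matrix_vector_mul_assoc S)
    ultimately show "x \<in> (*v) S ` box l u" by blast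
  qed (auto simp: matrix_vector_mul_assoc S)
  have lm: "(*v) S ` box l u \<in> lmeasurable"
    by (intro measurable_linear_image) auto
  have bor: "(*v) S ` box l u \<in> sets borel"
    using measurable_sets[OF meas, of "box l u"] pre by simp
  have "emeasure (density (distr lborel borel ((*v) T)) (\<lambda>_. ennreal \<bar>det T\<bar>)) (box l u)
      = ennreal \<bar>det T\<bar> * emeasure lborel ((*v) S ` box l u)"
    using meas pre by (simp add: emeasure_density nn_integral_cmult emeasure_distr)
  also have "emeasure lborel ((*v) S ` box l u) = emeasure lebesgue ((*v) S ` box l u)"
    using bor by simp
  also have "\<dots> = ennreal (\<bar>det S\<bar> * measure lebesgue (box l u))"
    by (subst emeasure_eq_measure2) (use lm measure_linear_image[of "(*v) S" "box l u"] in auto)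
  also have "measure lebesgue (box l u) = (\<Prod>b\<in>Basis. (u - l) \<bullet> b)"
    using lu by (simp add: inner_diff_left)
  also have "ennreal \<bar>det T\<bar> * ennreal (\<bar>det S\<bar> * (\<Prod>b\<in>Basis. (u - l) \<bullet> b)) =
      ennreal ((\<bar>det T\<bar> * \<bar>det S\<bar>) * (\<Prod>b\<in>Basis. (u - l) \<bullet> b))"
    by (simp only: ennreal_mult'[OF abs_ge_zero] mult.assoc)
  finally show "emeasure (density (distr lborel borel ((*v) T)) (\<lambda>_. ennreal \<bar>det T\<bar>)) (box l u)
      = (\<Prod>b\<in>Basis. (u - l) \<bullet> b)"
    unfolding det mult_1 .
qed (rule sets_density[THEN trans], rule sets_distr)

text \<open>
  The library has the linear change of variables only for well-ordered index types; this type
  provides such an index type of the same cardinality.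
\<close>

typedef 'a ordered_index = "{..<CARD('a::finite)}"
  by (auto intro!: exI[of _ 0])

instance ordered_index :: (finite) finite
proof
  show "finite (UNIV :: 'a ordered_index set)"
    by (rule inj_on_finite[of Rep_ordered_index _ "{..<CARD('a)}"])
      (use Rep_ordered_index in \<open>auto intro: injI simp: Rep_ordered_index_inject\<close>)
qed

instantiation ordered_index :: (finite) linorder
begin

definition "a \<le> b \<longleftrightarrow> Rep_ordered_index a \<le> Rep_ordered_index b" for a b :: "'a ordered_index"
definition "a < b \<longleftrightarrow> Rep_ordered_index a < Rep_ordered_index b" for a b :: "'a ordered_index"

instance
  by standard
    (auto simp: less_eq_ordered_index_def less_ordered_index_def Rep_ordered_index_inject)

end

instance ordered_index :: (finite) wellorder
proof
  fix P :: "'a ordered_index \<Rightarrow> bool" and a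
  assume step: "\<And>x. (\<And>y. y < x \<Longrightarrow> P y) \<Longrightarrow> P x"
  show "P a"
    by (rule measure_induct_rule[where f = Rep_ordered_index])
      (metis step less_ordered_index_def)
qed

lemma ex_bij_ordered_index: "\<exists>\<pi> :: 'a::finite ordered_index \<Rightarrow> 'a. bij \<pi>"
proof -
  obtain f :: "nat \<Rightarrow> 'a" where "bij_betw f {0..<CARD('a)} UNIV"
    using ex_bij_betw_nat_finite[OF finite_class.finite_UNIV] by blast
  moreover have "bij_betw Rep_ordered_index (UNIV :: 'a ordered_index set) {0..<CARD('a)}"
    by (intro bij_betwI[where g=Abs_ordered_index])
      (use Rep_ordered_index Rep_ordered_index_inverse Abs_ordered_index_inverse in \<open>auto simp: lessThan_atLeast0\<close>)
  ultimately show ?thesis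
    using bij_betw_trans by blast
qed

text \<open>Relabelling the coordinates by \<open>\<pi>\<close> permutes the sides of boxes, hence
  preserves Lebesgue measure. The corresponding map \<open>L\<close> on matrices is linear and
  multiplicative, so it commutes with \<open>mat_powr\<close>. The Jacobian is carried over through
  the trace, which is visibly invariant under relabelling.\<close>

lemma lborel_mat_powr_density:
  fixes A :: "real^'n^'n"
  assumes "r > 0"
  shows "density (distr lborel borel ((*v) (mat_powr r A))) (\<lambda>_. ennreal (r powr trace A)) = lborel"
proof -
  obtain \<pi> :: "'n ordered_index \<Rightarrow> 'n" where \<pi>: "bij \<pi>"
    using ex_bij_ordered_index by blast
  define \<rho> :: "real^'n ordered_index \<Rightarrow> real^'n" where "\<rho> x = (\<chi> i. x $ inv \<pi> i)" for x
  define L :: "real^'n^'n \<Rightarrow> real^'n ordered_index^'n ordered_index"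
    where "L C = (\<chi> i j. C $ \<pi> i $ \<pi> j)" for C
  have inv[simp]: "inv \<pi> (\<pi> i) = i" "\<pi> (inv \<pi> j) = j" for i j
    using \<pi> by (simp_all add: bij_is_inj bij_is_surj surj_f_inv_f)
  have lin: "linear L" by (rule linearI) (auto simp: L_def vec_eq_iff)
  have Lmult: "L (C ** C') = L C ** L C'" for C C'
    using sum.reindex_bij_betw[of \<pi> UNIV UNIV "\<lambda>k. C $ _ $ k * C' $ k $ _"] \<pi>
    by (simp add: L_def matrix_matrix_mult_def vec_eq_iff)
  have "L (mat_power A k) = mat_power (L A) k" for k A
  proof (induction k)
    case 0
    then show ?case
      using \<pi> by (auto simp: L_def mat_def vec_eq_iff bij_is_inj inj_eq)
  qed (simp add: mat_power_Suc Lmult)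
  then have "L (mat_exp C) = mat_exp (L C)" for C
    by (rule mat_exp_cong_linear[OF lin])
  then have Lpowr: "L (mat_powr r A) = mat_powr r (L A)"
    using assms by (simp add: mat_powr_def linear_cmul[OF lin])
  have Ltrace: "trace (L A) = trace A"
    using sum.reindex_bij_betw[of \<pi> UNIV UNIV] \<pi> by (auto simp: L_def trace_def)
  have L\<rho>: "\<rho> (L C *v x) = C *v \<rho> x" for C x
    using sum.reindex_bij_betw[of \<pi> UNIV UNIV "\<lambda>j. C $ _ $ j * x $ inv \<pi> j"] \<pi>
    by (simp add: L_def \<rho>_def matrix_vector_mult_def vec_eq_iff)
  have meas: "\<rho> \<in> borel_measurable borel"
    unfolding \<rho>_def
    by (intro borel_measurable_continuous_onI continuous_on_vec_lambda continuous_intros)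
  have mv: "(*v) C \<in> borel_measurable borel" for C :: "real^'k^'k"
    by (intro borel_measurable_continuous_onI matrix_vector_mult_linear_continuous_on)
  have \<rho>: "distr lborel borel \<rho> = lborel"
  proof (rule lborel_eqI[symmetric])
    fix l u :: "real^'n"
    assume lu: "\<And>b. b \<in> Basis \<Longrightarrow> l \<bullet> b \<le> u \<bullet> b"
    define l' u' :: "real^'n ordered_index" where "l' = (\<chi> i. l $ \<pi> i)" and "u' = (\<chi> i. u $ \<pi> i)"
    have le: "l' \<bullet> b \<le> u' \<bullet> b" if b: "b \<in> Basis" for b
    proof -
      obtain i where "b = axis i 1" using b by (auto simp: Basis_vec_def)
      moreover have "l \<bullet> axis (\<pi> i) 1 \<le> u \<bullet> axis (\<pi> i) 1"
        by (intro lu) (simp add: axis_in_Basis_iff)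
      ultimately show ?thesis by (simp add: inner_axis l'_def u'_def)
    qed
    have "\<rho> -` box l u = box l' u'"
    proof -
      have "(\<forall>i. l $ i < x $ inv \<pi> i \<and> x $ inv \<pi> i < u $ i) \<longleftrightarrow>
          (\<forall>i. l $ \<pi> i < x $ i \<and> x $ i < u $ \<pi> i)" for x :: "real^'n ordered_index"
        by (metis inv)
      then show ?thesis
        by (auto simp: mem_box_cart \<rho>_def l'_def u'_def)
    qed
    then have "emeasure (distr lborel borel \<rho>) (box l u) = emeasure lborel (box l' u')"
      using meas by (simp add: emeasure_distr)
    also have "\<dots> = (\<Prod>b\<in>Basis. (u' - l') \<bullet> b)"
      using le by simp
    also have "(\<Prod>b\<in>Basis. (u' - l') \<bullet> b) = (\<Prod>i\<in>UNIV. u' $ i - l' $ i)"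
      by (simp add: Basis_vec_def prod.UNION_disjoint inner_axis axis_eq_axis)
    also have "\<dots> = (\<Prod>i\<in>UNIV. u $ i - l $ i)"
      using prod.reindex_bij_betw[of \<pi> UNIV UNIV "\<lambda>i. u $ i - l $ i"] \<pi>
      by (simp add: l'_def u'_def)
    also have "\<dots> = (\<Prod>b\<in>Basis. (u - l) \<bullet> b)"
      by (simp add: Basis_vec_def prod.UNION_disjoint inner_axis axis_eq_axis)
    finally show "emeasure (distr lborel borel \<rho>) (box l u) = (\<Prod>b\<in>Basis. (u - l) \<bullet> b)" .
  qed simp
  have det: "det (mat_powr r (L A)) = r powr trace A"
    using assms by (simp add: det_mat_powr Ltrace)
  have "density (distr lborel borel ((*v) (mat_powr r (L A)))) (\<lambda>_. ennreal (r powr trace A)) = lborel"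
    using lborel_matrix_density_wellorder[of "mat_powr r (L A)"] assms det by simp
  then have "distr (density (distr lborel borel ((*v) (mat_powr r (L A))))
      (\<lambda>_. ennreal (r powr trace A))) borel \<rho> = lborel"
    using \<rho> by simp
  moreover have "distr (density (distr lborel borel ((*v) (mat_powr r (L A))))
      (\<lambda>_. ennreal (r powr trace A))) borel \<rho> =
    density (distr (distr lborel borel ((*v) (mat_powr r (L A)))) borel \<rho>)
      (\<lambda>_. ennreal (r powr trace A))"
    using meas by (intro measure_eqI)
      (auto simp: emeasure_density_const emeasure_distr measurable_sets_borel[OF meas])
  moreover have "distr (distr lborel borel ((*v) (mat_powr r (L A)))) borel \<rho> =
      distr lborel borel ((*v) (mat_powr r A))"
  proof -
    have "distr (distr lborel borel ((*v) (mat_powr r (L A)))) borel \<rho> =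
        distr lborel borel (\<lambda>x. \<rho> (L (mat_powr r A) *v x))"
      using meas mv by (subst distr_distr) (simp_all add: o_def Lpowr)
    also have "\<dots> = distr (distr lborel borel \<rho>) borel ((*v) (mat_powr r A))"
      using meas mv by (subst distr_distr) (simp_all add: o_def L\<rho>)
    finally show ?thesis by (simp add: \<rho>)
  qed
  ultimately show ?thesis by simp
qed

lemma integral_lborel_mat_powr:
  fixes A :: "real^'n^'n" and f :: "real^'n \<Rightarrow> 'b::{banach, second_countable_topology}"
  assumes "r > 0" "f \<in> borel_measurable borel"
  shows "(\<integral>s. f s \<partial>lborel) = (\<integral>s. r powr trace A *\<^sub>R f (mat_powr r A *v s) \<partial>lborel)"
proof -
  have [measurable]: "(*v) (mat_powr r A) \<in> borel_measurable borel"
    by (intro borel_measurable_continuous_onI matrix_vector_mult_linear_continuous_on)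
  note assms(2)[measurable]
  have "(\<integral>s. f s \<partial>lborel) = (\<integral>s. f s \<partial>density (distr lborel borel ((*v) (mat_powr r A))) (\<lambda>_. ennreal (r powr trace A)))"
    by (simp add: lborel_mat_powr_density[OF assms(1)])
  also have "\<dots> = (\<integral>s. r powr trace A *\<^sub>R f (mat_powr r A *v s) \<partial>lborel)"
    by (subst integral_density) (auto simp: integral_distr)
  finally show ?thesis .
qed

section \<open>Uniqueness of multivariate characteristic functions\<close>

lemma (in prob_space) integrable_weighted_iexp:
  assumes [measurable]: "c \<in> borel_measurable M" "f \<in> borel_measurable M"
    and "\<And>x. \<bar>c x\<bar> \<le> K"
  shows "integrable M (\<lambda>x. complex_of_real (c x) * iexp (f x))"
  by (rule integrable_const_bound[where B=K]) (use assms(3) in \<open>auto simp: norm_mult\<close>)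

lemma normalized_weighted_law:
  fixes v Z :: "'a \<Rightarrow> real"
  assumes v: "integrable R v" "\<And>x. v x \<ge> 0" "(\<integral>x. v x \<partial>R) = c" "c > 0"
    and [measurable]: "Z \<in> borel_measurable R" "A \<in> sets borel"
  defines "N \<equiv> distr (density R (\<lambda>x. ennreal (v x / c))) borel Z"
  shows "real_distribution N"
    and "char N u = (CLINT x|R. v x * iexp (u * Z x)) / c"
    and "measure N A = (\<integral>x. v x * indicator A (Z x) \<partial>R) / c"
proof -
  have [measurable]: "v \<in> borel_measurable R" using v by auto
  have "(\<integral>\<^sup>+x. ennreal (v x / c) \<partial>R) = ennreal (\<integral>x. v x / c \<partial>R)"
    using v by (intro nn_integral_eq_integral) auto
  then have "prob_space (density R (\<lambda>x. ennreal (v x / c)))"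
    using v by (intro prob_spaceI) (simp add: emeasure_density cong: nn_integral_cong)
  then interpret prob_space "density R (\<lambda>x. ennreal (v x / c))" .
  show real: "real_distribution N"
    unfolding N_def by (rule real_distribution_distr) simp
  have "char N u = (CLINT x|R. (v x / c) *\<^sub>R iexp (u * Z x))"
    using v by (simp add: char_def N_def integral_distr integral_density)
  then show "char N u = (CLINT x|R. v x * iexp (u * Z x)) / c"
    by (simp add: scaleR_conv_of_real)
  have "measure N A = (\<integral>x. indicator A x \<partial>N)"
    by (simp add: N_def)
  also have "\<dots> = (\<integral>x. (v x / c) * indicator A (Z x) \<partial>R)"
    unfolding N_def using v by (subst integral_distr) (simp_all add: integral_density)
  finally show "measure N A = (\<integral>x. v x * indicator A (Z x) \<partial>R) / c"
    by simp
qed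

text \<open>Divided by their common mass \<open>c\<close>, the weighted laws are probability
  measures and one-dimensional uniqueness applies. The case u = 0 of \<open>eq\<close> shows that
  the masses agree; mass 0, where normalization fails, is treated apart.\<close>

lemma weighted_law_eqI:
  fixes w Y :: "'a \<Rightarrow> real" and w' Y' :: "'b \<Rightarrow> real"
  assumes w: "integrable P w" "\<And>x. w x \<ge> 0" and w': "integrable Q w'" "\<And>x. w' x \<ge> 0"
    and Y[measurable]: "Y \<in> borel_measurable P" "Y' \<in> borel_measurable Q"
    and eq: "\<And>u. (CLINT x|P. w x * iexp (u * Y x)) = (CLINT x|Q. w' x * iexp (u * Y' x))"
    and A[measurable]: "A \<in> sets borel"
  shows "(\<integral>x. w x * indicator A (Y x) \<partial>P) = (\<integral>x. w' x * indicator A (Y' x) \<partial>Q)"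
proof -
  have [measurable]: "w \<in> borel_measurable P" "w' \<in> borel_measurable Q"
    using w w' by auto
  define c where "c = (\<integral>x. w x \<partial>P)"
  have c: "c \<ge> 0" "c = (\<integral>x. w' x \<partial>Q)"
    using eq[of 0] w(2) w'(2) unfolding c_def
    by (auto intro!: Bochner_Integration.integral_nonneg dest: of_real_eq_iff[THEN iffD1])
  show ?thesis
  proof (cases "c = 0")
    case True
    have "(\<integral>x. v x * indicator A (Z x) \<partial>R) = 0"
      if "integrable R v" "\<And>x. v x \<ge> 0" "(\<integral>x. v x \<partial>R) = 0" for R :: "'c measure" and v Z :: "'c \<Rightarrow> real"
    proof -
      have "AE x in R. v x = 0"
        using that integral_nonneg_eq_0_iff_AE[of R v] by auto
      then show ?thesis
        by (intro integral_eq_zero_AE) auto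
    qed
    from this[OF w] this[OF w'] show ?thesis
      using True c by (simp add: c_def)
  next
    case False
    with c have "c > 0" by simp
    note P = normalized_weighted_law[OF w c_def[symmetric] \<open>c > 0\<close> Y(1) A]
    note Q = normalized_weighted_law[OF w' c(2)[symmetric] \<open>c > 0\<close> Y(2) A]
    have "distr (density P (\<lambda>x. ennreal (w x / c))) borel Y =
        distr (density Q (\<lambda>x. ennreal (w' x / c))) borel Y'"
      by (rule Levy_uniqueness[OF P(1) Q(1)]) (use P(2) Q(2) eq in auto)
    then show ?thesis
      using P(3) Q(3) \<open>c > 0\<close> by simp
  qed
qed

text \<open>
  The phase \<open>iexp (\<theta> x)\<close> of the remaining coordinates is absorbed into the nonnegative weights
  \<open>1 + cos \<theta>\<close> and \<open>1 + sin \<theta>\<close>, so that the one-dimensional uniqueness theorem applies.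
\<close>

lemma (in prob_space) integral_weighted_phase:
  fixes c \<theta> Y :: "'a \<Rightarrow> real"
  assumes [measurable]: "c \<in> borel_measurable M" "\<theta> \<in> borel_measurable M" "Y \<in> borel_measurable M"
    and c: "\<And>x. \<bar>c x\<bar> \<le> 1"
  shows "(CLINT x|M. complex_of_real (c x * (1 + cos (\<theta> x))) * iexp (Y x)) =
      (CLINT x|M. c x * iexp (Y x)) +
      ((CLINT x|M. c x * iexp (Y x + \<theta> x)) + (CLINT x|M. c x * iexp (Y x - \<theta> x))) / 2"
    and "(CLINT x|M. complex_of_real (c x * (1 + sin (\<theta> x))) * iexp (Y x)) =
      (CLINT x|M. c x * iexp (Y x)) +
      ((CLINT x|M. c x * iexp (Y x + \<theta> x)) - (CLINT x|M. c x * iexp (Y x - \<theta> x))) / (2 * \<i>)"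
    and "(CLINT x|M. c x * iexp (\<theta> x)) =
      complex_of_real ((\<integral>x. c x * (1 + cos (\<theta> x)) \<partial>M) - (\<integral>x. c x \<partial>M)) +
      \<i> * complex_of_real ((\<integral>x. c x * (1 + sin (\<theta> x)) \<partial>M) - (\<integral>x. c x \<partial>M))"
proof -
  have int: "integrable M (\<lambda>x. c x * iexp (f x))" if [measurable]: "f \<in> borel_measurable M" for f
    by (rule integrable_weighted_iexp) (use c in auto)
  have intr: "integrable M (\<lambda>x. c x * f x)" if [measurable]: "f \<in> borel_measurable M"
    and "\<And>x. \<bar>f x\<bar> \<le> 1" for f :: "'a \<Rightarrow> real"
    by (rule integrable_const_bound[where B=1])
      (use c that in \<open>auto simp: abs_mult intro!: mult_le_one\<close>)
  have "complex_of_real (c x * (1 + cos (\<theta> x))) * iexp (Y x) =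
      c x * iexp (Y x) + (c x * iexp (Y x + \<theta> x) + c x * iexp (Y x - \<theta> x)) / 2" for x
    by (simp add: complex_eq_iff Re_exp Im_exp cos_add cos_diff sin_add sin_diff algebra_simps)
  then show "(CLINT x|M. complex_of_real (c x * (1 + cos (\<theta> x))) * iexp (Y x)) =
      (CLINT x|M. c x * iexp (Y x)) +
      ((CLINT x|M. c x * iexp (Y x + \<theta> x)) + (CLINT x|M. c x * iexp (Y x - \<theta> x))) / 2"
    using int[of Y] int[of "\<lambda>x. Y x + \<theta> x"] int[of "\<lambda>x. Y x - \<theta> x"] by simp
  have "complex_of_real (c x * (1 + sin (\<theta> x))) * iexp (Y x) =
      c x * iexp (Y x) + (c x * iexp (Y x + \<theta> x) - c x * iexp (Y x - \<theta> x)) / (2 * \<i>)" for x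
    by (simp add: complex_eq_iff Re_exp Im_exp Re_divide Im_divide
        cos_add cos_diff sin_add sin_diff algebra_simps power2_eq_square)
  then show "(CLINT x|M. complex_of_real (c x * (1 + sin (\<theta> x))) * iexp (Y x)) =
      (CLINT x|M. c x * iexp (Y x)) +
      ((CLINT x|M. c x * iexp (Y x + \<theta> x)) - (CLINT x|M. c x * iexp (Y x - \<theta> x))) / (2 * \<i>)"
    using int[of Y] int[of "\<lambda>x. Y x + \<theta> x"] int[of "\<lambda>x. Y x - \<theta> x"] by simp
  have "complex_of_real (c x) * iexp (\<theta> x) =
      complex_of_real (c x * cos (\<theta> x)) + \<i> * complex_of_real (c x * sin (\<theta> x))" for x
    by (simp add: complex_eq_iff Re_exp Im_exp)
  then have "(CLINT x|M. c x * iexp (\<theta> x)) =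
      complex_of_real (\<integral>x. c x * cos (\<theta> x) \<partial>M) + \<i> * complex_of_real (\<integral>x. c x * sin (\<theta> x) \<partial>M)"
    using intr[of "\<lambda>x. cos (\<theta> x)"] intr[of "\<lambda>x. sin (\<theta> x)"]
    by (simp del: of_real_mult)
  moreover have "(\<integral>x. c x * (1 + cos (\<theta> x)) \<partial>M) = (\<integral>x. c x \<partial>M) + (\<integral>x. c x * cos (\<theta> x) \<partial>M)"
    using intr[of "\<lambda>x. cos (\<theta> x)"] intr[of "\<lambda>x. 1"] by (simp add: distrib_left)
  moreover have "(\<integral>x. c x * (1 + sin (\<theta> x)) \<partial>M) = (\<integral>x. c x \<partial>M) + (\<integral>x. c x * sin (\<theta> x) \<partial>M)"
    using intr[of "\<lambda>x. sin (\<theta> x)"] intr[of "\<lambda>x. 1"] by (simp add: distrib_left)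
  ultimately show "(CLINT x|M. c x * iexp (\<theta> x)) =
      complex_of_real ((\<integral>x. c x * (1 + cos (\<theta> x)) \<partial>M) - (\<integral>x. c x \<partial>M)) +
      \<i> * complex_of_real ((\<integral>x. c x * (1 + sin (\<theta> x)) \<partial>M) - (\<integral>x. c x \<partial>M))"
    by simp
qed

text \<open>The set \<open>S\<close> collects the coordinates whose phase has already been replaced
  by an indicator. For empty \<open>S\<close> this is the hypothesis, for \<open>S = K\<close> it is
  equality of the laws on rectangles, and each induction step converts one coordinate
  \<open>j\<close>.\<close>

lemma char_eq_imp_rectangle_eq:
  fixes Y :: "'k \<Rightarrow> 'a \<Rightarrow> real" and Y' :: "'k \<Rightarrow> 'b \<Rightarrow> real"
  assumes P: "prob_space P" and Q: "prob_space Q" and "finite K"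
    and Y[measurable]: "\<And>k. k \<in> K \<Longrightarrow> Y k \<in> borel_measurable P"
    and Y'[measurable]: "\<And>k. k \<in> K \<Longrightarrow> Y' k \<in> borel_measurable Q"
    and eq: "\<And>u. (CLINT x|P. iexp (\<Sum>k\<in>K. u k * Y k x)) = (CLINT x|Q. iexp (\<Sum>k\<in>K. u k * Y' k x))"
    and "S \<subseteq> K" and A[measurable]: "\<And>k. k \<in> K \<Longrightarrow> A k \<in> sets borel"
  shows "(CLINT x|P. complex_of_real (\<Prod>k\<in>S. indicator (A k) (Y k x)) * iexp (\<Sum>k\<in>K - S. u k * Y k x)) =
    (CLINT x|Q. complex_of_real (\<Prod>k\<in>S. indicator (A k) (Y' k x)) * iexp (\<Sum>k\<in>K - S. u k * Y' k x))"
proof -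
  have "finite S" using assms finite_subset by auto
  then show ?thesis
    using \<open>S \<subseteq> K\<close>
  proof (induction S arbitrary: u)
    case empty
    then show ?case using eq by simp
  next
    case (insert j S)
    interpret P: prob_space P by fact
    interpret Q: prob_space Q by fact
    have j: "j \<in> K" "j \<notin> S" and "S \<subseteq> K" using insert by auto
    define L where "L = K - insert j S"
    have KS: "K - S = insert j L" "j \<notin> L" "finite L" "L \<subseteq> K"
      using j \<open>finite K\<close> by (auto simp: L_def)
    define c where "c y = (\<Prod>k\<in>S. indicator (A k) (y k) :: real)" for y :: "'k \<Rightarrow> real"
    define \<theta> where "\<theta> y = (\<Sum>k\<in>L. u k * y k)" for y :: "'k \<Rightarrow> real"
    let ?y = "\<lambda>x k. Y k x" and ?y' = "\<lambda>x k. Y' k x"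
    have c: "0 \<le> c y" "\<bar>c y\<bar> \<le> 1" for y
      unfolding c_def by (auto simp: abs_prod intro!: prod_nonneg prod_le_1)
    have meas[measurable]: "(\<lambda>x. c (?y x)) \<in> borel_measurable P" "(\<lambda>x. c (?y' x)) \<in> borel_measurable Q"
        "(\<lambda>x. \<theta> (?y x)) \<in> borel_measurable P" "(\<lambda>x. \<theta> (?y' x)) \<in> borel_measurable Q"
        "Y j \<in> borel_measurable P" "Y' j \<in> borel_measurable Q" "A j \<in> sets borel"
      unfolding c_def \<theta>_def using j \<open>S \<subseteq> K\<close> \<open>L \<subseteq> K\<close>
      by (auto intro!: borel_measurable_prod borel_measurable_sum borel_measurable_times
          measurable_compose[OF Y borel_measurable_indicator]
          measurable_compose[OF Y' borel_measurable_indicator] A Y Y')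
    \<comment> \<open>The induction hypothesis holds for all frequencies, so the remaining phase
      \<open>\<theta>\<close> may be scaled by any \<open>s\<close>; the values 0, 1 and -1 are what
      the weights 1 + cos and 1 + sin require.\<close>
    have IH: "(CLINT x|P. c (?y x) * iexp (v * Y j x + s * \<theta> (?y x))) =
        (CLINT x|Q. c (?y' x) * iexp (v * Y' j x + s * \<theta> (?y' x)))" for v s
    proof -
      have "(\<Sum>k\<in>K - S. (if k = j then v else s * u k) * y k) = v * y j + s * \<theta> y"
        for y
      proof -
        have "(\<Sum>k\<in>L. (if k = j then v else s * u k) * y k) = s * \<theta> y"
          unfolding \<theta>_def sum_distrib_left using KS by (intro sum.cong) auto
        then show ?thesis using KS by simp
      qed
      then show ?thesis
        using insert.IH[of "\<lambda>k. if k = j then v else s * u k"] \<open>S \<subseteq> K\<close>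
        by (simp add: c_def)
    qed
    define d where "d y = c y * indicator (A j) (y j)" for y
    have weight: "(\<integral>x. f x * indicator (A j) (Y j x) \<partial>P) = (\<integral>x. f' x * indicator (A j) (Y' j x) \<partial>Q)"
      if [measurable]: "f \<in> borel_measurable P" "f' \<in> borel_measurable Q"
        and b: "\<And>x. 0 \<le> f x \<and> f x \<le> 2" "\<And>x. 0 \<le> f' x \<and> f' x \<le> 2"
        and e: "\<And>v. (CLINT x|P. f x * iexp (v * Y j x)) = (CLINT x|Q. f' x * iexp (v * Y' j x))"
      for f :: "'a \<Rightarrow> real" and f' :: "'b \<Rightarrow> real"
    proof (rule weighted_law_eqI[OF _ _ _ _ _ _ e])
      show "integrable P f"
        by (rule P.integrable_const_bound[where B=2]) (use b in auto)
      show "integrable Q f'"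
        by (rule Q.integrable_const_bound[where B=2]) (use b in auto)
    qed (use b in auto)
    have le2: "0 \<le> c y * (1 + t) \<and> c y * (1 + t) \<le> 2" if "\<bar>t\<bar> \<le> 1"
      for y t
      using mult_mono[of "c y" 1 "1 + t" 2] c[of y] that by (auto simp: abs_le_iff)
    have le2': "0 \<le> c y \<and> c y \<le> 2" for y
      using c[of y] by auto
    have IH': "(CLINT x|P. c (?y x) * iexp (v * Y j x)) = (CLINT x|Q. c (?y' x) * iexp (v * Y' j x))"
        "(CLINT x|P. c (?y x) * iexp (v * Y j x + \<theta> (?y x))) =
          (CLINT x|Q. c (?y' x) * iexp (v * Y' j x + \<theta> (?y' x)))"
        "(CLINT x|P. c (?y x) * iexp (v * Y j x - \<theta> (?y x))) =
          (CLINT x|Q. c (?y' x) * iexp (v * Y' j x - \<theta> (?y' x)))" for v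
      using IH[of v 0] IH[of v 1] IH[of v "- 1"] by simp_all
    have w1: "(\<integral>x. c (?y x) * indicator (A j) (Y j x) \<partial>P) = (\<integral>x. c (?y' x) * indicator (A j) (Y' j x) \<partial>Q)"
      by (rule weight) (use le2' IH'(1) in auto)
    have w2: "(\<integral>x. c (?y x) * (1 + cos (\<theta> (?y x))) * indicator (A j) (Y j x) \<partial>P) =
        (\<integral>x. c (?y' x) * (1 + cos (\<theta> (?y' x))) * indicator (A j) (Y' j x) \<partial>Q)"
    proof (rule weight)
      fix v show "(CLINT x|P. complex_of_real (c (?y x) * (1 + cos (\<theta> (?y x)))) * iexp (v * Y j x)) =
          (CLINT x|Q. complex_of_real (c (?y' x) * (1 + cos (\<theta> (?y' x)))) * iexp (v * Y' j x))"
        by (subst P.integral_weighted_phase(1), measurable, rule c(2))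
          (subst Q.integral_weighted_phase(1), measurable, rule c(2), simp only: IH')
    qed (use le2 in auto)
    have w3: "(\<integral>x. c (?y x) * (1 + sin (\<theta> (?y x))) * indicator (A j) (Y j x) \<partial>P) =
        (\<integral>x. c (?y' x) * (1 + sin (\<theta> (?y' x))) * indicator (A j) (Y' j x) \<partial>Q)"
    proof (rule weight)
      fix v show "(CLINT x|P. complex_of_real (c (?y x) * (1 + sin (\<theta> (?y x)))) * iexp (v * Y j x)) =
          (CLINT x|Q. complex_of_real (c (?y' x) * (1 + sin (\<theta> (?y' x)))) * iexp (v * Y' j x))"
        by (subst P.integral_weighted_phase(2), measurable, rule c(2))
          (subst Q.integral_weighted_phase(2), measurable, rule c(2), simp only: IH')
    qed (use le2 in auto)
    have d: "(\<lambda>x. d (?y x)) \<in> borel_measurable P" "(\<lambda>x. d (?y' x)) \<in> borel_measurable Q"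
      unfolding d_def by measurable
    have d1: "\<bar>d y\<bar> \<le> 1" for y
      using c[of y] by (auto simp: d_def indicator_def)
    \<comment> \<open>The three nonnegative weights 1, 1 + cos \<theta> and 1 + sin \<theta>
      together recover the complex phase, now with the indicator of coordinate \<open>j\<close>
      included in \<open>d\<close>.\<close>
    have "(CLINT x|P. d (?y x) * iexp (\<theta> (?y x))) = (CLINT x|Q. d (?y' x) * iexp (\<theta> (?y' x)))"
    proof -
      have dw: "(\<integral>x. d (?y x) \<partial>P) = (\<integral>x. d (?y' x) \<partial>Q)"
        "(\<integral>x. d (?y x) * (1 + cos (\<theta> (?y x))) \<partial>P) = (\<integral>x. d (?y' x) * (1 + cos (\<theta> (?y' x))) \<partial>Q)"
        "(\<integral>x. d (?y x) * (1 + sin (\<theta> (?y x))) \<partial>P) = (\<integral>x. d (?y' x) * (1 + sin (\<theta> (?y' x))) \<partial>Q)"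
        using w1 w2 w3 by (simp_all add: d_def mult_ac)
      show ?thesis
        unfolding P.integral_weighted_phase(3)[OF d(1) meas(3) meas(5) d1]
          Q.integral_weighted_phase(3)[OF d(2) meas(4) meas(6) d1] dw ..
    qed
    then show ?case
      using insert.hyps by (simp add: d_def c_def \<theta>_def L_def mult_ac)
  qed
qed

lemma char_eq_imp_distr_PiM_eq:
  fixes Y :: "'k \<Rightarrow> 'a \<Rightarrow> real" and Y' :: "'k \<Rightarrow> 'b \<Rightarrow> real"
  assumes P: "prob_space P" and Q: "prob_space Q" and K: "finite K"
    and Y[measurable]: "\<And>k. k \<in> K \<Longrightarrow> Y k \<in> borel_measurable P"
    and Y'[measurable]: "\<And>k. k \<in> K \<Longrightarrow> Y' k \<in> borel_measurable Q"
    and eq: "\<And>u. (CLINT x|P. iexp (\<Sum>k\<in>K. u k * Y k x)) = (CLINT x|Q. iexp (\<Sum>k\<in>K. u k * Y' k x))"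
  shows "distr P (\<Pi>\<^sub>M k\<in>K. borel) (\<lambda>x. \<lambda>k\<in>K. Y k x) = distr Q (\<Pi>\<^sub>M k\<in>K. borel) (\<lambda>x. \<lambda>k\<in>K. Y' k x)"
proof -
  interpret P: prob_space P by fact
  interpret Q: prob_space Q by fact
  have rectangle: "emeasure (distr R (\<Pi>\<^sub>M k\<in>K. borel) (\<lambda>x. \<lambda>k\<in>K. Z k x)) (Pi\<^sub>E K A) =
      ennreal (\<integral>x. (\<Prod>k\<in>K. indicator (A k) (Z k x)) \<partial>R)"
    if R: "prob_space R" and Z[measurable]: "\<And>k. k \<in> K \<Longrightarrow> Z k \<in> borel_measurable R"
      and A[measurable]: "\<And>k. k \<in> K \<Longrightarrow> A k \<in> sets borel"
    for R :: "'c measure" and Z :: "'k \<Rightarrow> 'c \<Rightarrow> real" and A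
  proof -
    interpret R: prob_space R by fact
    have "emeasure (distr R (\<Pi>\<^sub>M k\<in>K. borel) (\<lambda>x. \<lambda>k\<in>K. Z k x)) (Pi\<^sub>E K A) =
        emeasure R ((\<lambda>x. \<lambda>k\<in>K. Z k x) -` Pi\<^sub>E K A \<inter> space R)"
      using K by (intro emeasure_distr measurable_restrict) (auto intro!: sets_PiM_I_finite)
    also have "(\<lambda>x. \<lambda>k\<in>K. Z k x) -` Pi\<^sub>E K A \<inter> space R = {x \<in> space R. \<forall>k\<in>K. Z k x \<in> A k}"
      by (auto simp: PiE_iff)
    also have "emeasure R {x \<in> space R. \<forall>k\<in>K. Z k x \<in> A k} =
        ennreal (measure R {x \<in> space R. \<forall>k\<in>K. Z k x \<in> A k})"
      by (simp add: R.emeasure_eq_measure)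
    also have "measure R {x \<in> space R. \<forall>k\<in>K. Z k x \<in> A k} =
        (\<integral>x. indicator {x \<in> space R. \<forall>k\<in>K. Z k x \<in> A k} x \<partial>R)"
      by (simp add: Collect_conj_eq Int_absorb2 subset_iff cong: conj_cong)
    also have "\<dots> = (\<integral>x. (\<Prod>k\<in>K. indicator (A k) (Z k x)) \<partial>R)"
    proof (rule Bochner_Integration.integral_cong[OF refl])
      fix x assume "x \<in> space R"
      then show "indicator {x \<in> space R. \<forall>k\<in>K. Z k x \<in> A k} x =
          (\<Prod>k\<in>K. indicator (A k) (Z k x) :: real)"
        using K by (auto simp: indicator_def prod_zero_iff)
    qed
    finally show ?thesis .
  qed
  show ?thesis
  proof (rule measure_eqI_PiM_finite[where I=K and M="\<lambda>_. borel" and A="\<lambda>_. Pi\<^sub>E K (\<lambda>_. UNIV)"])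
    fix A :: "'k \<Rightarrow> real set" assume A: "\<And>i. i \<in> K \<Longrightarrow> A i \<in> sets borel"
    have "complex_of_real (\<integral>x. (\<Prod>k\<in>K. indicator (A k) (Y k x)) \<partial>P) =
        complex_of_real (\<integral>x. (\<Prod>k\<in>K. indicator (A k) (Y' k x)) \<partial>Q)"
      using char_eq_imp_rectangle_eq[OF assms subset_refl A, where u = "\<lambda>_. 0"]
      by (simp del: of_real_prod)
    then show "emeasure (distr P (\<Pi>\<^sub>M k\<in>K. borel) (\<lambda>x. \<lambda>k\<in>K. Y k x)) (Pi\<^sub>E K A) =
        emeasure (distr Q (\<Pi>\<^sub>M k\<in>K. borel) (\<lambda>x. \<lambda>k\<in>K. Y' k x)) (Pi\<^sub>E K A)"
      by (simp add: rectangle[OF P Y A] rectangle[OF Q Y' A])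
  next
    show "range (\<lambda>_ :: nat. \<Pi>\<^sub>E k\<in>K. UNIV) \<subseteq> prod_algebra K (\<lambda>_. borel :: real measure)"
      using K by (auto intro!: prod_algebraI_finite)
    show "emeasure (distr P (\<Pi>\<^sub>M k\<in>K. borel) (\<lambda>x. \<lambda>k\<in>K. Y k x)) (\<Pi>\<^sub>E k\<in>K. UNIV) \<noteq> \<infinity>"
      by (simp add: rectangle[OF P Y])
  qed (use K in \<open>auto simp: space_PiM\<close>)
qed

text \<open>A family of vectors is flattened to a family of reals indexed by pairs (k, i); the
  measurable map \<open>G\<close> reassembles it.\<close>

lemma char_eq_imp_distr_vec_eq:
  fixes Y :: "'k \<Rightarrow> 'a \<Rightarrow> real^'n" and Y' :: "'k \<Rightarrow> 'b \<Rightarrow> real^'n"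
  assumes P: "prob_space P" and Q: "prob_space Q" and K: "finite K"
    and Y[measurable]: "\<And>k. k \<in> K \<Longrightarrow> Y k \<in> borel_measurable P"
    and Y'[measurable]: "\<And>k. k \<in> K \<Longrightarrow> Y' k \<in> borel_measurable Q"
    and eq: "\<And>u. (CLINT x|P. iexp (\<Sum>k\<in>K. Y k x \<bullet> u k)) = (CLINT x|Q. iexp (\<Sum>k\<in>K. Y' k x \<bullet> u k))"
  shows "distr P (\<Pi>\<^sub>M k\<in>K. borel) (\<lambda>x. \<lambda>k\<in>K. Y k x) = distr Q (\<Pi>\<^sub>M k\<in>K. borel) (\<lambda>x. \<lambda>k\<in>K. Y' k x)"
proof -
  define I where "I = K \<times> (UNIV :: 'n set)"
  define G where "G y = (\<lambda>k\<in>K. \<chi> i. y (k, i))" for y :: "'k \<times> 'n \<Rightarrow> real"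
  have "(\<lambda>y. \<chi> i. y (k, i)) \<in> borel_measurable (\<Pi>\<^sub>M p\<in>I. borel :: real measure)" if "k \<in> K" for k
  proof -
    have "(\<lambda>y. y (k, i)) \<in> borel_measurable (\<Pi>\<^sub>M p\<in>I. borel :: real measure)" for i
      using that by (intro measurable_component_singleton) (auto simp: I_def)
    then show ?thesis
      by (subst borel_measurable_euclidean_space) (auto simp: Basis_vec_def inner_axis)
  qed
  then have G: "G \<in> measurable (\<Pi>\<^sub>M p\<in>I. borel) (\<Pi>\<^sub>M k\<in>K. borel)"
    unfolding G_def by (intro measurable_restrict)
  have sum: "(\<Sum>p\<in>I. u p * Z (fst p) x $ snd p) = (\<Sum>k\<in>K. Z k x \<bullet> (\<chi> i. u (k, i)))"
    for Z :: "'k \<Rightarrow> 'c \<Rightarrow> real^'n" and x u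
    by (simp add: I_def inner_vec_def mult.commute sum.cartesian_product split_def)
  have image: "distr R (\<Pi>\<^sub>M k\<in>K. borel) (\<lambda>x. \<lambda>k\<in>K. Z k x) =
      distr (distr R (\<Pi>\<^sub>M p\<in>I. borel) (\<lambda>x. \<lambda>p\<in>I. Z (fst p) x $ snd p)) (\<Pi>\<^sub>M k\<in>K. borel) G"
    if Z: "\<And>k. k \<in> K \<Longrightarrow> Z k \<in> borel_measurable R" for R :: "'c measure" and Z :: "'k \<Rightarrow> 'c \<Rightarrow> real^'n"
  proof -
    have "(\<lambda>x. \<lambda>p\<in>I. Z (fst p) x $ snd p) \<in> measurable R (\<Pi>\<^sub>M p\<in>I. borel)"
      by (intro measurable_restrict measurable_compose[OF Z borel_measurable_nth])
        (auto simp: I_def)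
    moreover have "G (\<lambda>p\<in>I. Z (fst p) x $ snd p) = (\<lambda>k\<in>K. Z k x)" for x
      by (auto simp: G_def I_def fun_eq_iff vec_eq_iff)
    ultimately show ?thesis
      using G by (simp add: distr_distr o_def)
  qed
  have "distr P (\<Pi>\<^sub>M p\<in>I. borel) (\<lambda>x. \<lambda>p\<in>I. Y (fst p) x $ snd p) =
      distr Q (\<Pi>\<^sub>M p\<in>I. borel) (\<lambda>x. \<lambda>p\<in>I. Y' (fst p) x $ snd p)"
  proof (rule char_eq_imp_distr_PiM_eq[OF P Q])
    show "finite I" using K by (simp add: I_def)
    show "(CLINT x|P. iexp (\<Sum>p\<in>I. u p * Y (fst p) x $ snd p)) =
        (CLINT x|Q. iexp (\<Sum>p\<in>I. u p * Y' (fst p) x $ snd p))" for u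
      using eq[of "\<lambda>k. \<chi> i. u (k, i)"] by (simp add: sum)
  qed (use measurable_compose[OF Y borel_measurable_nth]
      measurable_compose[OF Y' borel_measurable_nth] in \<open>auto simp: I_def\<close>)
  then have "distr (distr P (\<Pi>\<^sub>M p\<in>I. borel) (\<lambda>x. \<lambda>p\<in>I. Y (fst p) x $ snd p)) (\<Pi>\<^sub>M k\<in>K. borel) G =
      distr (distr Q (\<Pi>\<^sub>M p\<in>I. borel) (\<lambda>x. \<lambda>p\<in>I. Y' (fst p) x $ snd p)) (\<Pi>\<^sub>M k\<in>K. borel) G"
    by (rule arg_cong)
  moreover note image[of Y P, OF Y] image[of Y' Q, OF Y']
  ultimately show ?thesis
    by (simp only:)
qed

lemma char_eq_imp_distr_eq:
  fixes Y :: "'a \<Rightarrow> real^'n" and Y' :: "'b \<Rightarrow> real^'n"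
  assumes P: "prob_space P" and Q: "prob_space Q"
    and Y[measurable]: "Y \<in> borel_measurable P" and Y'[measurable]: "Y' \<in> borel_measurable Q"
    and eq: "\<And>u. (CLINT x|P. iexp (Y x \<bullet> u)) = (CLINT x|Q. iexp (Y' x \<bullet> u))"
  shows "distr P borel Y = distr Q borel Y'"
proof -
  have eq': "distr P (\<Pi>\<^sub>M k\<in>{()}. borel) (\<lambda>x. \<lambda>k\<in>{()}. Y x) = distr Q (\<Pi>\<^sub>M k\<in>{()}. borel) (\<lambda>x. \<lambda>k\<in>{()}. Y' x)"
    by (rule char_eq_imp_distr_vec_eq[OF P Q]) (use eq in auto)
  have "distr R borel Z = distr (distr R (\<Pi>\<^sub>M k\<in>{()}. borel) (\<lambda>x. \<lambda>k\<in>{()}. Z x)) borel (\<lambda>y. y ())"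
    if [measurable]: "Z \<in> borel_measurable R" for R :: "'c measure" and Z :: "'c \<Rightarrow> real^'n"
    by (subst distr_distr) (auto simp: o_def)
  from this[OF Y] this[OF Y'] show ?thesis
    using eq' by simp
qed

section \<open>Characteristic functions of infinitely divisible laws\<close>

text \<open>Since 1 - cos t = 2 sin^2 (t / 2), this is the addition formula for sin followed by (p +
  q)^2 \<le> 2 p^2 + 2 q^2. All factors 2 in the quasi-triangle inequalities below originate
  here.\<close>

lemma one_minus_cos_add_le: "1 - cos (a + b) \<le> 2 * (1 - cos a) + 2 * (1 - cos b :: real)"
proof -
  have half: "1 - cos t = 2 * (sin (t / 2))\<^sup>2" for t :: real
    using cos_double_sin[of "t / 2"] by simp
  define p where "p = sin (a / 2) * cos (b / 2)"
  define q where "q = cos (a / 2) * sin (b / 2)"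
  have "sin ((a + b) / 2) = p + q"
    by (simp add: add_divide_distrib sin_add p_def q_def)
  then have "(sin ((a + b) / 2))\<^sup>2 \<le> 2 * p\<^sup>2 + 2 * q\<^sup>2"
    using sum_squares_bound[of p q] by (simp add: power2_sum)
  also have "p\<^sup>2 \<le> (sin (a / 2))\<^sup>2"
    using mult_left_mono[of "(cos (b / 2))\<^sup>2" 1 "(sin (a / 2))\<^sup>2"]
    by (simp add: p_def power_mult_distrib abs_square_le_1)
  also have "q\<^sup>2 \<le> (sin (b / 2))\<^sup>2"
    using mult_right_mono[of "(cos (a / 2))\<^sup>2" 1 "(sin (b / 2))\<^sup>2"]
    by (simp add: q_def power_mult_distrib abs_square_le_1)
  finally show ?thesis
    by (simp add: half)
qed

section \<open>Symmetrization and the modulus of a characteristic function\<close>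

lemma distribution_measurable:
  assumes "distribution \<mu>"
  shows "prob_space \<mu>" "measurable \<mu> N = measurable borel N" "space \<mu> = UNIV"
  using assms sets_eq_imp_space_eq[of \<mu> borel]
  by (auto simp: distribution_def cong: measurable_cong_sets)

lemma char_fun_Re_Im:
  assumes "distribution \<mu>"
  shows "Re (char_fun \<mu> u) = (\<integral>x. cos (x \<bullet> u) \<partial>\<mu>)" "Im (char_fun \<mu> u) = (\<integral>x. sin (x \<bullet> u) \<partial>\<mu>)"
proof -
  interpret prob_space \<mu> using assms by (simp add: distribution_def)
  have "integrable \<mu> (\<lambda>x. iexp (x \<bullet> u))"
    by (rule integrable_const_bound[where B=1]) (auto simp: distribution_measurable[OF assms])
  then show "Re (char_fun \<mu> u) = (\<integral>x. cos (x \<bullet> u) \<partial>\<mu>)" "Im (char_fun \<mu> u) = (\<integral>x. sin (x \<bullet> u) \<partial>\<mu>)"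
    by (simp_all add: char_fun_def Re_exp Im_exp flip: integral_Re integral_Im)
qed

lemma char_fun_zero [simp]: "distribution \<mu> \<Longrightarrow> char_fun \<mu> 0 = 1"
  using prob_space.prob_space[of \<mu>] by (simp add: char_fun_def distribution_def)

lemma continuous_on_char_fun:
  fixes \<mu> :: "(real^'n) measure"
  assumes "distribution \<mu>"
  shows "continuous_on UNIV (char_fun \<mu>)"
proof -
  interpret prob_space \<mu> using assms by (simp add: distribution_def)
  show ?thesis
    unfolding continuous_on_sequentially comp_def char_fun_def
  proof (intro ballI allI impI, elim conjE)
    fix u and a :: "real^'n" assume "u \<longlonglongrightarrow> a"
    then show "(\<lambda>n. CLINT x|\<mu>. iexp (x \<bullet> u n)) \<longlonglongrightarrow> (CLINT x|\<mu>. iexp (x \<bullet> a))"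
      by (intro integral_dominated_convergence[where w="\<lambda>_. 1"])
        (auto simp: distribution_measurable[OF assms] intro!: tendsto_intros)
  qed
qed

lemma integral_cos_diff:
  assumes "distribution \<mu>"
  shows "(\<integral>x. 1 - cos ((x - y) \<bullet> u) \<partial>\<mu>) =
    1 - (Re (char_fun \<mu> u) * cos (y \<bullet> u) + Im (char_fun \<mu> u) * sin (y \<bullet> u))"
proof -
  interpret prob_space \<mu> using assms by (simp add: distribution_def)
  have int: "integrable \<mu> (\<lambda>x. cos (x \<bullet> u))" "integrable \<mu> (\<lambda>x. sin (x \<bullet> u))"
    by (rule integrable_const_bound[where B=1]; auto simp: distribution_measurable[OF assms])+
  then show ?thesis
    by (simp add: inner_diff_left cos_diff char_fun_Re_Im[OF assms] prob_space)
qed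

text \<open>
  \<open>1 - |char_fun \<mu> u|\<^sup>2\<close> is the integral of \<open>1 - cos ((x - y) \<bullet> u)\<close> over two independent copies
  \<open>x\<close>, \<open>y\<close>.
\<close>

lemma integral_integral_cos_diff:
  assumes "distribution \<mu>"
  shows "(\<integral>y. (\<integral>x. 1 - cos ((x - y) \<bullet> u) \<partial>\<mu>) \<partial>\<mu>) = 1 - (cmod (char_fun \<mu> u))\<^sup>2"
    and "integrable \<mu> (\<lambda>y. \<integral>x. 1 - cos ((x - y) \<bullet> u) \<partial>\<mu>)"
proof -
  interpret prob_space \<mu> using assms by (simp add: distribution_def)
  have int: "integrable \<mu> (\<lambda>x. cos (x \<bullet> u))" "integrable \<mu> (\<lambda>x. sin (x \<bullet> u))"
    by (rule integrable_const_bound[where B=1]; auto simp: distribution_measurable[OF assms])+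
  then show "(\<integral>y. (\<integral>x. 1 - cos ((x - y) \<bullet> u) \<partial>\<mu>) \<partial>\<mu>) = 1 - (cmod (char_fun \<mu> u))\<^sup>2"
    "integrable \<mu> (\<lambda>y. \<integral>x. 1 - cos ((x - y) \<bullet> u) \<partial>\<mu>)"
    by (simp_all add: integral_cos_diff[OF assms] prob_space cmod_power2[unfolded power2_eq_square] power2_eq_square
        flip: char_fun_Re_Im[OF assms])
qed

text \<open>The cosine inequality is integrated over the symmetrized law, that is, over x - y for
  independent copies x, y.\<close>

lemma char_fun_quasi_triangle:
  assumes "distribution \<mu>"
  shows "1 - (cmod (char_fun \<mu> (u + v)))\<^sup>2 \<le>
    2 * (1 - (cmod (char_fun \<mu> u))\<^sup>2) + 2 * (1 - (cmod (char_fun \<mu> v))\<^sup>2)"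
proof -
  interpret prob_space \<mu> using assms by (simp add: distribution_def)
  let ?f = "\<lambda>u y. \<integral>x. 1 - cos ((x - y) \<bullet> u) \<partial>\<mu>"
  have twice: "(\<integral>x. 2 * f x + 2 * g x \<partial>\<mu>) = 2 * (\<integral>x. f x \<partial>\<mu>) + 2 * (\<integral>x. g x \<partial>\<mu>)"
    if "integrable \<mu> f" "integrable \<mu> g" for f g :: "_ \<Rightarrow> real"
    using that by simp
  have int: "integrable \<mu> (\<lambda>x. 1 - cos ((x - y) \<bullet> u))" for u y
    by (rule integrable_const_bound[where B=2])
      (auto simp: distribution_measurable[OF assms] abs_le_iff intro: order_trans[OF _ cos_ge_minus_one])
  have "?f (u + v) y \<le> (\<integral>x. 2 * (1 - cos ((x - y) \<bullet> u)) + 2 * (1 - cos ((x - y) \<bullet> v)) \<partial>\<mu>)" for y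
  proof (rule integral_mono[OF int])
    show "integrable \<mu> (\<lambda>x. 2 * (1 - cos ((x - y) \<bullet> u)) + 2 * (1 - cos ((x - y) \<bullet> v)))"
      by (intro int Bochner_Integration.integrable_add integrable_mult_right)
    show "1 - cos ((x - y) \<bullet> (u + v)) \<le> 2 * (1 - cos ((x - y) \<bullet> u)) + 2 * (1 - cos ((x - y) \<bullet> v))" for x
      by (simp only: inner_add_right one_minus_cos_add_le)
  qed
  then have "?f (u + v) y \<le> 2 * ?f u y + 2 * ?f v y" for y
    unfolding twice[OF int int] .
  then have "(\<integral>y. ?f (u + v) y \<partial>\<mu>) \<le> (\<integral>y. 2 * ?f u y + 2 * ?f v y \<partial>\<mu>)"
    by (intro integral_mono Bochner_Integration.integrable_add integrable_mult_right integral_integral_cos_diff[OF assms]) auto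
  also have "\<dots> = 2 * (\<integral>y. ?f u y \<partial>\<mu>) + 2 * (\<integral>y. ?f v y \<partial>\<mu>)"
    by (intro twice integral_integral_cos_diff(2)[OF assms])
  finally show ?thesis
    by (simp only: integral_integral_cos_diff(1)[OF assms])
qed

lemma norm_char_fun_le_1: "distribution \<mu> \<Longrightarrow> cmod (char_fun \<mu> u) \<le> 1"
proof -
  assume \<mu>: "distribution \<mu>"
  interpret prob_space \<mu> using \<mu> by (simp add: distribution_def)
  have "cmod (char_fun \<mu> u) \<le> (\<integral>x. cmod (iexp (x \<bullet> u)) \<partial>\<mu>)"
    unfolding char_fun_def by (rule integral_norm_bound)
  then show ?thesis by (simp add: prob_space)
qed

text \<open>A random variable on the unit circle has mean square distance 1 - |c|^2 from its mean c;
  this vanishes when |c| = 1.\<close>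

lemma char_fun_norm_1_imp_AE:
  assumes "distribution \<mu>" "cmod (char_fun \<mu> u) = 1"
  shows "AE x in \<mu>. iexp (x \<bullet> u) = char_fun \<mu> u"
proof -
  interpret prob_space \<mu> using assms by (simp add: distribution_def)
  define c s where "c = Re (char_fun \<mu> u)" and "s = Im (char_fun \<mu> u)"
  have cs: "c\<^sup>2 + s\<^sup>2 = 1" using assms(2) by (simp add: c_def s_def cmod_def)
  have int: "integrable \<mu> (\<lambda>x. cos (x \<bullet> u))" "integrable \<mu> (\<lambda>x. sin (x \<bullet> u))"
    by (rule integrable_const_bound[where B=1]; auto simp: distribution_measurable[OF assms(1)])+
  have sq: "(cmod (iexp (x \<bullet> u) - char_fun \<mu> u))\<^sup>2 = 2 - 2 * (cos (x \<bullet> u) * c + sin (x \<bullet> u) * s)" for x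
    using cs sin_cos_squared_add[of "x \<bullet> u"]
    by (simp add: cmod_power2[unfolded power2_eq_square] Re_exp Im_exp power2_eq_square algebra_simps
        flip: c_def s_def)
  have intsq: "integrable \<mu> (\<lambda>x. 2 - 2 * (cos (x \<bullet> u) * c + sin (x \<bullet> u) * s))"
    using int by auto
  have "(\<integral>x. 2 - 2 * (cos (x \<bullet> u) * c + sin (x \<bullet> u) * s) \<partial>\<mu>) = 0"
    using int cs by (simp add: prob_space power2_eq_square flip: char_fun_Re_Im[OF assms(1)] c_def s_def)
  moreover have "0 \<le> 2 - 2 * (cos (x \<bullet> u) * c + sin (x \<bullet> u) * s)" for x
    unfolding sq[symmetric] by simp
  ultimately have "AE x in \<mu>. 2 - 2 * (cos (x \<bullet> u) * c + sin (x \<bullet> u) * s) = 0"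
    using integral_nonneg_eq_0_iff_AE[OF intsq] by simp
  then show ?thesis
    unfolding sq[symmetric] by simp
qed

lemma iexp_eq_imp:
  assumes "iexp a = iexp b"
  obtains n :: int where "a = b + 2 * of_int n * pi"
proof -
  from assms obtain n :: int where "\<i> * a = \<i> * b + (of_int (2 * n) * pi) * \<i>"
    unfolding exp_eq by blast
  from arg_cong[OF this, of Im] show ?thesis
    by (intro that[of n]) simp
qed

lemma (in prob_space) AE_imp_ex:
  assumes "AE x in M. Q x"
  shows "\<exists>x. Q x"
proof (rule ccontr)
  assume "\<nexists>x. Q x"
  with assms have "AE x in M. False" by simp
  then show False by simp
qed

text \<open>Modulus 1 along the whole line through \<open>v\<close> would fix x \<bullet> v modulo 2
  pi (k + 1) for every k, for almost all x. Two such values differ by less than the period once k is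
  large, so they coincide and the law sits on a hyperplane.\<close>

lemma full_imp_norm_char_fun_neq_1:
  assumes "distribution \<mu>" "full \<mu>" "v \<noteq> 0"
  shows "\<exists>c. cmod (char_fun \<mu> (c *\<^sub>R v)) \<noteq> 1"
proof (rule ccontr)
  interpret prob_space \<mu> using assms by (simp add: distribution_def)
  assume "\<nexists>c. cmod (char_fun \<mu> (c *\<^sub>R v)) \<noteq> 1"
  then have "AE x in \<mu>. \<forall>k::nat. iexp (x \<bullet> (1 / Suc k) *\<^sub>R v) = char_fun \<mu> ((1 / Suc k) *\<^sub>R v)"
    by (intro AE_all_countable[THEN iffD2] allI char_fun_norm_1_imp_AE[OF assms(1)]) auto
  then have ae: "AE x in \<mu>. x \<in> {x. \<forall>k::nat. iexp (x \<bullet> (1 / Suc k) *\<^sub>R v) = char_fun \<mu> ((1 / Suc k) *\<^sub>R v)}"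
    (is "AE x in \<mu>. x \<in> ?G") by simp
  have "\<exists>y. y \<in> ?G"
    by (rule AE_imp_ex[OF ae])
  then obtain y where y: "y \<in> ?G" ..
  have "v \<bullet> x = v \<bullet> y" if x: "x \<in> ?G" for x
  proof (rule ccontr)
    define t where "t = x \<bullet> v - y \<bullet> v"
    assume "v \<bullet> x \<noteq> v \<bullet> y"
    then have t: "t \<noteq> 0" by (simp add: t_def inner_commute)
    obtain k :: nat where "\<bar>t\<bar> / (2 * pi) < real k"
      using reals_Archimedean2 by blast
    then have "\<bar>t\<bar> / (2 * pi) < real (Suc k)" by simp
    then have k: "\<bar>t\<bar> < 2 * pi * Suc k"
      using pi_gt_zero by (simp add: pos_divide_less_eq mult.commute del: of_nat_Suc)
    from x y have "iexp (x \<bullet> (1 / Suc k) *\<^sub>R v) = iexp (y \<bullet> (1 / Suc k) *\<^sub>R v)" by auto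
    then obtain n :: int where n: "x \<bullet> (1 / Suc k) *\<^sub>R v = y \<bullet> (1 / Suc k) *\<^sub>R v + 2 * of_int n * pi"
      by (rule iexp_eq_imp)
    then have "t / Suc k = of_int n * (2 * pi)"
      by (simp add: t_def diff_divide_distrib)
    then have tn: "t = of_int n * (2 * pi * Suc k)" by (simp add: field_simps)
    with t have "n \<noteq> 0" by auto
    then have "1 \<le> \<bar>real_of_int n\<bar>" by linarith
    then have "2 * pi * Suc k \<le> \<bar>t\<bar>"
      unfolding tn abs_mult using mult_right_mono[of 1 "\<bar>real_of_int n\<bar>" "2 * pi * Suc k"] by simp
    with k show False by simp
  qed
  then have "AE x in \<mu>. v \<bullet> x = v \<bullet> y"
    using ae by (auto elim: eventually_mono)
  then show False
    using assms(2,3) by (auto simp: full_def)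
qed

section \<open>Convolution roots and continuous logarithms\<close>

lemma char_fun_distr_sum:
  assumes "distribution \<nu>"
  shows "char_fun (distr (\<Pi>\<^sub>M i\<in>{..<n}. \<nu>) borel (\<lambda>x. \<Sum>i<n. x i)) u = char_fun \<nu> u ^ n"
proof -
  interpret \<nu>: prob_space \<nu> using assms by (simp add: distribution_def)
  interpret product_prob_space "\<lambda>_ :: nat. \<nu>" "{..<n}" by unfold_locales
  have meas: "(\<lambda>x. \<Sum>i<n. x i) \<in> borel_measurable (\<Pi>\<^sub>M i\<in>{..<n}. \<nu>)"
  proof (rule borel_measurable_sum)
    fix i assume "i \<in> {..<n}"
    then have "(\<lambda>x. x i) \<in> measurable (\<Pi>\<^sub>M i\<in>{..<n}. \<nu>) \<nu>"
      by (rule measurable_component_singleton)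
    then show "(\<lambda>x. x i) \<in> borel_measurable (\<Pi>\<^sub>M i\<in>{..<n}. \<nu>)"
      using assms by (simp add: distribution_def cong: measurable_cong_sets)
  qed
  have "char_fun (distr (\<Pi>\<^sub>M i\<in>{..<n}. \<nu>) borel (\<lambda>x. \<Sum>i<n. x i)) u =
      (CLINT x|(\<Pi>\<^sub>M i\<in>{..<n}. \<nu>). (\<Prod>i\<in>{..<n}. iexp (x i \<bullet> u)))"
    unfolding char_fun_def using meas
    by (simp add: integral_distr inner_sum_left sum_distrib_left exp_sum)
  also have "\<dots> = (\<Prod>i\<in>{..<n}. CLINT x|\<nu>. iexp (x \<bullet> u))"
    by (intro product_integral_prod \<nu>.integrable_const_bound[where B=1])
      (auto simp: distribution_measurable[OF assms])
  finally show ?thesis by (simp add: char_fun_def)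
qed

lemma infinitely_divisible_root:
  assumes "infinitely_divisible \<mu>" "n \<ge> 1"
  obtains \<nu> where "distribution \<nu>" "\<And>u. char_fun \<mu> u = char_fun \<nu> u ^ n"
  using assms char_fun_distr_sum unfolding infinitely_divisible_def by metis

text \<open>Where the characteristic function does not vanish, the modulus of its n-th root tends to
  1. For large n the quasi-triangle inequality with u = v then keeps the root away from 0 at 2v.
  Nonvanishing thus spreads by doubling from a neighbourhood of 0 to the whole space.\<close>

lemma infinitely_divisible_char_fun_nonzero:
  assumes \<mu>: "distribution \<mu>" and id: "infinitely_divisible \<mu>"
  shows "char_fun \<mu> u \<noteq> 0"
proof -
  have double: "char_fun \<mu> (2 *\<^sub>R v) \<noteq> 0" if v: "char_fun \<mu> v \<noteq> 0" for v
  proof -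
    have "(\<lambda>n. root n (cmod (char_fun \<mu> v))) \<longlonglongrightarrow> 1"
      using v by (intro LIMSEQ_root_const) simp
    then have "(\<lambda>n. 4 * (1 - (root n (cmod (char_fun \<mu> v)))\<^sup>2)) \<longlonglongrightarrow> 4 * (1 - 1\<^sup>2)"
      by (intro tendsto_intros)
    then have "eventually (\<lambda>n. 4 * (1 - (root n (cmod (char_fun \<mu> v)))\<^sup>2) < 1) sequentially"
      by (rule order_tendstoD) simp
    then obtain n where n: "n \<ge> 1" "4 * (1 - (root n (cmod (char_fun \<mu> v)))\<^sup>2) < 1"
      using eventually_happens[OF eventually_conj[OF eventually_ge_at_top[of 1]]] by fastforce
    obtain \<nu> where \<nu>: "distribution \<nu>" "\<And>u. char_fun \<mu> u = char_fun \<nu> u ^ n"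
      using infinitely_divisible_root[OF id n(1)] by metis
    have root: "root n (cmod (char_fun \<mu> v)) = cmod (char_fun \<nu> v)"
      using n by (simp add: \<nu>(2) norm_power real_root_power_cancel)
    have "1 - (cmod (char_fun \<nu> (v + v)))\<^sup>2 < 1"
      using char_fun_quasi_triangle[OF \<nu>(1), of v v] n(2) unfolding root by linarith
    then have "char_fun \<nu> (v + v) \<noteq> 0"
      by fastforce
    then show ?thesis by (simp only: \<nu>(2) scaleR_2 power_not_zero not_False_eq_True)
  qed
  have "continuous (at 0) (char_fun \<mu>)"
    using continuous_on_char_fun[OF \<mu>] by (simp add: continuous_on_eq_continuous_at)
  then obtain \<delta> where \<delta>: "\<delta> > 0" "\<And>u. norm u < \<delta> \<Longrightarrow> char_fun \<mu> u \<noteq> 0"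
    using continuous_at_avoid[of 0 "char_fun \<mu>" 0] \<mu> by auto
  have scaled: "char_fun \<mu> ((2 ^ k) *\<^sub>R v) \<noteq> 0" if "norm v < \<delta>" for k v
  proof (induction k)
    case (Suc k)
    then show ?case using double[of "2 ^ k *\<^sub>R v"] by simp
  qed (use \<delta> that in auto)
  obtain k where "norm u / \<delta> < 2 ^ k"
    using real_arch_pow[of 2 "norm u / \<delta>"] by auto
  then have "norm ((1 / 2 ^ k) *\<^sub>R u) < \<delta>"
    using \<delta> by (simp add: field_simps)
  from scaled[OF this, of k] show ?thesis by simp
qed

text \<open>The difference of two logarithms takes values in the discrete set of multiples of 2 pi
  i, so by continuity it is constant.\<close>

lemma continuous_log_unique:
  fixes f g :: "'a::real_normed_vector \<Rightarrow> complex"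
  assumes "continuous_on UNIV f" "continuous_on UNIV g" "f 0 = g 0" "\<And>x. exp (f x) = exp (g x)"
  shows "f = g"
proof -
  have diff: "\<exists>n::int. f x - g x = of_int n * (2 * pi * \<i>)" for x
    using assms(4)[of x] by (auto simp: exp_eq)
  have "(\<lambda>x. f x - g x) constant_on UNIV"
  proof (rule continuous_discrete_range_constant)
    show "\<exists>e>0. \<forall>y. y \<in> UNIV \<and> f y - g y \<noteq> f x - g x \<longrightarrow> e \<le> norm (f y - g y - (f x - g x))" for x
    proof (intro exI[of _ "2 * pi"] conjI allI impI)
      fix y assume y: "y \<in> UNIV \<and> f y - g y \<noteq> f x - g x"
      obtain m n :: int where mn: "f x - g x = of_int m * (2 * pi * \<i>)" "f y - g y = of_int n * (2 * pi * \<i>)"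
        using diff by metis
      with y have "n \<noteq> m" by auto
      then have "1 \<le> \<bar>real_of_int (n - m)\<bar>" by linarith
      moreover have "f y - g y - (f x - g x) = of_int (n - m) * (2 * pi * \<i>)"
        by (simp add: mn algebra_simps)
      ultimately show "2 * pi \<le> norm (f y - g y - (f x - g x))"
        using mult_right_mono[of 1 "\<bar>real_of_int (n - m)\<bar>" "2 * pi"]
        by (simp only: norm_mult norm_of_int) (simp add: norm_mult)
    qed simp
  qed (use assms in \<open>auto intro: continuous_on_diff\<close>)
  then have "f x - g x = f 0 - g 0" for x
    by (auto simp: constant_on_def)
  with assms(3) show ?thesis by (simp add: fun_eq_iff)
qed

lemma log_char_properties:
  assumes \<mu>: "distribution \<mu>" and id: "infinitely_divisible \<mu>"
  shows "continuous_on UNIV (log_char \<mu>)" "log_char \<mu> 0 = 0" "char_fun \<mu> u = exp (log_char \<mu> u)"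
proof -
  obtain g where g: "continuous_on UNIV g" "\<And>u. char_fun \<mu> u = exp (g u)"
    using continuous_logarithm_on_contractible[OF continuous_on_char_fun[OF \<mu>] _ infinitely_divisible_char_fun_nonzero[OF assms]]
    by (metis UNIV_I contractible_UNIV)
  \<comment> \<open>A logarithm given by contractibility is determined only up to a multiple of 2 pi
    i; subtracting \<open>g 0\<close> normalizes it at 0 without changing its exponential.\<close>
  have g0: "exp (g 0) = 1" using g(2)[of 0] \<mu> by simp
  have "\<exists>!\<psi>. continuous_on UNIV \<psi> \<and> \<psi> 0 = 0 \<and> (\<forall>u. char_fun \<mu> u = exp (\<psi> u))"
  proof (rule ex1I[of _ "\<lambda>u. g u - g 0"])
    show "continuous_on UNIV (\<lambda>u. g u - g 0) \<and> g 0 - g 0 = 0 \<and> (\<forall>u. char_fun \<mu> u = exp (g u - g 0))"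
      using g g0 by (auto intro!: continuous_intros simp: exp_diff)
    then show "\<psi> = (\<lambda>u. g u - g 0)"
      if "continuous_on UNIV \<psi> \<and> \<psi> 0 = 0 \<and> (\<forall>u. char_fun \<mu> u = exp (\<psi> u))" for \<psi>
      using that by (intro continuous_log_unique) auto
  qed
  from theI'[OF this]
  have "continuous_on UNIV (log_char \<mu>) \<and> log_char \<mu> 0 = 0 \<and> (\<forall>u. char_fun \<mu> u = exp (log_char \<mu> u))"
    unfolding log_char_def .
  then show "continuous_on UNIV (log_char \<mu>)" "log_char \<mu> 0 = 0" "char_fun \<mu> u = exp (log_char \<mu> u)"
    by blast+
qed

lemma log_char_eqI:
  assumes "distribution \<mu>" "infinitely_divisible \<mu>"
    and "continuous_on UNIV \<psi>" "\<psi> 0 = 0" "\<And>u. char_fun \<mu> u = exp (\<psi> u)"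
  shows "log_char \<mu> = \<psi>"
  using log_char_properties[OF assms(1,2)] assms(3-5) by (intro continuous_log_unique) auto

text \<open>The n-th convolution root has squared modulus exp (-2 h / n). The inequality for its
  characteristic function becomes linear in \<open>h\<close> as n grows; \<open>a\<close> and
  \<open>b\<close> are the two sides in the limit.\<close>

lemma Re_log_char_quasi_triangle:
  assumes \<mu>: "distribution \<mu>" and id: "infinitely_divisible \<mu>"
  shows "- Re (log_char \<mu> (u + v)) \<le> 2 * (- Re (log_char \<mu> u)) + 2 * (- Re (log_char \<mu> v))"
proof -
  define h where "h u = - Re (log_char \<mu> u)" for u
  have cmod: "cmod (char_fun \<mu> u) = exp (- h u)" for u
    by (simp add: log_char_properties[OF assms] h_def)
  then have h0: "h u \<ge> 0" for u
    using norm_char_fun_le_1[OF \<mu>, of u] by simp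
  define a where "a = 2 * h (u + v)"
  define b where "b = 4 * h u + 4 * h v"
  have a0: "a \<ge> 0" using h0 by (simp add: a_def)
  have "a \<le> b * (1 + a / real n)" if n: "n \<ge> 1" for n :: nat
  proof -
    obtain \<nu> where \<nu>: "distribution \<nu>" "\<And>u. char_fun \<mu> u = char_fun \<nu> u ^ n"
      using infinitely_divisible_root[OF id n] by metis
    have sq: "(cmod (char_fun \<nu> u))\<^sup>2 = exp (- (2 * h u / n))" for u
    proof -
      have "cmod (char_fun \<nu> u) ^ n = cmod (char_fun \<mu> u)"
        by (simp only: \<nu>(2) norm_power)
      also have "\<dots> = exp (real n * - (h u / n))"
        using n by (simp add: cmod)
      also have "\<dots> = exp (- (h u / n)) ^ n"
        by (rule exp_of_nat_mult)
      finally have "cmod (char_fun \<nu> u) = exp (- (h u / n))"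
        by (rule power_eq_imp_eq_base) (use n in auto)
      then show ?thesis
        using exp_of_nat_mult[of 2 "- (h u / n)"] by simp
    qed
    have "1 - exp (- (a / n)) \<le> 2 * (1 - exp (- (2 * h u / n))) + 2 * (1 - exp (- (2 * h v / n)))"
      using char_fun_quasi_triangle[OF \<nu>(1), of u v] by (simp only: sq a_def)
    also have "1 - exp (- (2 * h u / n)) \<le> 2 * h u / n"
      using exp_ge_add_one_self[of "- (2 * h u / n)"] by linarith
    also have "1 - exp (- (2 * h v / n)) \<le> 2 * h v / n"
      using exp_ge_add_one_self[of "- (2 * h v / n)"] by linarith
    finally have 1: "1 - exp (- (a / n)) \<le> b / n"
      by (simp add: b_def add_divide_distrib)
    \<comment> \<open>Bounding exp (-x) by 1 / (1 + x) makes the left side at least (a / n) / (1 + a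
      / n), which leaves the elementary inequality a \<le> b (1 + a / n).\<close>
    have "exp (- (a / n)) \<le> 1 / (1 + a / n)"
      unfolding exp_minus inverse_eq_divide using a0 n
      by (intro divide_left_mono exp_ge_add_one_self mult_pos_pos) (auto intro: add_pos_nonneg)
    then have "1 - 1 / (1 + a / n) \<le> b / n" using 1 by linarith
    moreover have "1 + a / n > 0" using a0 n by (intro add_pos_nonneg) auto
    then have "1 - 1 / (1 + a / n) = (a / n) / (1 + a / n)"
      by (simp add: field_simps)
    ultimately have "a / n \<le> b / n * (1 + a / n)"
      using \<open>1 + a / n > 0\<close> by (simp only: pos_divide_le_eq)
    then have "a / n * n \<le> b / n * (1 + a / n) * n"
      using n by (intro mult_right_mono) auto
    then show ?thesis using n by simp
  qed
  moreover have "(\<lambda>n. b * (1 + a / real n)) \<longlonglongrightarrow> b * (1 + 0)"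
    by (intro tendsto_intros lim_const_over_n)
  ultimately have "a \<le> b"
    using LIMSEQ_le_const[of _ "b * (1 + 0)" a] by auto
  then show ?thesis by (simp add: a_def b_def h_def)
qed

lemma char_fun_uminus: "distribution \<mu> \<Longrightarrow> char_fun \<mu> (- u) = cnj (char_fun \<mu> u)"
  by (simp add: complex_eq_iff char_fun_Re_Im)

lemma Re_log_char_uminus:
  assumes "distribution \<mu>" "infinitely_divisible \<mu>"
  shows "Re (log_char \<mu> (- u)) = Re (log_char \<mu> u)"
proof -
  have "exp (Re (log_char \<mu> (- u))) = exp (Re (log_char \<mu> u))"
    using char_fun_uminus[OF assms(1), of u] complex_mod_cnj[of "char_fun \<mu> u"]
    by (simp add: log_char_properties[OF assms] flip: norm_exp_eq_Re)
  then show ?thesis by simp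
qed

section \<open>Homogeneous quasi-norms\<close>

text \<open>For zeros the factor 2 is harmless: nonnegativity and evenness make the zero set closed
  under addition and negation, hence a subgroup.\<close>

lemma quasi_norm_multiple_zero:
  fixes h :: "'a::real_vector \<Rightarrow> real"
  assumes "\<And>x. h x \<ge> 0" "\<And>x y. h (x + y) \<le> 2 * h x + 2 * h y" "\<And>x. h (- x) = h x"
    and "h u = 0"
  shows "h (of_int n *\<^sub>R u) = 0"
proof -
  have "h 0 = 0"
    using assms(1)[of 0] assms(2)[of u "- u"] assms(3,4) by simp
  then have nat: "h (real k *\<^sub>R u) = 0" for k
  proof (induction k)
    case (Suc k)
    then have "h (real (Suc k) *\<^sub>R u) \<le> 0"
      using assms(2)[of "real k *\<^sub>R u" u] assms(4) by (simp add: algebra_simps)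
    then show ?case using assms(1) by (simp add: order_antisym)
  qed simp
  show ?thesis
    using nat[of "nat n"] nat[of "nat (- n)"] assms(3)[of "real (nat (- n)) *\<^sub>R u"]
    by (cases "n \<ge> 0") auto
qed

lemma continuous_on_mat_powr_apply:
  fixes A :: "real^'n^'n"
  shows "continuous_on {0<..} (\<lambda>s. mat_powr s A *v u)"
proof -
  have "linear (\<lambda>X :: real^'n^'n. X *v u)"
    by (rule linearI) (simp_all add: matrix_vector_mult_add_rdistrib scaleR_matrix_vector_assoc)
  then have "continuous_on UNIV (\<lambda>X :: real^'n^'n. X *v u)"
    by (simp add: linear_continuous_on linear_conv_bounded_linear)
  from continuous_on_compose2[OF this continuous_on_mat_powr] show ?thesis
    by auto
qed

text \<open>
  The zeros of \<open>h\<close> form a closed subgroup without lines, hence a discrete one. It is invariant under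
  the flow \<open>s\<^sup>A\<close>, so the flow fixes each of its elements, and homogeneity forces \<open>h\<close> to vanish on
  the lines through them.
\<close>

lemma homogeneous_quasi_norm_pos:
  fixes h :: "real^'n \<Rightarrow> real"
  assumes cont: "continuous_on UNIV h"
    and nonneg: "\<And>x. h x \<ge> 0"
    and quasi: "\<And>x y. h (x + y) \<le> 2 * h x + 2 * h y"
    and even: "\<And>x. h (- x) = h x"
    and hom: "\<And>s x. s > 0 \<Longrightarrow> h (mat_powr s A *v x) = s * h x"
    and lines: "\<And>v. v \<noteq> 0 \<Longrightarrow> \<exists>c. h (c *\<^sub>R v) \<noteq> 0"
    and u: "u \<noteq> 0"
  shows "h u > 0"
proof -
  have tendsto: "(\<lambda>k. h (f k)) \<longlonglongrightarrow> h a" if "f \<longlonglongrightarrow> a" for f :: "nat \<Rightarrow> real^'n" and a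
    using continuous_on_tendsto_compose[OF cont that] by simp
  note multiple = quasi_norm_multiple_zero[OF nonneg quasi even]
  have discrete: "\<exists>\<delta>>0. \<forall>x. x \<noteq> 0 \<and> norm x < \<delta> \<longrightarrow> h x \<noteq> 0"
  proof (rule ccontr)
    assume contra: "\<not> ?thesis"
    have "\<exists>x. x \<noteq> 0 \<and> norm x < 1 / Suc k \<and> h x = 0" for k :: nat
      using contra by (auto dest: spec[of _ "1 / Suc k"])
    then obtain x where x: "\<And>k. x k \<noteq> 0" "\<And>k. norm (x k) < 1 / Suc k" "\<And>k. h (x k) = 0"
      by metis
    define w where "w k = (1 / norm (x k)) *\<^sub>R x k" for k
    have "\<forall>k. w k \<in> sphere 0 1"
      using x(1) by (simp add: w_def)
    then obtain v r where v: "v \<in> sphere 0 1" and r: "strict_mono (r :: nat \<Rightarrow> nat)" "(w \<circ> r) \<longlonglongrightarrow> v"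
      using compact_sphere[unfolded compact_def] by metis
    have "v \<noteq> 0" using v by auto
    then obtain c where c: "h (c *\<^sub>R v) \<noteq> 0" using lines by blast
    \<comment> \<open>The multiple \<open>n k\<close> of the zero \<open>x (r k)\<close> differs
      from c times its direction by at most the norm of \<open>x (r k)\<close>. Zeros of
      \<open>h\<close> therefore converge to c v, contradicting continuity.\<close>
    define n where "n k = \<lfloor>c / norm (x (r k))\<rfloor>" for k
    have x0: "(\<lambda>k. norm (x (r k))) \<longlonglongrightarrow> 0"
    proof (rule tendsto_sandwich[OF _ _ tendsto_const])
      show "(\<lambda>k. 1 / Suc (r k)) \<longlonglongrightarrow> 0"
        using LIMSEQ_subseq_LIMSEQ[OF LIMSEQ_inverse_real_of_nat r(1)]
        by (simp add: o_def inverse_eq_divide)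
    qed (use x(2) in \<open>auto intro!: always_eventually less_imp_le\<close>)
    have "(\<lambda>k. of_int (n k) * norm (x (r k)) - c) \<longlonglongrightarrow> 0"
    proof (rule Lim_null_comparison[OF always_eventually x0], rule allI)
      fix k
      have "\<bar>of_int (n k) - c / norm (x (r k))\<bar> \<le> 1"
        unfolding n_def by linarith
      then have "\<bar>of_int (n k) - c / norm (x (r k))\<bar> * norm (x (r k)) \<le> 1 * norm (x (r k))"
        by (intro mult_right_mono) auto
      moreover have "of_int (n k) * norm (x (r k)) - c = (of_int (n k) - c / norm (x (r k))) * norm (x (r k))"
        using x(1)[of "r k"] by (simp add: field_simps)
      ultimately show "norm (of_int (n k) * norm (x (r k)) - c) \<le> norm (x (r k))"
        by (simp add: abs_mult)
    qed
    then have "(\<lambda>k. of_int (n k) * norm (x (r k))) \<longlonglongrightarrow> c"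
      by (simp add: LIM_zero_iff)
    then have "(\<lambda>k. (of_int (n k) * norm (x (r k))) *\<^sub>R w (r k)) \<longlonglongrightarrow> c *\<^sub>R v"
      using r(2) by (intro tendsto_scaleR) (auto simp: o_def)
    then have "(\<lambda>k. of_int (n k) *\<^sub>R x (r k)) \<longlonglongrightarrow> c *\<^sub>R v"
      using x(1) by (simp add: w_def)
    then have "(\<lambda>k. h (of_int (n k) *\<^sub>R x (r k))) \<longlonglongrightarrow> h (c *\<^sub>R v)"
      by (rule tendsto)
    then have "h (c *\<^sub>R v) = 0"
      using multiple[OF x(3)] by (simp add: LIMSEQ_const_iff)
    with c show False by simp
  qed
  then obtain \<delta> where \<delta>: "\<delta> > 0" "\<And>x. x \<noteq> 0 \<Longrightarrow> norm x < \<delta> \<Longrightarrow> h x \<noteq> 0" by blast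
  show ?thesis
  proof (rule ccontr)
    assume "\<not> h u > 0"
    with nonneg[of u] have hu: "h u = 0" by simp
    have "continuous_on {0<..} (\<lambda>s. mat_powr s A *v u - u)"
      by (intro continuous_intros continuous_on_mat_powr_apply)
    then have "continuous (at 1) (\<lambda>s. mat_powr s A *v u - u)"
      by (simp add: continuous_on_eq_continuous_at)
    then obtain d where d: "d > 0" "\<And>s. dist s 1 < d \<Longrightarrow> dist (mat_powr s A *v u - u) 0 < \<delta>"
      using \<delta>(1) unfolding continuous_at_eps_delta by (auto simp: dist_norm)
    \<comment> \<open>Any s different from 1 within distance d of 1 serves: the flow then moves
      \<open>u\<close> by a zero of \<open>h\<close> shorter than \<open>\<delta>\<close>, hence not
      at all.\<close>
    define s where "s = 1 + d / 2"
    have s: "s > 0" "s \<noteq> 1" using d by (auto simp: s_def)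
    have "norm (mat_powr s A *v u - u) < \<delta>"
      using d by (auto simp: s_def dist_norm)
    moreover have "h (mat_powr s A *v u - u) = 0"
      using quasi[of "mat_powr s A *v u" "- u"] nonneg[of "mat_powr s A *v u - u"] hom[OF s(1), of u]
      by (simp add: even hu)
    ultimately have fixed: "mat_powr s A *v u = u"
      using \<delta>(2)[of "mat_powr s A *v u - u"] by auto
    \<comment> \<open>The whole line through \<open>u\<close> is fixed by s^A, so h = s h on it with
      s different from 1.\<close>
    have "h (c *\<^sub>R u) = 0" for c
      using hom[OF s(1), of "c *\<^sub>R u"] fixed s by (simp add: matrix_vector_mult_scaleR)
    then show False using lines[OF u] by auto
  qed
qed

text \<open>
  If an orbit \<open>s\<^sup>A x\<close> stayed outside the unit ball as \<open>s\<close> tends to \<open>0\<close>, it would tend to infinity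
  because \<open>h\<close> tends to \<open>0\<close> along it. Differences of points on the orbit would then attain norm \<open>1\<close>
  while \<open>h\<close> is arbitrarily small there.
\<close>

lemma ex_mat_powr_norm_eq_1:
  fixes h :: "real^'n \<Rightarrow> real"
  assumes cont: "continuous_on UNIV h"
    and pos: "\<And>x. x \<noteq> 0 \<Longrightarrow> h x > 0"
    and quasi: "\<And>x y. h (x + y) \<le> 2 * h x + 2 * h y"
    and even: "\<And>x. h (- x) = h x"
    and hom: "\<And>s x. s > 0 \<Longrightarrow> h (mat_powr s A *v x) = s * h x"
    and x: "x \<noteq> 0"
  shows "\<exists>s>0. norm (mat_powr s A *v x) = 1"
proof -
  define \<gamma> where "\<gamma> s = mat_powr s A *v x" for s
  have \<gamma>: "continuous_on {0<..} \<gamma>"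
    unfolding \<gamma>_def by (rule continuous_on_mat_powr_apply)
  have h\<gamma>: "h (\<gamma> s) = s * h x" if "s > 0" for s
    using hom[OF that] by (simp add: \<gamma>_def)
  have hx: "h x > 0" using pos x by blast
  have minimum: "\<exists>m>0. \<forall>y\<in>K. m \<le> h y" if K: "compact K" "0 \<notin> K" for K :: "(real^'n) set"
  proof (cases "K = {}")
    case False
    then obtain y where "y \<in> K" "\<forall>z\<in>K. h y \<le> h z"
      using continuous_attains_inf[OF K(1) False continuous_on_subset[OF cont subset_UNIV]] by blast
    then show ?thesis using pos[of y] K(2) by metis
  qed (auto intro: exI[of _ 1])
  \<comment> \<open>It is not known whether the orbit crosses the sphere inwards or outwards, so
    both orders of \<open>a\<close> and \<open>b\<close> are covered.\<close>
  have IVT: "\<exists>s>0. f s = 1"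
    if "continuous_on {0<..} f" "a > 0" "b > 0" "f a \<le> 1" "f b \<ge> 1" for f :: "real \<Rightarrow> real" and a b
  proof (cases "a \<le> b")
    case True
    moreover have "continuous_on {a..b} f"
      by (rule continuous_on_subset[OF that(1)]) (use that(2) in auto)
    ultimately show ?thesis
      using IVT'[of f a 1 b] that by (meson less_le_trans)
  next
    case False
    moreover have "continuous_on {b..a} f"
      by (rule continuous_on_subset[OF that(1)]) (use that(3) in auto)
    ultimately show ?thesis
      using IVT2'[of f a 1 b] that by (meson less_le_trans linear)
  qed
  have large: "\<exists>s>0. norm (\<gamma> s) \<ge> 1"
  proof (rule ccontr)
    assume contra: "\<not> ?thesis"
    obtain y where y: "\<forall>z\<in>cball 0 1. h z \<le> h y"
      using continuous_attains_sup[of "cball 0 1" h] continuous_on_subset[OF cont subset_UNIV] by auto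
    \<comment> \<open>With this s, \<open>h (\<gamma> s)\<close> equals |h y| + 1 and exceeds the
      maximum h y of \<open>h\<close> on the unit ball.\<close>
    define s where "s = (\<bar>h y\<bar> + 1) / h x"
    have "s > 0" using hx by (simp add: s_def)
    with contra have "\<gamma> s \<in> cball 0 1" by force
    with y have "h (\<gamma> s) \<le> h y" by blast
    with h\<gamma>[OF \<open>s > 0\<close>] hx show False by (simp add: s_def)
  qed
  have small: "\<exists>s>0. norm (\<gamma> s) \<le> 1"
  proof (rule ccontr)
    assume "\<not> ?thesis"
    then have out: "norm (\<gamma> s) > 1" if "s > 0" for s using that by force
    obtain m where m: "m > 0" "\<And>y. norm y = 1 \<Longrightarrow> m \<le> h y"
      using minimum[of "sphere 0 1"] by auto
    \<comment> \<open>For r \<le> s the quasi-triangle inequality bounds h (\<gamma> r - \<gamma> s)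
      by 4 s h x, which this choice makes equal to m / 2 and hence smaller than the minimum m on the
      sphere.\<close>
    define s where "s = m / (8 * h x)"
    have s: "s > 0" using m hx by (simp add: s_def)
    have "compact (cball 0 (norm (\<gamma> s) + 2) - ball (0 :: real^'n) 1)"
      by (intro compact_diff) auto
    then obtain m' where m': "m' > 0" "\<And>y. 1 \<le> norm y \<Longrightarrow> norm y \<le> norm (\<gamma> s) + 2 \<Longrightarrow> m' \<le> h y"
      using minimum[of "cball 0 (norm (\<gamma> s) + 2) - ball (0 :: real^'n) 1"] by (auto simp: not_less)
    \<comment> \<open>Here h (\<gamma> s') \<le> m' / 2 lies below the minimum m' of
      \<open>h\<close> on the shell between the radii 1 and |\<gamma> s| + 2, so
      \<open>\<gamma> s'\<close> must lie beyond the outer radius.\<close>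
    define s' where "s' = min s (m' / (2 * h x))"
    have s': "s' > 0" "s' \<le> s" using s m' hx by (auto simp: s'_def)
    have "s' * h x < m'"
    proof -
      have "s' * h x \<le> m' / (2 * h x) * h x"
        using hx by (intro mult_right_mono) (auto simp: s'_def)
      then show ?thesis using hx m' by simp
    qed
    then have "norm (\<gamma> s') > norm (\<gamma> s) + 2"
      using m'(2)[of "\<gamma> s'"] out[OF s'(1)] h\<gamma>[OF s'(1)] by force
    then have far: "norm (\<gamma> s' - \<gamma> s) \<ge> 1"
      using norm_triangle_sub[of "\<gamma> s'" "\<gamma> s"] by linarith
    have "continuous_on {s'..s} (\<lambda>r. norm (\<gamma> r - \<gamma> s))"
      using s' by (intro continuous_intros continuous_on_subset[OF \<gamma>]) auto
    then obtain r where r: "s' \<le> r" "r \<le> s" "norm (\<gamma> r - \<gamma> s) = 1"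
      using IVT2'[of "\<lambda>r. norm (\<gamma> r - \<gamma> s)" s 1 s'] far s' by auto
    then have "m \<le> h (\<gamma> r - \<gamma> s)" using m by blast
    also have "\<dots> \<le> 2 * h (\<gamma> r) + 2 * h (\<gamma> s)"
      using quasi[of "\<gamma> r" "- \<gamma> s"] by (simp add: even)
    also have "\<dots> \<le> 4 * (s * h x)"
      using r s' hx by (simp add: h\<gamma>)
    also have "\<dots> = m / 2" using hx by (simp add: s_def)
    finally show False using m by simp
  qed
  from large small obtain a b where ab: "a > 0" "b > 0" "norm (\<gamma> a) \<le> 1" "norm (\<gamma> b) \<ge> 1" by blast
  have "continuous_on {0<..} (\<lambda>s. norm (\<gamma> s))"
    using \<gamma> by (intro continuous_intros)
  from IVT[OF this ab] show ?thesis by (simp add: \<gamma>_def)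
qed

text \<open>Every orbit of the flow other than the origin meets the unit sphere, and along it both
  functions are multiplied by s, so a bound on the sphere suffices. The constant m, the minimum of
  \<open>h\<close> there, is independent of f; this lets z vary when f is \<open>h\<close> composed
  with \<open>cscale z\<close>.\<close>

lemma homogeneous_bound:
  fixes h f :: "real^'n \<Rightarrow> real"
  assumes cont: "continuous_on UNIV h"
    and pos: "\<And>x. x \<noteq> 0 \<Longrightarrow> h x > 0"
    and quasi: "\<And>x y. h (x + y) \<le> 2 * h x + 2 * h y"
    and even: "\<And>x. h (- x) = h x"
    and hom: "\<And>s x. s > 0 \<Longrightarrow> h (mat_powr s A *v x) = s * h x"
  obtains m where "m > 0"
    "\<And>f K x. (\<And>s x. s > 0 \<Longrightarrow> f (mat_powr s A *v x) = s * f x) \<Longrightarrow> (\<And>v. norm v = 1 \<Longrightarrow> f v \<le> K)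
      \<Longrightarrow> x \<noteq> 0 \<Longrightarrow> K \<ge> 0 \<Longrightarrow> f x \<le> K / m * h x"
proof -
  obtain y where y: "y \<in> sphere 0 1" "\<forall>z\<in>sphere 0 1. h y \<le> h z"
    using continuous_attains_inf[of "sphere 0 1" h] continuous_on_subset[OF cont subset_UNIV]
      vector_choose_size[of 1, where 'a = "real^'n"] by force
  show thesis
  proof (rule that)
    show m: "h y > 0" using y(1) by (intro pos) auto
    fix f :: "real^'n \<Rightarrow> real" and K and x :: "real^'n"
    assume f: "\<And>s x. s > 0 \<Longrightarrow> f (mat_powr s A *v x) = s * f x" "\<And>v. norm v = 1 \<Longrightarrow> f v \<le> K"
      and x: "x \<noteq> 0" and K: "K \<ge> 0"
    obtain s where s: "s > 0" "norm (mat_powr s A *v x) = 1"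
      using ex_mat_powr_norm_eq_1[OF cont pos quasi even hom x] by blast
    have "s * f x \<le> K"
      using f(1)[OF s(1), of x] f(2)[OF s(2)] by simp
    also have "K = K / h y * h y" using m by simp
    also have "\<dots> \<le> K / h y * (s * h x)"
    proof (rule mult_left_mono)
      have "h y \<le> h (mat_powr s A *v x)" using y(2) s(2) by simp
      then show "h y \<le> s * h x" by (simp add: hom[OF s(1)])
    qed (use K m in auto)
    finally show "f x \<le> K / h y * h x"
      using mult_le_cancel_left_pos[OF s(1), of "f x" "K / h y * h x"] by (simp add: mult_ac)
  qed
qed

section \<open>Full strictly operator-stable laws\<close>

text \<open>\<open>\<complex>\<^sup>m\<close> is identified with \<open>\<real>\<^sup>2\<^sup>m\<close> as in \<^const>\<open>Re_Im_vec\<close>.\<close>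

definition join_vec :: "real^'m::finite \<Rightarrow> real^'m \<Rightarrow> real^('m + 'm)" where
  "join_vec a b = (\<chi> i. case i of Inl p \<Rightarrow> a $ p | Inr p \<Rightarrow> b $ p)"

text \<open>Scalar multiplication of the complex space in real coordinates. Phase rotations and the
  oscillating factor of the kernel both act through it, and its adjoint is scaling by the
  conjugate.\<close>

definition cscale :: "complex \<Rightarrow> real^('m::finite + 'm) \<Rightarrow> real^('m + 'm)" where
  "cscale z x = (\<chi> i. case i of Inl p \<Rightarrow> Re z * x $ Inl p - Im z * x $ Inr p
     | Inr p \<Rightarrow> Re z * x $ Inr p + Im z * x $ Inl p)"

lemma join_vec_nth [simp]: "join_vec a b $ Inl p = a $ p" "join_vec a b $ Inr p = b $ p"
  by (simp_all add: join_vec_def)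

lemma cscale_nth [simp]: "cscale z x $ Inl p = Re z * x $ Inl p - Im z * x $ Inr p"
  "cscale z x $ Inr p = Re z * x $ Inr p + Im z * x $ Inl p"
  by (simp_all add: cscale_def)

lemma vec_sum_eq_iff: "x = y \<longleftrightarrow> (\<forall>p. x $ Inl p = y $ Inl p) \<and> (\<forall>p. x $ Inr p = y $ Inr p)"
  for x y :: "'a^('m::finite + 'n::finite)"
  by (metis sumE vec_eq_iff)

lemma sum_UNIV_Plus: "(\<Sum>i\<in>UNIV. f i) = (\<Sum>p\<in>UNIV. f (Inl p)) + (\<Sum>p\<in>UNIV. f (Inr p))"
  for f :: "'a::finite + 'b::finite \<Rightarrow> 'c::comm_monoid_add"
  using sum.Plus[of UNIV UNIV f] by (simp add: UNIV_Plus_UNIV)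

lemma inner_join_vec: "x \<bullet> join_vec a b = (\<chi> p. x $ Inl p) \<bullet> a + (\<chi> p. x $ Inr p) \<bullet> b"
  by (simp add: inner_vec_def sum_UNIV_Plus)

lemma cscale_mult: "cscale (z * w) x = cscale z (cscale w x)"
  by (simp add: vec_sum_eq_iff algebra_simps)

lemma cscale_one [simp]: "cscale 1 x = x"
  by (simp add: vec_sum_eq_iff)

lemma cscale_zero [simp]: "cscale 0 x = 0" "cscale z 0 = 0"
  by (simp_all add: vec_sum_eq_iff)

lemma cscale_of_real: "cscale (of_real c) x = c *\<^sub>R x"
  by (simp add: vec_sum_eq_iff)

lemma cscale_add_left: "cscale (z + w) x = cscale z x + cscale w x"
  by (simp add: vec_sum_eq_iff algebra_simps)

lemma cscale_add_right: "cscale z (x + y) = cscale z x + cscale z y"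
  by (simp add: vec_sum_eq_iff algebra_simps)

lemma cscale_diff_left: "cscale (z - w) x = cscale z x - cscale w x"
  by (simp add: vec_sum_eq_iff algebra_simps)

lemma cscale_scaleR: "cscale z (c *\<^sub>R x) = c *\<^sub>R cscale z x"
  by (simp add: vec_sum_eq_iff algebra_simps)

lemma cscale_sum_right: "cscale z (\<Sum>j\<in>J. f j) = (\<Sum>j\<in>J. cscale z (f j))"
  by (induction J rule: infinite_finite_induct) (simp_all add: cscale_add_right)

lemma cscale_eq_0_iff: "cscale z x = 0 \<longleftrightarrow> z = 0 \<or> x = 0"
proof
  assume 0: "cscale z x = 0"
  show "z = 0 \<or> x = 0"
  proof (rule disjCI)
    assume x: "x \<noteq> 0"
    show "z = 0"
    proof (rule ccontr)
      assume "z \<noteq> 0"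
      then have "x = cscale (inverse z) (cscale z x)"
        by (simp flip: cscale_mult)
      with 0 x show False by simp
    qed
  qed
qed auto

lemma inner_cscale: "cscale z x \<bullet> y = x \<bullet> cscale (cnj z) y"
  by (simp add: inner_vec_def sum_UNIV_Plus algebra_simps flip: sum.distrib)

lemma norm_cscale: "norm (cscale z x) = cmod z * norm x"
proof -
  have "cscale z x \<bullet> cscale z x = x \<bullet> cscale (of_real ((cmod z)\<^sup>2)) x"
    by (simp only: inner_cscale complex_norm_square mult.commute[of z] cscale_mult)
  then have "(norm (cscale z x))\<^sup>2 = (cmod z * norm x)\<^sup>2"
    by (simp only: cscale_of_real power2_norm_eq_inner inner_scaleR_right power_mult_distrib)
  then show ?thesis
    by (simp add: power2_eq_iff_nonneg)
qed

lemma bounded_bilinear_cscale: "bounded_bilinear cscale"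
proof
  show "\<exists>K. \<forall>z x. norm (cscale z x) \<le> norm z * norm x * K"
    by (intro exI[of _ 1]) (simp add: norm_cscale)
qed (simp_all add: cscale_add_left cscale_add_right cscale_scaleR vec_sum_eq_iff algebra_simps)

lemmas continuous_on_cscale [continuous_intros] =
  bounded_bilinear.continuous_on[OF bounded_bilinear_cscale]

lemma linear_join_vec_zero: "linear (\<lambda>a. join_vec a 0)"
  by (rule linearI) (simp_all add: vec_sum_eq_iff)

section \<open>Block matrices, phase rotations and the sum of B with itself\<close>

lemma block_matrix_mult_vec:
  "block_matrix A B C D *v x =
    join_vec (A *v (\<chi> p. x $ Inl p) + B *v (\<chi> p. x $ Inr p)) (C *v (\<chi> p. x $ Inl p) + D *v (\<chi> p. x $ Inr p))"
  by (simp add: vec_sum_eq_iff block_matrix_def matrix_vector_mult_def sum_UNIV_Plus)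

lemma phase_rotation_mult_vec:
  fixes x :: "real^('m::finite + 'm)"
  shows "block_matrix (cos \<beta> *\<^sub>R mat 1) (sin \<beta> *\<^sub>R mat 1) (- (sin \<beta> *\<^sub>R mat 1)) (cos \<beta> *\<^sub>R mat 1) *v x
    = cscale (cis (- \<beta>)) x"
proof -
  have "- (a *\<^sub>R mat 1) *v y = - (a *\<^sub>R y)" "(a *\<^sub>R mat 1) *v y = a *\<^sub>R y" for a and y :: "real^'m"
    by (simp_all add: scaleR_matrix_vector_assoc[symmetric] flip: scaleR_minus_left)
  then show ?thesis
    by (simp add: block_matrix_mult_vec vec_sum_eq_iff)
qed

lemma direct_sum_mult_vec:
  "direct_sum B *v x = join_vec (B *v (\<chi> p. x $ Inl p)) (B *v (\<chi> p. x $ Inr p))"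
  by (simp add: direct_sum_def block_matrix_mult_vec)

lemma direct_sum_mult_join_vec: "direct_sum B *v join_vec a b = join_vec (B *v a) (B *v b)"
  by (simp add: direct_sum_mult_vec)

text \<open>Equality of the two diagonal blocks makes their sum complex linear. Complex scaling
  therefore commutes with the flow under which \<open>h\<close> is homogeneous.\<close>

lemma direct_sum_cscale: "direct_sum B *v cscale z x = cscale z (direct_sum B *v x)"
  by (simp add: direct_sum_mult_vec vec_sum_eq_iff)
    (simp add: matrix_vector_mult_def sum_distrib_left algebra_simps sum_subtractf sum.distrib)

lemma direct_sum_mult: "direct_sum A ** direct_sum B = direct_sum (A ** B)"
  by (simp add: matrix_eq direct_sum_mult_vec matrix_vector_mul_assoc[symmetric] del: matrix_vector_mul_assoc)

lemma transpose_direct_sum: "transpose (direct_sum B) = direct_sum (transpose B)"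
  by (auto simp: direct_sum_def block_matrix_def transpose_def vec_eq_iff split: sum.split)

lemma mat_powr_direct_sum: "mat_powr s (direct_sum B) = direct_sum (mat_powr s B)"
proof -
  have lin: "linear (direct_sum :: real^'a^'a \<Rightarrow> _)"
    by (rule linearI) (auto simp: direct_sum_def block_matrix_def vec_eq_iff split: sum.split)
  have "direct_sum (mat_power A k) = mat_power (direct_sum A) k" for k and A :: "real^'a^'a"
  proof (induction k)
    case 0
    then show ?case
      by (auto simp: direct_sum_def block_matrix_def mat_def vec_eq_iff split: sum.split)
  qed (simp add: mat_power_Suc flip: direct_sum_mult)
  then show ?thesis
    by (simp add: mat_powr_def mat_exp_cong_linear[OF lin] linear_cmul[OF lin] linear_0[OF lin])
qed

locale full_stable_law =
  fixes \<mu> :: "(real^('m::finite + 'm)) measure" and B :: "real^'m^'m"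
  assumes distr: "distribution \<mu>" and full: "full \<mu>"
    and stable: "strictly_operator_stable_exponent \<mu> (direct_sum B)"
begin

definition h :: "real^('m + 'm) \<Rightarrow> real" where
  "h x = - Re (log_char \<mu> x)"

lemma infdiv: "infinitely_divisible \<mu>"
  using stable by (simp add: strictly_operator_stable_exponent_def)

lemma continuous_log_char: "continuous_on UNIV (log_char \<mu>)"
  and log_char_0 [simp]: "log_char \<mu> 0 = 0"
  and char_fun_eq: "char_fun \<mu> u = exp (log_char \<mu> u)"
  using log_char_properties[OF distr infdiv] by auto

lemma log_char_homogeneous:
  "s > 0 \<Longrightarrow> log_char \<mu> (direct_sum (mat_powr s (transpose B)) *v x) = s * log_char \<mu> x"
  using stable
  by (simp add: strictly_operator_stable_exponent_def transpose_direct_sum mat_powr_direct_sum)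

lemma h_homogeneous: "s > 0 \<Longrightarrow> h (mat_powr s (direct_sum (transpose B)) *v x) = s * h x"
  by (simp add: h_def log_char_homogeneous mat_powr_direct_sum)

lemma continuous_h: "continuous_on UNIV h"
  unfolding h_def[abs_def] by (intro continuous_intros continuous_log_char)

lemma h_nonneg: "h x \<ge> 0"
  using norm_char_fun_le_1[OF distr, of x] by (simp add: char_fun_eq h_def)

lemma h_0 [simp]: "h 0 = 0"
  by (simp add: h_def)

lemma h_quasi: "h (x + y) \<le> 2 * h x + 2 * h y"
  using Re_log_char_quasi_triangle[OF distr infdiv, of x y] by (simp add: h_def)

lemma h_uminus: "h (- x) = h x"
  using Re_log_char_uminus[OF distr infdiv] by (simp add: h_def)

lemma h_pos: "x \<noteq> 0 \<Longrightarrow> h x > 0"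
proof (rule homogeneous_quasi_norm_pos[OF continuous_h h_nonneg h_quasi h_uminus h_homogeneous])
  fix v :: "real^('m + 'm)" assume "v \<noteq> 0"
  then obtain c where "cmod (char_fun \<mu> (c *\<^sub>R v)) \<noteq> 1"
    using full_imp_norm_char_fun_neq_1[OF distr full] by blast
  then show "\<exists>c. h (c *\<^sub>R v) \<noteq> 0"
    by (intro exI[of _ c]) (simp add: char_fun_eq h_def)
qed

text \<open>The modulus of \<open>log_char \<mu>\<close> is homogeneous under the same flow as
  \<open>h\<close> and bounded on the sphere. Thus the real part alone controls the imaginary part
  as well.\<close>

lemma ex_log_char_bound: "\<exists>C\<ge>0. \<forall>x. cmod (log_char \<mu> x) \<le> C * h x"
proof -
  obtain m where m: "m > 0"
    "\<And>f K x. (\<And>s x. s > 0 \<Longrightarrow> f (mat_powr s (direct_sum (transpose B)) *v x) = s * f x) \<Longrightarrow>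
      (\<And>v. norm v = 1 \<Longrightarrow> f v \<le> K) \<Longrightarrow> x \<noteq> 0 \<Longrightarrow> K \<ge> 0 \<Longrightarrow> f x \<le> K / m * h x"
    by (rule homogeneous_bound[OF continuous_h h_pos h_quasi h_uminus h_homogeneous]) blast+
  have "bounded (log_char \<mu> ` sphere 0 1)"
    by (intro compact_imp_bounded compact_continuous_image continuous_on_subset[OF continuous_log_char]) auto
  then obtain K where K: "K > 0" "\<And>x. norm x = 1 \<Longrightarrow> cmod (log_char \<mu> x) \<le> K"
    by (auto simp: bounded_pos)
  have "cmod (log_char \<mu> x) \<le> K / m * h x" for x
  proof (cases "x = 0")
    case False
    then show ?thesis
      using K by (intro m(2)) (auto simp: mat_powr_direct_sum log_char_homogeneous norm_mult)
  qed simp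
  then show ?thesis using K m(1) by (intro exI[of _ "K / m"]) simp
qed

text \<open>Scaling by \<open>z\<close> commutes with the flow, so h (z x) is homogeneous in x; for
  |z| \<le> 1 it is bounded on the unit sphere by the maximum of \<open>h\<close> on the unit ball,
  uniformly in z.\<close>

lemma ex_h_cscale_bound: "\<exists>C\<ge>0. \<forall>z x. cmod z \<le> 1 \<longrightarrow> h (cscale z x) \<le> C * h x"
proof -
  obtain m where m: "m > 0"
    "\<And>f K x. (\<And>s x. s > 0 \<Longrightarrow> f (mat_powr s (direct_sum (transpose B)) *v x) = s * f x) \<Longrightarrow>
      (\<And>v. norm v = 1 \<Longrightarrow> f v \<le> K) \<Longrightarrow> x \<noteq> 0 \<Longrightarrow> K \<ge> 0 \<Longrightarrow> f x \<le> K / m * h x"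
    by (rule homogeneous_bound[OF continuous_h h_pos h_quasi h_uminus h_homogeneous]) blast+
  have "bounded (h ` cball 0 1)"
    by (intro compact_imp_bounded compact_continuous_image continuous_on_subset[OF continuous_h]) auto
  then obtain K where K: "K > 0" "\<And>x. norm x \<le> 1 \<Longrightarrow> h x \<le> K"
    by (auto simp: bounded_pos abs_le_iff)
  have "h (cscale z x) \<le> K / m * h x" if z: "cmod z \<le> 1" for z x
  proof (cases "x = 0")
    case False
    show ?thesis
    proof (rule m(2)[OF _ _ False])
      show "h (cscale z (mat_powr s (direct_sum (transpose B)) *v x)) = s * h (cscale z x)" if "s > 0" for s x
        using h_homogeneous[OF that, of "cscale z x"] by (simp add: mat_powr_direct_sum direct_sum_cscale)
      show "h (cscale z v) \<le> K" if "norm v = 1" for v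
        using z that by (intro K) (simp add: norm_cscale)
    qed (use K in auto)
  qed simp
  then show ?thesis using K m(1) by (intro exI[of _ "K / m"]) simp
qed

text \<open>Invariance of the law gives invariance of the characteristic function under the adjoint
  rotation; uniqueness of the normalized continuous logarithm lifts it to
  \<open>log_char \<mu>\<close>.\<close>

lemma log_char_rotation_invariant:
  assumes inv: "\<And>A. A \<in> phase_rotations \<Longrightarrow> distr \<mu> borel (\<lambda>x. A *v x) = \<mu>"
    and z: "cmod z = 1"
  shows "log_char \<mu> (cscale z x) = log_char \<mu> x"
proof -
  obtain \<beta> where \<beta>: "0 \<le> \<beta>" "\<beta> < 2 * pi" "z = cis \<beta>"
    using z sincos_total_2pi[of "Re z" "Im z"] by (metis cis.ctr cmod_unit_one complex.collapse cmod_power2 one_power2)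
  let ?A = "block_matrix (cos \<beta> *\<^sub>R mat 1) (sin \<beta> *\<^sub>R mat 1) (- (sin \<beta> *\<^sub>R mat 1)) (cos \<beta> *\<^sub>R mat 1)
    :: real^('m + 'm)^('m + 'm)"
  have "distr \<mu> borel (\<lambda>x. ?A *v x) = \<mu>"
    using \<beta> by (intro inv) (auto simp: phase_rotations_def)
  then have rot: "distr \<mu> borel (cscale (cis (- \<beta>))) = \<mu>"
    by (simp add: phase_rotation_mult_vec)
  have meas: "cscale (cis (- \<beta>)) \<in> borel_measurable \<mu>"
    unfolding distribution_measurable(2)[OF distr]
    by (intro borel_measurable_continuous_onI continuous_intros)
  have "log_char \<mu> = (\<lambda>x. log_char \<mu> (cscale z x))"
  proof (rule log_char_eqI[OF distr infdiv])
    show "continuous_on UNIV (\<lambda>x. log_char \<mu> (cscale z x))"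
      by (rule continuous_on_compose2[OF continuous_log_char]) (auto intro!: continuous_intros)
    fix u
    have "char_fun \<mu> u = char_fun (distr \<mu> borel (cscale (cis (- \<beta>)))) u"
      using rot by simp
    also have "\<dots> = (CLINT x|\<mu>. iexp (cscale (cis (- \<beta>)) x \<bullet> u))"
      unfolding char_fun_def by (rule integral_distr[OF meas]) simp
    also have "\<dots> = char_fun \<mu> (cscale z u)"
      unfolding char_fun_def by (simp add: inner_cscale \<beta>(3) cis_cnj)
    finally show "char_fun \<mu> u = exp (log_char \<mu> (cscale z u))"
      by (simp add: char_fun_eq)
  qed simp
  then show ?thesis by metis
qed

end

section \<open>Integration of simple functions\<close>

lemma cmod_iexp_diff_le: "cmod (iexp a - iexp b) \<le> \<bar>a - b\<bar>" "cmod (iexp a - iexp b) \<le> 2"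
proof -
  have "iexp a - iexp b = iexp b * (iexp (a - b) - 1)"
    by (simp add: algebra_simps flip: exp_add)
  then have "cmod (iexp a - iexp b) = cmod (iexp (a - b) - 1)"
    by (simp add: norm_mult)
  then show "cmod (iexp a - iexp b) \<le> \<bar>a - b\<bar>"
    using iexp_approx1[of "a - b" 0] by simp
  show "cmod (iexp a - iexp b) \<le> 2"
    using norm_triangle_ineq4[of "iexp a" "iexp b"] by simp
qed

text \<open>A nonempty T stands for the atom of points lying in exactly the sets with index in T.
  The identity regroups a sum over overlapping sets into a sum over disjoint atoms.\<close>

lemma sum_nonempty_subsets_swap:
  fixes g :: "nat set \<Rightarrow> nat \<Rightarrow> 'a::comm_monoid_add"
  shows "(\<Sum>j<n. \<Sum>T\<in>{T\<in>Pow {..<n} - {{}}. j \<in> T}. g T j) = (\<Sum>T\<in>Pow {..<n} - {{}}. \<Sum>j\<in>T. g T j)"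
proof -
  have "(\<Sum>j<n. \<Sum>T\<in>{T\<in>Pow {..<n} - {{}}. j \<in> T}. g T j) =
      (\<Sum>T\<in>Pow {..<n} - {{}}. \<Sum>j\<in>{j\<in>{..<n}. j \<in> T}. g T j)"
    by (rule sum.swap_restrict) auto
  also have "\<dots> = (\<Sum>T\<in>Pow {..<n} - {{}}. \<Sum>j\<in>T. g T j)"
    by (intro sum.cong) auto
  finally show ?thesis .
qed

locale stable_random_measure = full_stable_law \<mu> B
  for \<mu> :: "(real^('m::finite + 'm)) measure" and B :: "real^'m^'m" +
  fixes P :: "'w measure" and M :: "(real^'d) set \<Rightarrow> 'w \<Rightarrow> real^('m + 'm)"
  assumes scattered: "indep_scattered_random_measure P \<mu> M"
begin

sublocale prob_space P
  using scattered by (simp add: indep_scattered_random_measure_def)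

lemma measurable_M [measurable]: "A \<in> finite_measure_sets \<Longrightarrow> M A \<in> borel_measurable P"
  using scattered by (simp add: indep_scattered_random_measure_def)

lemma char_M:
  "A \<in> finite_measure_sets \<Longrightarrow>
    (CLINT \<omega>|P. iexp (M A \<omega> \<bullet> u)) = exp (complex_of_real (measure lborel A) * log_char \<mu> u)"
  using scattered by (simp add: indep_scattered_random_measure_def)

lemma M_sequence:
  assumes "range A \<subseteq> finite_measure_sets" "disjoint_family A"
  shows "indep_vars (\<lambda>_. borel) (\<lambda>n :: nat. M (A n)) UNIV"
    and "(\<Union>n. A n) \<in> finite_measure_sets \<Longrightarrow> AE \<omega> in P. (\<lambda>n. M (A n) \<omega>) sums M (\<Union>n. A n) \<omega>"
  using scattered assms unfolding indep_scattered_random_measure_def by blast+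

section \<open>Additivity and independence for finite families\<close>

lemma empty_finite_measure: "{} \<in> finite_measure_sets"
  by (simp add: finite_measure_sets_def)

lemma finite_measure_sets_subset:
  assumes "A \<in> finite_measure_sets" "C \<in> sets borel" "C \<subseteq> A"
  shows "C \<in> finite_measure_sets"
  using assms emeasure_mono[of C A lborel] by (auto simp: finite_measure_sets_def)

lemma finite_measure_sets_UN:
  assumes "finite I" "\<And>i. i \<in> I \<Longrightarrow> A i \<in> finite_measure_sets"
  shows "(\<Union>i\<in>I. A i) \<in> finite_measure_sets"
proof -
  have "emeasure lborel (\<Union>i\<in>I. A i) \<le> (\<Sum>i\<in>I. emeasure lborel (A i))"
    using assms by (intro emeasure_subadditive_finite) (auto simp: finite_measure_sets_def)
  also have "\<dots> < \<infinity>"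
    using assms by (auto simp: finite_measure_sets_def ennreal_sum_less_top infinity_ennreal_def)
  finally show ?thesis
    using assms by (auto simp: finite_measure_sets_def)
qed

text \<open>Countable additivity for the constant sequence of empty sets makes a constant series
  converge, so its terms vanish.\<close>

lemma M_empty: "AE \<omega> in P. M {} \<omega> = 0"
proof -
  have "AE \<omega> in P. (\<lambda>n :: nat. M {} \<omega>) sums M (\<Union>n :: nat. {}) \<omega>"
    by (intro M_sequence) (auto simp: empty_finite_measure disjoint_family_on_def)
  then show ?thesis
  proof eventually_elim
    case (elim \<omega>)
    then have "(\<lambda>n :: nat. M {} \<omega>) \<longlonglongrightarrow> 0"
      by (intro summable_LIMSEQ_zero sums_summable)
    then show ?case by (simp add: LIMSEQ_const_iff)
  qed
qed

text \<open>Independence and additivity are given for sequences, so the family is enumerated by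
  \<open>e\<close> and padded with empty sets, whose random measure is almost surely 0.\<close>

lemma M_finite_family:
  assumes I: "finite I" and A: "\<And>i. i \<in> I \<Longrightarrow> A i \<in> finite_measure_sets" "disjoint_family_on A I"
  shows "\<exists>e. bij_betw e {0..<card I} I \<and> indep_vars (\<lambda>_. borel) (\<lambda>k. M (A (e k))) {0..<card I}"
    and "AE \<omega> in P. M (\<Union>i\<in>I. A i) \<omega> = (\<Sum>i\<in>I. M (A i) \<omega>)"
proof -
  obtain e where e: "bij_betw e {0..<card I} I"
    using ex_bij_betw_nat_finite[OF I] by blast
  define A' where "A' k = (if k < card I then A (e k) else {})" for k
  have range: "range A' \<subseteq> finite_measure_sets"
    using A(1) bij_betwE[OF e] by (auto simp: A'_def empty_finite_measure)
  have disj: "disjoint_family A'"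
    unfolding disjoint_family_on_def
  proof (intro ballI impI)
    fix k l :: nat assume "k \<noteq> l"
    show "A' k \<inter> A' l = {}"
    proof (cases "k < card I \<and> l < card I")
      case True
      then have "e k \<noteq> e l" "e k \<in> I" "e l \<in> I"
        using \<open>k \<noteq> l\<close> bij_betwE[OF e] inj_onD[OF bij_betw_imp_inj_on[OF e], of k l] by auto
      with True A(2) show ?thesis
        by (simp add: A'_def disjoint_family_on_def)
    qed (auto simp: A'_def)
  qed
  have "indep_vars (\<lambda>_. borel) (\<lambda>k. M (A' k)) {0..<card I}"
    using M_sequence(1)[OF range disj] by (rule indep_vars_subset) simp
  then have "indep_vars (\<lambda>_. borel) (\<lambda>k. M (A (e k))) {0..<card I}"
    by (rule indep_vars_cong[THEN iffD1, rotated -1]) (auto simp: A'_def)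
  with e show "\<exists>e. bij_betw e {0..<card I} I \<and> indep_vars (\<lambda>_. borel) (\<lambda>k. M (A (e k))) {0..<card I}"
    by blast
  have UN: "(\<Union>k. A' k) = (\<Union>i\<in>I. A i)"
  proof -
    have "(\<Union>k. A' k) = (\<Union>k\<in>{0..<card I}. A (e k))"
      by (auto simp: A'_def split: if_splits)
    also have "\<dots> = (\<Union>i\<in>e ` {0..<card I}. A i)" by simp
    finally show ?thesis by (simp only: bij_betw_imp_surj_on[OF e])
  qed
  have "AE \<omega> in P. (\<lambda>k. M (A' k) \<omega>) sums M (\<Union>i\<in>I. A i) \<omega>"
    using M_sequence(2)[OF range disj] finite_measure_sets_UN[OF I A(1)] by (simp add: UN)
  then show "AE \<omega> in P. M (\<Union>i\<in>I. A i) \<omega> = (\<Sum>i\<in>I. M (A i) \<omega>)"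
    using M_empty
  proof eventually_elim
    case (elim \<omega>)
    have "(\<lambda>k. M (A' k) \<omega>) sums (\<Sum>k\<in>{0..<card I}. M (A' k) \<omega>)"
      by (rule sums_finite) (auto simp: A'_def elim)
    with elim(1) have "M (\<Union>i\<in>I. A i) \<omega> = (\<Sum>k\<in>{0..<card I}. M (A' k) \<omega>)"
      by (rule sums_unique2)
    also have "\<dots> = (\<Sum>i\<in>I. M (A i) \<omega>)"
      using sum.reindex_bij_betw[OF e, of "\<lambda>i. M (A i) \<omega>"] by (simp add: A'_def)
    finally show ?case .
  qed
qed

lemma char_M_finite_family:
  assumes I: "finite I" and A: "\<And>i. i \<in> I \<Longrightarrow> A i \<in> finite_measure_sets" "disjoint_family_on A I"
  shows "(CLINT \<omega>|P. iexp (\<Sum>i\<in>I. M (A i) \<omega> \<bullet> r i)) =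
    exp (\<Sum>i\<in>I. complex_of_real (measure lborel (A i)) * log_char \<mu> (r i))"
proof -
  obtain e where e: "bij_betw e {0..<card I} I"
    and indep: "indep_vars (\<lambda>_. borel) (\<lambda>k. M (A (e k))) {0..<card I}"
    using M_finite_family(1)[OF assms] by blast
  have A': "A (e k) \<in> finite_measure_sets" if "k \<in> {0..<card I}" for k
    using bij_betwE[OF e] that by (intro A) auto
  have "(CLINT \<omega>|P. iexp (\<Sum>i\<in>I. M (A i) \<omega> \<bullet> r i)) =
      (CLINT \<omega>|P. (\<Prod>k\<in>{0..<card I}. iexp (M (A (e k)) \<omega> \<bullet> r (e k))))"
    by (simp add: sum_distrib_left exp_sum flip: sum.reindex_bij_betw[OF e])
  also have "\<dots> = (\<Prod>k\<in>{0..<card I}. CLINT \<omega>|P. iexp (M (A (e k)) \<omega> \<bullet> r (e k)))"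
  proof (rule indep_vars_lebesgue_integral)
    show "indep_vars (\<lambda>_. borel) (\<lambda>k \<omega>. iexp (M (A (e k)) \<omega> \<bullet> r (e k))) {0..<card I}"
      by (rule indep_vars_compose2[OF indep]) measurable
    show "integrable P (\<lambda>\<omega>. iexp (M (A (e k)) \<omega> \<bullet> r (e k)))" if "k \<in> {0..<card I}" for k
      using A'[OF that] by (intro integrable_const_bound[where B=1]) auto
  qed simp
  also have "\<dots> = (\<Prod>k\<in>{0..<card I}. exp (complex_of_real (measure lborel (A (e k))) * log_char \<mu> (r (e k))))"
    by (intro prod.cong refl char_M A')
  also have "\<dots> = exp (\<Sum>i\<in>I. complex_of_real (measure lborel (A i)) * log_char \<mu> (r i))"
    by (simp add: exp_sum flip: sum.reindex_bij_betw[OF e])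
  finally show ?thesis .
qed

text \<open>
  A list of pairs \<open>(A, r)\<close> represents the vector-valued simple function \<open>\<Sum> 1\<^bsub>A\<^esub> r\<close>. The sets need
  not be disjoint, so that sums of simple functions correspond to concatenations.
\<close>

definition simple_list :: "((real^'d) set \<times> (real^('m + 'm))) list \<Rightarrow> bool" where
  "simple_list xs \<longleftrightarrow> (\<forall>(A, r)\<in>set xs. A \<in> finite_measure_sets)"

definition list_fun :: "((real^'d) set \<times> (real^('m + 'm))) list \<Rightarrow> real^'d \<Rightarrow> real^('m + 'm)" where
  "list_fun xs s = (\<Sum>(A, r)\<leftarrow>xs. indicator A s *\<^sub>R r)"

definition list_int :: "((real^'d) set \<times> (real^('m + 'm))) list \<Rightarrow> 'w \<Rightarrow> real" where
  "list_int xs \<omega> = (\<Sum>(A, r)\<leftarrow>xs. M A \<omega> \<bullet> r)"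

definition neg_list :: "((real^'d) set \<times> (real^('m + 'm))) list \<Rightarrow> ((real^'d) set \<times> (real^('m + 'm))) list" where
  "neg_list xs = map (\<lambda>(A, r). (A, - r)) xs"

lemma list_append [simp]:
  "simple_list (xs @ ys) \<longleftrightarrow> simple_list xs \<and> simple_list ys"
  "list_fun (xs @ ys) s = list_fun xs s + list_fun ys s"
  "list_int (xs @ ys) \<omega> = list_int xs \<omega> + list_int ys \<omega>"
  by (auto simp: simple_list_def list_fun_def list_int_def)

lemma neg_list [simp]:
  "simple_list xs \<Longrightarrow> simple_list (neg_list xs)"
  "list_fun (neg_list xs) s = - list_fun xs s"
  "list_int (neg_list xs) \<omega> = - list_int xs \<omega>"
proof -
  show "simple_list xs \<Longrightarrow> simple_list (neg_list xs)"
    by (auto simp: simple_list_def neg_list_def)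
  show "list_fun (neg_list xs) s = - list_fun xs s" "list_int (neg_list xs) \<omega> = - list_int xs \<omega>"
    by (induction xs) (auto simp: list_fun_def list_int_def neg_list_def)
qed

lemma measurable_list_int:
  assumes "simple_list xs"
  shows "list_int xs \<in> borel_measurable P"
  using assms
proof (induction xs)
  case (Cons p xs)
  obtain A r where [simp]: "p = (A, r)" by (cases p)
  have "(\<lambda>\<omega>. M A \<omega> \<bullet> r + list_int xs \<omega>) \<in> borel_measurable P"
    using Cons by (auto simp: simple_list_def intro!: borel_measurable_add borel_measurable_inner)
  then show ?case by (simp add: list_int_def)
qed (simp add: list_int_def[abs_def])

lemma measurable_list_fun:
  assumes "simple_list xs"
  shows "list_fun xs \<in> borel_measurable borel"
  using assms
proof (induction xs)
  case (Cons p xs)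
  obtain A r where [simp]: "p = (A, r)" by (cases p)
  have "A \<in> sets borel" using Cons by (simp add: simple_list_def finite_measure_sets_def)
  then have "(\<lambda>s. indicator A s *\<^sub>R r + list_fun xs s) \<in> borel_measurable borel"
    using Cons by (auto simp: simple_list_def intro!: borel_measurable_add borel_measurable_scaleR)
  then show ?case by (simp add: list_fun_def)
qed (simp add: list_fun_def[abs_def])

lemma measurable_iexp: "f \<in> borel_measurable N \<Longrightarrow> (\<lambda>\<omega>. iexp (f \<omega>)) \<in> borel_measurable N"
  by measurable

text \<open>The sets in the list may overlap. Over the atoms they generate, the random measure is
  independent and the simple function constant, so the characteristic function factorizes.\<close>

lemma char_list_int:
  assumes "simple_list xs"
  shows "(CLINT \<omega>|P. iexp (list_int xs \<omega>)) = exp (\<integral>s. log_char \<mu> (list_fun xs s) \<partial>lborel)"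
    and "integrable lborel (\<lambda>s. log_char \<mu> (list_fun xs s))"
proof -
  define n where "n = length xs"
  define A where "A j = fst (xs ! j)" for j
  define r where "r j = snd (xs ! j)" for j
  have A: "A j \<in> finite_measure_sets" if "j < n" for j
    using assms that nth_mem[of j xs] unfolding simple_list_def A_def n_def
    by (cases "xs ! j") auto
  have fun_eq: "list_fun xs s = (\<Sum>j<n. indicator (A j) s *\<^sub>R r j)" for s
    by (simp add: list_fun_def sum_list_sum_nth n_def A_def r_def split_def atLeast0LessThan)
  have int_eq: "list_int xs \<omega> = (\<Sum>j<n. M (A j) \<omega> \<bullet> r j)" for \<omega>
    by (simp add: list_int_def sum_list_sum_nth n_def A_def r_def split_def atLeast0LessThan)
  define \<T> where "\<T> = Pow {..<n} - {{}}"
  \<comment> \<open>The atom of the points lying in exactly the sets with index in T. The empty T is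
    left out of \<open>\<T>\<close>: its atom, the complement of all the sets, has infinite
    measure.\<close>
  define C where "C T = {s. \<forall>j<n. s \<in> A j \<longleftrightarrow> j \<in> T}" for T
  define R where "R T = (\<Sum>j\<in>T. r j)" for T
  have fin: "finite \<T>" by (simp add: \<T>_def)
  have C: "C T \<in> finite_measure_sets" if T: "T \<in> \<T>" for T
  proof -
    obtain j where j: "j \<in> T" "j < n" using T by (auto simp: \<T>_def)
    show ?thesis
    proof (rule finite_measure_sets_subset[OF A[OF j(2)]])
      have "C T = (\<Inter>j\<in>{..<n}. if j \<in> T then A j else - A j) \<inter> UNIV"
        by (auto simp: C_def)
      also have "\<dots> \<in> sets borel"
      proof (cases "n = 0")
        case False
        then show ?thesis
          using A by (intro sets.Int sets.finite_INT)
            (auto simp: finite_measure_sets_def intro!: borel_comp)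
      qed (use j in simp)
      finally show "C T \<in> sets borel" .
    qed (use j in \<open>auto simp: C_def\<close>)
  qed
  have disj: "disjoint_family_on C \<T>"
    unfolding disjoint_family_on_def
  proof (intro ballI impI)
    fix T T' assume T: "T \<in> \<T>" "T' \<in> \<T>" "T \<noteq> T'"
    then obtain j where "j < n" "(j \<in> T) \<noteq> (j \<in> T')" by (auto simp: \<T>_def)
    then show "C T \<inter> C T' = {}" by (auto simp: C_def)
  qed
  have UN: "A j = (\<Union>T\<in>{T\<in>\<T>. j \<in> T}. C T)" if "j < n" for j
  proof (intro set_eqI iffI)
    fix s assume "s \<in> A j"
    then have "{j. j < n \<and> s \<in> A j} \<in> {T\<in>\<T>. j \<in> T}" "s \<in> C {j. j < n \<and> s \<in> A j}"
      using that by (auto simp: \<T>_def C_def)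
    then show "s \<in> (\<Union>T\<in>{T\<in>\<T>. j \<in> T}. C T)" by blast
  qed (use that in \<open>auto simp: C_def\<close>)
  have "AE \<omega> in P. \<forall>j\<in>{..<n}. M (A j) \<omega> = (\<Sum>T\<in>{T\<in>\<T>. j \<in> T}. M (C T) \<omega>)"
  proof (rule AE_finite_allI)
    fix j assume "j \<in> {..<n}"
    then have "j < n" by simp
    show "AE \<omega> in P. M (A j) \<omega> = (\<Sum>T\<in>{T\<in>\<T>. j \<in> T}. M (C T) \<omega>)"
      unfolding UN[OF \<open>j < n\<close>]
      using fin C by (intro M_finite_family(2) disjoint_family_on_mono[OF _ disj]) auto
  qed simp
  then have "AE \<omega> in P. list_int xs \<omega> = (\<Sum>T\<in>\<T>. M (C T) \<omega> \<bullet> R T)"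
  proof eventually_elim
    case (elim \<omega>)
    then have "list_int xs \<omega> = (\<Sum>j<n. \<Sum>T\<in>{T\<in>\<T>. j \<in> T}. M (C T) \<omega> \<bullet> r j)"
      by (simp add: int_eq inner_sum_left)
    also have "\<dots> = (\<Sum>T\<in>\<T>. \<Sum>j\<in>T. M (C T) \<omega> \<bullet> r j)"
      unfolding \<T>_def by (rule sum_nonempty_subsets_swap)
    finally show ?case by (simp add: R_def inner_sum_right)
  qed
  moreover have "(\<lambda>\<omega>. \<Sum>T\<in>\<T>. M (C T) \<omega> \<bullet> R T) \<in> borel_measurable P"
    using C by (intro borel_measurable_sum borel_measurable_inner) auto
  ultimately have "(CLINT \<omega>|P. iexp (list_int xs \<omega>)) = (CLINT \<omega>|P. iexp (\<Sum>T\<in>\<T>. M (C T) \<omega> \<bullet> R T))"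
    using measurable_list_int[OF assms]
    by (intro integral_cong_AE measurable_iexp) (auto elim!: eventually_mono)
  also have "\<dots> = exp (\<Sum>T\<in>\<T>. complex_of_real (measure lborel (C T)) * log_char \<mu> (R T))"
    by (rule char_M_finite_family[OF fin C disj])
  finally have char: "(CLINT \<omega>|P. iexp (list_int xs \<omega>)) =
      exp (\<Sum>T\<in>\<T>. complex_of_real (measure lborel (C T)) * log_char \<mu> (R T))" .
  have log_char: "log_char \<mu> (list_fun xs s) = (\<Sum>T\<in>\<T>. indicator (C T) s *\<^sub>R log_char \<mu> (R T))" for s
  proof -
    \<comment> \<open>The index of the atom containing s. If it is empty, the right-hand sum is 0,
      in agreement with \<open>log_char \<mu> 0 = 0\<close>.\<close>
    define T0 where "T0 = {j. j < n \<and> s \<in> A j}"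
    have in_C: "s \<in> C T \<longleftrightarrow> T = T0" if "T \<in> \<T>" for T
      using that by (auto simp: C_def T0_def \<T>_def)
    have "(\<Sum>T\<in>\<T>. indicator (C T) s *\<^sub>R log_char \<mu> (R T)) = (\<Sum>T\<in>\<T>. if T = T0 then log_char \<mu> (R T) else 0)"
      using in_C by (intro sum.cong) (auto simp: indicator_def)
    also have "\<dots> = log_char \<mu> (R T0)"
    proof -
      have "T0 \<in> \<T> \<longleftrightarrow> T0 \<noteq> {}" by (auto simp: \<T>_def T0_def)
      then show ?thesis
        using fin by (cases "T0 = {}") (simp_all add: R_def)
    qed
    also have "R T0 = list_fun xs s"
      unfolding R_def T0_def fun_eq
      by (intro sum.mono_neutral_cong_left) (auto simp: indicator_def)
    finally show ?thesis ..
  qed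
  have meas: "C T \<in> sets lborel" "emeasure lborel (C T) < \<infinity>" if "T \<in> \<T>" for T
    using C[OF that] by (auto simp: finite_measure_sets_def)
  have "has_bochner_integral lborel (\<lambda>s. \<Sum>T\<in>\<T>. indicator (C T) s *\<^sub>R log_char \<mu> (R T))
      (\<Sum>T\<in>\<T>. measure lborel (C T) *\<^sub>R log_char \<mu> (R T))"
    using meas by (intro has_bochner_integral_sum has_bochner_integral_scaleR_left
        has_bochner_integral_real_indicator) auto
  then show "integrable lborel (\<lambda>s. log_char \<mu> (list_fun xs s))"
    and "(CLINT \<omega>|P. iexp (list_int xs \<omega>)) = exp (\<integral>s. log_char \<mu> (list_fun xs s) \<partial>lborel)"
    unfolding log_char char
    by (auto simp: has_bochner_integral_iff scaleR_conv_of_real)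
qed

end

section \<open>Stochastic integrals\<close>

text \<open>The function \<open>iexp\<close> is 1-Lipschitz and differences of its values are at
  most 2: the Lipschitz bound is used where the distance is at most e / 2, the bound 2 on the
  remaining event of small probability.\<close>

lemma (in prob_space) tendsto_in_prob_imp_iexp_L1:
  fixes Z :: "nat \<Rightarrow> 'a \<Rightarrow> real"
  assumes [measurable]: "\<And>k. Z k \<in> borel_measurable M" "Y \<in> borel_measurable M"
    and conv: "\<And>\<epsilon>. \<epsilon> > 0 \<Longrightarrow> (\<lambda>k. measure M {\<omega> \<in> space M. \<bar>Z k \<omega> - Y \<omega>\<bar> > \<epsilon>}) \<longlonglongrightarrow> 0"
  shows "(\<lambda>k. \<integral>\<omega>. cmod (iexp (Z k \<omega>) - iexp (Y \<omega>)) \<partial>M) \<longlonglongrightarrow> 0"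
proof (rule LIMSEQ_I)
  fix e :: real assume e: "e > 0"
  let ?A = "\<lambda>k. {\<omega> \<in> space M. \<bar>Z k \<omega> - Y \<omega>\<bar> > e / 2}"
  have int: "integrable M (\<lambda>\<omega>. cmod (iexp (Z k \<omega>) - iexp (Y \<omega>)))" for k
    by (rule integrable_const_bound[where B=2]) (auto intro: cmod_iexp_diff_le)
  have bound: "(\<integral>\<omega>. cmod (iexp (Z k \<omega>) - iexp (Y \<omega>)) \<partial>M) \<le> e / 2 + 2 * measure M (?A k)" for k
  proof -
    have "cmod (iexp (Z k \<omega>) - iexp (Y \<omega>)) \<le> e / 2 + 2 * indicator (?A k) \<omega>" if "\<omega> \<in> space M" for \<omega>
      using cmod_iexp_diff_le[of "Z k \<omega>" "Y \<omega>"] e that by (cases "\<omega> \<in> ?A k") auto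
    moreover have "integrable M (\<lambda>\<omega>. e / 2 + 2 * indicator (?A k) \<omega>)"
      by (intro Bochner_Integration.integrable_add integrable_mult_right integrable_const)
        (auto simp: emeasure_eq_measure intro!: integrable_real_indicator)
    ultimately have "(\<integral>\<omega>. cmod (iexp (Z k \<omega>) - iexp (Y \<omega>)) \<partial>M) \<le> (\<integral>\<omega>. e / 2 + 2 * indicator (?A k) \<omega> \<partial>M)"
      by (intro integral_mono int)
    also have "\<dots> = e / 2 + 2 * measure M (?A k)"
    proof -
      have "integrable M (indicator (?A k) :: 'a \<Rightarrow> real)"
        by (auto simp: emeasure_eq_measure intro!: integrable_real_indicator)
      then show ?thesis
        by (subst Bochner_Integration.integral_add) (auto simp: prob_space Int_absorb2 subset_eq)
    qed
    finally show ?thesis .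
  qed
  have "eventually (\<lambda>k. measure M (?A k) < e / 4) sequentially"
    using conv[of "e / 2"] e by (intro order_tendstoD) auto
  then obtain N where N: "\<And>k. k \<ge> N \<Longrightarrow> measure M (?A k) < e / 4"
    by (auto simp: eventually_sequentially)
  show "\<exists>N. \<forall>k\<ge>N. norm ((\<integral>\<omega>. cmod (iexp (Z k \<omega>) - iexp (Y \<omega>)) \<partial>M) - 0) < e"
  proof (intro exI[of _ N] allI impI)
    fix k assume "N \<le> k"
    have "0 \<le> (\<integral>\<omega>. cmod (iexp (Z k \<omega>) - iexp (Y \<omega>)) \<partial>M)"
      by (rule Bochner_Integration.integral_nonneg) simp
    with bound[of k] N[OF \<open>N \<le> k\<close>]
    show "norm ((\<integral>\<omega>. cmod (iexp (Z k \<omega>) - iexp (Y \<omega>)) \<partial>M) - 0) < e"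
      unfolding diff_0_right real_norm_def by linarith
  qed
qed

context stable_random_measure
begin

text \<open>The integral tested against a vector: \<open>v s\<close> plays the part of the
  transposed integrand applied to that vector, and \<open>Y\<close> that of the corresponding real
  component. With overlapping lists allowed, sums of integrands are approximated by
  concatenation.\<close>

definition stoch_int :: "(real^'d \<Rightarrow> real^('m + 'm)) \<Rightarrow> ('w \<Rightarrow> real) \<Rightarrow> bool" where
  "stoch_int v Y \<longleftrightarrow> v \<in> borel_measurable borel \<and> Y \<in> borel_measurable P \<and>
    (\<exists>xs. (\<forall>k :: nat. simple_list (xs k)) \<and> (AE s in lborel. (\<lambda>k. list_fun (xs k) s) \<longlonglongrightarrow> v s) \<and>
      (\<forall>\<epsilon>>0. (\<lambda>k. measure P {\<omega> \<in> space P. \<bar>list_int (xs k) \<omega> - Y \<omega>\<bar> > \<epsilon>}) \<longlonglongrightarrow> 0))"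

lemma stoch_int_zero: "stoch_int (\<lambda>_. 0) (\<lambda>_. 0)"
  unfolding stoch_int_def
  by (intro conjI exI[of _ "\<lambda>_. []"]) (auto simp: simple_list_def list_fun_def list_int_def)

lemma stoch_int_add:
  assumes "stoch_int v Y" "stoch_int v' Y'"
  shows "stoch_int (\<lambda>s. v s + v' s) (\<lambda>\<omega>. Y \<omega> + Y' \<omega>)"
proof -
  have [measurable]: "v \<in> borel_measurable borel" "v' \<in> borel_measurable borel"
    "Y \<in> borel_measurable P" "Y' \<in> borel_measurable P"
    using assms by (auto simp: stoch_int_def)
  obtain xs where xs: "\<And>k :: nat. simple_list (xs k)"
    "AE s in lborel. (\<lambda>k. list_fun (xs k) s) \<longlonglongrightarrow> v s"
    "\<And>\<epsilon>. \<epsilon> > 0 \<Longrightarrow> (\<lambda>k. measure P {\<omega> \<in> space P. \<bar>list_int (xs k) \<omega> - Y \<omega>\<bar> > \<epsilon>}) \<longlonglongrightarrow> 0"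
    using assms(1) unfolding stoch_int_def by blast
  obtain ys where ys: "\<And>k :: nat. simple_list (ys k)"
    "AE s in lborel. (\<lambda>k. list_fun (ys k) s) \<longlonglongrightarrow> v' s"
    "\<And>\<epsilon>. \<epsilon> > 0 \<Longrightarrow> (\<lambda>k. measure P {\<omega> \<in> space P. \<bar>list_int (ys k) \<omega> - Y' \<omega>\<bar> > \<epsilon>}) \<longlonglongrightarrow> 0"
    using assms(2) unfolding stoch_int_def by blast
  have [measurable]: "list_int (xs k) \<in> borel_measurable P" "list_int (ys k) \<in> borel_measurable P" for k
    using xs(1) ys(1) measurable_list_int by auto
  have "(\<lambda>k. measure P {\<omega> \<in> space P. \<bar>list_int (xs k @ ys k) \<omega> - (Y \<omega> + Y' \<omega>)\<bar> > \<epsilon>}) \<longlonglongrightarrow> 0"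
    if "\<epsilon> > 0" for \<epsilon>
  proof (rule tendsto_sandwich[OF _ _ tendsto_const])
    let ?A = "\<lambda>k. {\<omega> \<in> space P. \<bar>list_int (xs k) \<omega> - Y \<omega>\<bar> > \<epsilon> / 2}"
    let ?B = "\<lambda>k. {\<omega> \<in> space P. \<bar>list_int (ys k) \<omega> - Y' \<omega>\<bar> > \<epsilon> / 2}"
    show "(\<lambda>k. measure P (?A k) + measure P (?B k)) \<longlonglongrightarrow> 0"
      using tendsto_add[OF xs(3)[of "\<epsilon> / 2"] ys(3)[of "\<epsilon> / 2"]] that by simp
    show "eventually (\<lambda>k. measure P {\<omega> \<in> space P. \<bar>list_int (xs k @ ys k) \<omega> - (Y \<omega> + Y' \<omega>)\<bar> > \<epsilon>}
        \<le> measure P (?A k) + measure P (?B k)) sequentially"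
    proof (intro always_eventually allI)
      fix k
      have "measure P {\<omega> \<in> space P. \<bar>list_int (xs k @ ys k) \<omega> - (Y \<omega> + Y' \<omega>)\<bar> > \<epsilon>}
          \<le> measure P (?A k \<union> ?B k)"
      proof (intro finite_measure_mono subsetI)
        fix \<omega> assume "\<omega> \<in> {\<omega> \<in> space P. \<bar>list_int (xs k @ ys k) \<omega> - (Y \<omega> + Y' \<omega>)\<bar> > \<epsilon>}"
        then have "\<omega> \<in> space P" "\<bar>list_int (xs k) \<omega> + list_int (ys k) \<omega> - (Y \<omega> + Y' \<omega>)\<bar> > \<epsilon>"
          by auto
        moreover from this(2) have "\<bar>list_int (xs k) \<omega> - Y \<omega>\<bar> > \<epsilon> / 2 \<or> \<bar>list_int (ys k) \<omega> - Y' \<omega>\<bar> > \<epsilon> / 2"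
          by linarith
        ultimately show "\<omega> \<in> ?A k \<union> ?B k" by blast
      qed measurable
      also have "\<dots> \<le> measure P (?A k) + measure P (?B k)"
        by (intro measure_Un_le) measurable
      finally show "measure P {\<omega> \<in> space P. \<bar>list_int (xs k @ ys k) \<omega> - (Y \<omega> + Y' \<omega>)\<bar> > \<epsilon>}
          \<le> measure P (?A k) + measure P (?B k)" .
    qed
  qed simp
  moreover have "AE s in lborel. (\<lambda>k. list_fun (xs k @ ys k) s) \<longlonglongrightarrow> v s + v' s"
    using xs(2) ys(2) by eventually_elim (auto intro: tendsto_add)
  ultimately show ?thesis
    unfolding stoch_int_def using xs(1) ys(1)
    by (intro conjI exI[of _ "\<lambda>k. xs k @ ys k"]) (auto simp: list_append(1))
qed

lemma stoch_int_sum: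
  assumes "\<And>j. j \<in> J \<Longrightarrow> stoch_int (v j) (Y j)"
  shows "stoch_int (\<lambda>s. \<Sum>j\<in>J. v j s) (\<lambda>\<omega>. \<Sum>j\<in>J. Y j \<omega>)"
  using assms
proof (induction J rule: infinite_finite_induct)
  case (insert j J)
  then show ?case
    using stoch_int_add[of "v j" "Y j" "\<lambda>s. \<Sum>j\<in>J. v j s" "\<lambda>\<omega>. \<Sum>j\<in>J. Y j \<omega>"] by simp
qed (simp_all add: stoch_int_zero)

section \<open>Convergence of integrands measured by the integral of h\<close>

lemma measurable_h [measurable]: "h \<in> borel_measurable borel"
  by (intro borel_measurable_continuous_onI continuous_h)

lemma measurable_log_char [measurable]: "log_char \<mu> \<in> borel_measurable borel"
  by (intro borel_measurable_continuous_onI continuous_log_char)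

lemma h_diff: "h (x - y) \<le> 2 * h x + 2 * h y"
  using h_quasi[of x "- y"] by (simp add: h_uminus)

lemma integrable_h_list:
  "simple_list xs \<Longrightarrow> integrable lborel (\<lambda>s. h (list_fun xs s))"
  unfolding h_def by (intro integrable_minus integrable_Re char_list_int)

text \<open>
  The approximating simple functions form a Cauchy sequence with respect to the modular
  \<open>v \<mapsto> \<integral> h (v s) ds\<close>, since \<open>exp\<close> of minus this quantity is the modulus of a characteristic function
  and the simple integrals converge in probability.
\<close>

lemma list_int_Cauchy:
  assumes xs: "\<And>k :: nat. simple_list (xs k)"
    and Y: "Y \<in> borel_measurable P"
    and conv: "\<And>\<epsilon>. \<epsilon> > 0 \<Longrightarrow> (\<lambda>k. measure P {\<omega> \<in> space P. \<bar>list_int (xs k) \<omega> - Y \<omega>\<bar> > \<epsilon>}) \<longlonglongrightarrow> 0"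
    and \<epsilon>: "\<epsilon> > 0"
  shows "\<exists>N. \<forall>k\<ge>N. \<forall>l\<ge>N. (\<integral>s. h (list_fun (xs k) s - list_fun (xs l) s) \<partial>lborel) \<le> \<epsilon>"
proof -
  note Y[measurable]
  have J[measurable]: "list_int (xs k) \<in> borel_measurable P" for k
    by (rule measurable_list_int[OF xs])
  define d where "d k = (\<integral>\<omega>. cmod (iexp (list_int (xs k) \<omega>) - iexp (Y \<omega>)) \<partial>P)" for k
  have d0: "d \<longlonglongrightarrow> 0"
    unfolding d_def by (rule tendsto_in_prob_imp_iexp_L1[OF J Y conv])
  have int: "integrable P (\<lambda>\<omega>. cmod (iexp (f \<omega>) - iexp (g \<omega>)))"
    if [measurable]: "f \<in> borel_measurable P" "g \<in> borel_measurable P" for f g :: "'w \<Rightarrow> real"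
    by (rule integrable_const_bound[where B=2]) (auto intro: cmod_iexp_diff_le)
  have key: "1 - exp (- (\<integral>s. h (list_fun (xs k) s - list_fun (xs l) s) \<partial>lborel)) \<le> d k + d l" for k l
  proof -
    \<comment> \<open>This list represents the difference of the two simple functions; its integral
      is close to 0 in probability, so its characteristic function at frequency 1 is close to
      1.\<close>
    let ?ys = "xs k @ neg_list (xs l)"
    have ys: "simple_list ?ys" using xs by simp
    have "Re (\<integral>s. log_char \<mu> (list_fun ?ys s) \<partial>lborel) =
        - (\<integral>s. h (list_fun (xs k) s - list_fun (xs l) s) \<partial>lborel)"
      using char_list_int(2)[OF ys] by (simp add: h_def flip: integral_Re)
    then have "exp (- (\<integral>s. h (list_fun (xs k) s - list_fun (xs l) s) \<partial>lborel)) =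
        cmod (CLINT \<omega>|P. iexp (list_int ?ys \<omega>))"
      by (simp only: char_list_int(1)[OF ys] norm_exp_eq_Re)
    moreover have "1 - cmod (CLINT \<omega>|P. iexp (list_int ?ys \<omega>)) \<le> d k + d l"
    proof -
      have i: "integrable P (\<lambda>\<omega>. iexp (list_int ?ys \<omega>))"
        using measurable_list_int[OF ys] by (intro integrable_const_bound[where B=1] measurable_iexp) auto
      have "1 - cmod (CLINT \<omega>|P. iexp (list_int ?ys \<omega>)) \<le> cmod (1 - (CLINT \<omega>|P. iexp (list_int ?ys \<omega>)))"
        using norm_triangle_ineq2[of 1 "CLINT \<omega>|P. iexp (list_int ?ys \<omega>)"] by simp
      also have "1 - (CLINT \<omega>|P. iexp (list_int ?ys \<omega>)) = (CLINT \<omega>|P. 1 - iexp (list_int ?ys \<omega>))"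
        using i by (simp add: prob_space)
      also have "cmod \<dots> \<le> (\<integral>\<omega>. cmod (1 - iexp (list_int ?ys \<omega>)) \<partial>P)"
        by (rule integral_norm_bound)
      also have "\<dots> = (\<integral>\<omega>. cmod (iexp (list_int (xs k) \<omega>) - iexp (list_int (xs l) \<omega>)) \<partial>P)"
      proof (rule Bochner_Integration.integral_cong[OF refl])
        fix \<omega>
        have "iexp (list_int (xs l) \<omega>) * (1 - iexp (list_int ?ys \<omega>)) =
            - (iexp (list_int (xs k) \<omega>) - iexp (list_int (xs l) \<omega>))"
          by (simp add: right_diff_distrib algebra_simps flip: exp_add)
        then have "cmod (iexp (list_int (xs l) \<omega>)) * cmod (1 - iexp (list_int ?ys \<omega>)) =
            cmod (iexp (list_int (xs k) \<omega>) - iexp (list_int (xs l) \<omega>))"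
          by (metis norm_mult norm_minus_cancel)
        then show "cmod (1 - iexp (list_int ?ys \<omega>)) =
            cmod (iexp (list_int (xs k) \<omega>) - iexp (list_int (xs l) \<omega>))"
          by simp
      qed
      also have "\<dots> \<le> (\<integral>\<omega>. cmod (iexp (list_int (xs k) \<omega>) - iexp (Y \<omega>)) +
          cmod (iexp (list_int (xs l) \<omega>) - iexp (Y \<omega>)) \<partial>P)"
      proof (rule integral_mono)
        fix \<omega>
        have "cmod (p - q) \<le> cmod (p - y) + cmod (q - y)" for p q y :: complex
          using norm_triangle_ineq4[of "p - y" "q - y"] by simp
        then show "cmod (iexp (list_int (xs k) \<omega>) - iexp (list_int (xs l) \<omega>)) \<le>
            cmod (iexp (list_int (xs k) \<omega>) - iexp (Y \<omega>)) + cmod (iexp (list_int (xs l) \<omega>) - iexp (Y \<omega>))" .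
      qed (intro Bochner_Integration.integrable_add int; measurable)+
      also have "\<dots> = d k + d l"
        unfolding d_def by (intro Bochner_Integration.integral_add int) auto
      finally show ?thesis .
    qed
    ultimately show ?thesis by simp
  qed
  \<comment> \<open>Two errors below e add up to less than 1 - exp (-\<epsilon>), which translates
    back into an integral of \<open>h\<close> below \<open>\<epsilon>\<close>.\<close>
  define e where "e = (1 - exp (- \<epsilon>)) / 2"
  have "e > 0" using \<epsilon> by (simp add: e_def)
  then have "eventually (\<lambda>k. d k < e) sequentially"
    using d0 by (intro order_tendstoD) auto
  then obtain N where N: "\<And>k. k \<ge> N \<Longrightarrow> d k < e"
    by (auto simp: eventually_sequentially)
  show ?thesis
  proof (intro exI[of _ N] allI impI)
    fix k l assume "N \<le> k" "N \<le> l"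
    then have "d k + d l < 1 - exp (- \<epsilon>)"
      using add_strict_mono[OF N[of k] N[of l]] by (simp add: e_def)
    with key[of k l] have "1 - exp (- (\<integral>s. h (list_fun (xs k) s - list_fun (xs l) s) \<partial>lborel)) < 1 - exp (- \<epsilon>)"
      by (rule le_less_trans)
    then show "(\<integral>s. h (list_fun (xs k) s - list_fun (xs l) s) \<partial>lborel) \<le> \<epsilon>"
      by simp
  qed
qed

text \<open>
  Fatou's lemma turns the Cauchy property into convergence to \<open>v\<close> in the modular. Together with
  \<open>t \<le> p + min t q\<close> for \<open>0 \<le> t \<le> p + q\<close>, this replaces a dominating function for
  \<open>log_char \<mu> (list_fun (xs k) s)\<close>.
\<close>

lemma char_stoch_int:
  assumes "stoch_int v Y"
  shows "integrable lborel (\<lambda>s. h (v s))"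
    and "integrable lborel (\<lambda>s. log_char \<mu> (v s))"
    and "(CLINT \<omega>|P. iexp (Y \<omega>)) = exp (\<integral>s. log_char \<mu> (v s) \<partial>lborel)"
proof -
  have v[measurable]: "v \<in> borel_measurable borel" and Y[measurable]: "Y \<in> borel_measurable P"
    using assms by (auto simp: stoch_int_def)
  obtain xs where xs: "\<And>k :: nat. simple_list (xs k)"
    "AE s in lborel. (\<lambda>k. list_fun (xs k) s) \<longlonglongrightarrow> v s"
    "\<And>\<epsilon>. \<epsilon> > 0 \<Longrightarrow> (\<lambda>k. measure P {\<omega> \<in> space P. \<bar>list_int (xs k) \<omega> - Y \<omega>\<bar> > \<epsilon>}) \<longlonglongrightarrow> 0"
    using assms(1) unfolding stoch_int_def by blast
  define a where "a k = list_fun (xs k)" for k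
  have a[measurable]: "a k \<in> borel_measurable borel" for k
    unfolding a_def by (rule measurable_list_fun[OF xs(1)])
  have a_lim: "AE s in lborel. (\<lambda>k. a k s) \<longlonglongrightarrow> v s"
    using xs(2) by (simp add: a_def)
  have int_a: "integrable lborel (\<lambda>s. h (a k s))" for k
    unfolding a_def by (rule integrable_h_list[OF xs(1)])
  have int_aa: "integrable lborel (\<lambda>s. h (a k s - a l s))" for k l
    using integrable_h_list[of "xs k @ neg_list (xs l)"] xs(1) by (simp add: a_def)
  have h_lim: "(\<lambda>k. h (f k)) \<longlonglongrightarrow> h x" if "f \<longlonglongrightarrow> x" for f x
    using continuous_on_tendsto_compose[OF continuous_h that] by simp
  have fatou: "\<exists>N. \<forall>k\<ge>N. (\<integral>\<^sup>+s. ennreal (h (a k s - v s)) \<partial>lborel) \<le> ennreal \<epsilon>" if "\<epsilon> > 0" for \<epsilon>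
  proof -
    obtain N where N: "\<And>k l. k \<ge> N \<Longrightarrow> l \<ge> N \<Longrightarrow> (\<integral>s. h (a k s - a l s) \<partial>lborel) \<le> \<epsilon>"
      using list_int_Cauchy[OF xs(1) Y xs(3) \<open>\<epsilon> > 0\<close>] unfolding a_def by blast
    have "(\<integral>\<^sup>+s. ennreal (h (a k s - v s)) \<partial>lborel) \<le> ennreal \<epsilon>" if k: "k \<ge> N" for k
    proof -
      have "AE s in lborel. ennreal (h (a k s - v s)) = liminf (\<lambda>l. ennreal (h (a k s - a l s)))"
        using a_lim
      proof eventually_elim
        case (elim s)
        then have "(\<lambda>l. ennreal (h (a k s - a l s))) \<longlonglongrightarrow> ennreal (h (a k s - v s))"
          by (intro tendsto_ennrealI h_lim tendsto_diff tendsto_const)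
        then show ?case
          using lim_imp_Liminf[OF sequentially_bot] by metis
      qed
      then have "(\<integral>\<^sup>+s. ennreal (h (a k s - v s)) \<partial>lborel) =
          (\<integral>\<^sup>+s. liminf (\<lambda>l. ennreal (h (a k s - a l s))) \<partial>lborel)"
        by (rule nn_integral_cong_AE)
      also have "\<dots> \<le> liminf (\<lambda>l. \<integral>\<^sup>+s. ennreal (h (a k s - a l s)) \<partial>lborel)"
        by (rule nn_integral_liminf) measurable
      also have "\<dots> \<le> limsup (\<lambda>l. \<integral>\<^sup>+s. ennreal (h (a k s - a l s)) \<partial>lborel)"
        by (rule Liminf_le_Limsup) simp
      also have "\<dots> \<le> ennreal \<epsilon>"
      proof (rule Limsup_bounded)
        show "eventually (\<lambda>l. (\<integral>\<^sup>+s. ennreal (h (a k s - a l s)) \<partial>lborel) \<le> ennreal \<epsilon>) sequentially"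
          using eventually_ge_at_top[of N]
        proof eventually_elim
          case (elim l)
          have "(\<integral>\<^sup>+s. ennreal (h (a k s - a l s)) \<partial>lborel) = ennreal (\<integral>s. h (a k s - a l s) \<partial>lborel)"
            by (intro nn_integral_eq_integral int_aa) (simp add: h_nonneg)
          then show ?case
            using N[OF k elim] by (simp add: ennreal_leI)
        qed
      qed
      finally show ?thesis .
    qed
    then show ?thesis by blast
  qed
  \<comment> \<open>Any finite bound would do: it makes h (a N - v) integrable, and writing v = a N
    - (a N - v) then makes h (v s) integrable.\<close>
  obtain N where N: "\<And>k. k \<ge> N \<Longrightarrow> (\<integral>\<^sup>+s. ennreal (h (a k s - v s)) \<partial>lborel) \<le> ennreal 1"
    using fatou[of 1] by auto
  have int_av: "integrable lborel (\<lambda>s. h (a k s - v s))" if "k \<ge> N" for k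
    using N[OF that] by (intro integrableI_nonneg) (auto simp: h_nonneg intro: le_less_trans)
  have D0: "(\<lambda>k. \<integral>s. h (a k s - v s) \<partial>lborel) \<longlonglongrightarrow> 0"
  proof (rule LIMSEQ_I)
    fix e :: real assume e: "e > 0"
    obtain N' where N': "\<And>k. k \<ge> N' \<Longrightarrow> (\<integral>\<^sup>+s. ennreal (h (a k s - v s)) \<partial>lborel) \<le> ennreal (e / 2)"
      using fatou[of "e / 2"] e by auto
    show "\<exists>N. \<forall>k\<ge>N. norm ((\<integral>s. h (a k s - v s) \<partial>lborel) - 0) < e"
    proof (intro exI[of _ "max N N'"] allI impI)
      fix k assume "max N N' \<le> k"
      then have "ennreal (\<integral>s. h (a k s - v s) \<partial>lborel) \<le> ennreal (e / 2)"
        using N'[of k] int_av[of k] by (subst nn_integral_eq_integral[symmetric]) (auto simp: h_nonneg)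
      then have "(\<integral>s. h (a k s - v s) \<partial>lborel) \<le> e / 2"
        using e by (subst (asm) ennreal_le_iff) auto
      moreover have "0 \<le> (\<integral>s. h (a k s - v s) \<partial>lborel)"
        by (intro Bochner_Integration.integral_nonneg h_nonneg)
      ultimately show "norm ((\<integral>s. h (a k s - v s) \<partial>lborel) - 0) < e"
        using e by simp
    qed
  qed
  show int_v: "integrable lborel (\<lambda>s. h (v s))"
  proof (rule Bochner_Integration.integrable_bound)
    show "integrable lborel (\<lambda>s. 2 * h (a N s - v s) + 2 * h (a N s))"
      using int_av[of N] int_a[of N] by auto
    show "AE s in lborel. norm (h (v s)) \<le> norm (2 * h (a N s - v s) + 2 * h (a N s))"
    proof (rule AE_I2)
      fix s
      have "h (v s) \<le> 2 * h (a N s - v s) + 2 * h (a N s)"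
        using h_diff[of "a N s" "a N s - v s"] by simp
      then show "norm (h (v s)) \<le> norm (2 * h (a N s - v s) + 2 * h (a N s))"
        using h_nonneg[of "v s"] by simp
    qed
  qed measurable
  obtain C where C: "C \<ge> 0" "\<And>x. cmod (log_char \<mu> x) \<le> C * h x"
    using ex_log_char_bound by blast
  show int_psi: "integrable lborel (\<lambda>s. log_char \<mu> (v s))"
    by (rule Bochner_Integration.integrable_bound[OF integrable_mult_right[OF int_v, of C]])
      (use C h_nonneg in \<open>auto intro!: AE_I2 intro: order_trans[OF C(2)]\<close>)
  define t where "t k s = cmod (log_char \<mu> (a k s) - log_char \<mu> (v s))" for k s
  \<comment> \<open>The factor 3 adds the 2 from the quasi-triangle inequality applied to a k = (a k
    - v) + v to the 1 from the term with v itself.\<close>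
  define q where "q s = 3 * C * h (v s)" for s
  have [measurable]: "t k \<in> borel_measurable borel" "q \<in> borel_measurable borel" for k
    unfolding t_def[abs_def] q_def[abs_def] by measurable
  have q: "q s \<ge> 0" "integrable lborel q" for s
    using C h_nonneg int_v by (auto simp: q_def[abs_def])
  have t_le: "t k s \<le> 2 * C * h (a k s - v s) + min (t k s) (q s)" for k s
  proof -
    have "t k s \<le> cmod (log_char \<mu> (a k s)) + cmod (log_char \<mu> (v s))"
      unfolding t_def by (rule norm_triangle_ineq4)
    also have "\<dots> \<le> C * h (a k s) + C * h (v s)"
      by (intro add_mono C)
    also have "C * h (a k s) \<le> C * (2 * h (a k s - v s) + 2 * h (v s))"
      using h_quasi[of "a k s - v s" "v s"] C(1) by (intro mult_left_mono) auto
    finally have "t k s \<le> 2 * C * h (a k s - v s) + q s"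
      by (simp add: q_def algebra_simps)
    moreover have "0 \<le> 2 * C * h (a k s - v s)"
      using C h_nonneg by simp
    ultimately show ?thesis by (simp add: min_def)
  qed
  have int_min: "integrable lborel (\<lambda>s. min (t k s) (q s))" for k
    by (rule Bochner_Integration.integrable_bound[OF q(2)]) (auto simp: t_def q min_def intro!: AE_I2)
  have min0: "(\<lambda>k. \<integral>s. min (t k s) (q s) \<partial>lborel) \<longlonglongrightarrow> (\<integral>s. 0 \<partial>(lborel :: (real^'d) measure))"
  proof (rule integral_dominated_convergence[OF _ _ q(2)])
    show "AE s in lborel. (\<lambda>k. min (t k s) (q s)) \<longlonglongrightarrow> 0"
      using a_lim
    proof eventually_elim
      case (elim s)
      then have "(\<lambda>k. t k s) \<longlonglongrightarrow> cmod (log_char \<mu> (v s) - log_char \<mu> (v s))"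
        unfolding t_def using continuous_on_tendsto_compose[OF continuous_log_char elim]
        by (intro tendsto_intros) auto
      then have "(\<lambda>k. min (t k s) (q s)) \<longlonglongrightarrow> min 0 (q s)"
        by (intro tendsto_min) auto
      then show ?case using q by simp
    qed
  qed (auto simp: t_def q min_def intro!: AE_I2)
  have int_la: "integrable lborel (\<lambda>s. log_char \<mu> (a k s))" for k
    unfolding a_def by (rule char_list_int(2)[OF xs(1)])
  have "(\<lambda>k. (\<integral>s. log_char \<mu> (a k s) \<partial>lborel) - (\<integral>s. log_char \<mu> (v s) \<partial>lborel)) \<longlonglongrightarrow> 0"
  proof (rule Lim_null_comparison)
    show "(\<lambda>k. 2 * C * (\<integral>s. h (a k s - v s) \<partial>lborel) + (\<integral>s. min (t k s) (q s) \<partial>lborel)) \<longlonglongrightarrow> 0"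
      using tendsto_add[OF tendsto_mult_left[OF D0, of "2 * C"] min0] by simp
    show "eventually (\<lambda>k. cmod ((\<integral>s. log_char \<mu> (a k s) \<partial>lborel) - (\<integral>s. log_char \<mu> (v s) \<partial>lborel))
        \<le> 2 * C * (\<integral>s. h (a k s - v s) \<partial>lborel) + (\<integral>s. min (t k s) (q s) \<partial>lborel)) sequentially"
      using eventually_ge_at_top[of N]
    proof eventually_elim
      case (elim k)
      have "cmod ((\<integral>s. log_char \<mu> (a k s) \<partial>lborel) - (\<integral>s. log_char \<mu> (v s) \<partial>lborel))
          = cmod (\<integral>s. log_char \<mu> (a k s) - log_char \<mu> (v s) \<partial>lborel)"
        using int_la int_psi by simp
      also have "\<dots> \<le> (\<integral>s. t k s \<partial>lborel)"
        unfolding t_def by (rule integral_norm_bound)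
      also have "\<dots> \<le> (\<integral>s. 2 * C * h (a k s - v s) + min (t k s) (q s) \<partial>lborel)"
        using int_av[OF elim] int_min t_le int_la int_psi
        by (intro integral_mono) (auto simp: t_def intro!: integrable_norm)
      also have "\<dots> = 2 * C * (\<integral>s. h (a k s - v s) \<partial>lborel) + (\<integral>s. min (t k s) (q s) \<partial>lborel)"
        using int_av[OF elim] int_min by simp
      finally show ?case .
    qed
  qed
  then have "(\<lambda>k. \<integral>s. log_char \<mu> (a k s) \<partial>lborel) \<longlonglongrightarrow> (\<integral>s. log_char \<mu> (v s) \<partial>lborel)"
    by (simp add: LIM_zero_iff)
  then have "(\<lambda>k. exp (\<integral>s. log_char \<mu> (a k s) \<partial>lborel)) \<longlonglongrightarrow> exp (\<integral>s. log_char \<mu> (v s) \<partial>lborel)"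
    by (rule tendsto_exp)
  then have "(\<lambda>k. CLINT \<omega>|P. iexp (list_int (xs k) \<omega>)) \<longlonglongrightarrow> exp (\<integral>s. log_char \<mu> (v s) \<partial>lborel)"
    by (simp add: a_def char_list_int(1)[OF xs(1)])
  moreover have "(\<lambda>k. CLINT \<omega>|P. iexp (list_int (xs k) \<omega>)) \<longlonglongrightarrow> (CLINT \<omega>|P. iexp (Y \<omega>))"
  proof (rule LIM_zero_cancel, rule Lim_null_comparison)
    have J: "list_int (xs k) \<in> borel_measurable P" for k
      by (rule measurable_list_int[OF xs(1)])
    show "(\<lambda>k. \<integral>\<omega>. cmod (iexp (list_int (xs k) \<omega>) - iexp (Y \<omega>)) \<partial>P) \<longlonglongrightarrow> 0"
      by (rule tendsto_in_prob_imp_iexp_L1[OF J Y xs(3)])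
    have int: "integrable P (\<lambda>\<omega>. iexp (f \<omega>))" if "f \<in> borel_measurable P" for f :: "'w \<Rightarrow> real"
      using measurable_iexp[OF that] by (intro integrable_const_bound[where B=1]) auto
    show "eventually (\<lambda>k. cmod ((CLINT \<omega>|P. iexp (list_int (xs k) \<omega>)) - (CLINT \<omega>|P. iexp (Y \<omega>)))
        \<le> (\<integral>\<omega>. cmod (iexp (list_int (xs k) \<omega>) - iexp (Y \<omega>)) \<partial>P)) sequentially"
      unfolding Bochner_Integration.integral_diff[OF int[OF J] int[OF Y], symmetric]
      by (intro always_eventually allI integral_norm_bound)
  qed
  ultimately show "(CLINT \<omega>|P. iexp (Y \<omega>)) = exp (\<integral>s. log_char \<mu> (v s) \<partial>lborel)"
    by (metis LIMSEQ_unique)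
qed

end

section \<open>Harmonizable fields\<close>

declare transpose_matrix_vector [simp del]

lemma inner_matrix_mult_vec: "(A *v x) \<bullet> y = x \<bullet> (transpose A *v y)"
  for A :: "real^'n^'m"
  by (metis dot_lmul_matrix inner_commute transpose_transpose vector_transpose_matrix transpose_matrix_vector)

lemma continuous_on_matrix_mult_vec [continuous_intros]:
  fixes A :: "'a::t2_space \<Rightarrow> real^'n^'m"
  assumes "continuous_on S A" "continuous_on S x"
  shows "continuous_on S (\<lambda>s. A s *v x s)"
proof -
  have "continuous_on S (\<lambda>s. \<chi> i. \<Sum>j\<in>UNIV. A s $ i $ j * x s $ j)"
    by (intro continuous_intros assms)
  then show ?thesis by (simp add: matrix_vector_mult_def)
qed

lemma borel_measurable_matrix_mult_vec [measurable (raw)]: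
  fixes A :: "'a \<Rightarrow> real^'n^'m"
  assumes "A \<in> borel_measurable N" "x \<in> borel_measurable N"
  shows "(\<lambda>s. A s *v x s) \<in> borel_measurable N"
proof -
  have "(\<lambda>p. fst p *v snd p) \<in> borel_measurable (borel \<Otimes>\<^sub>M borel :: ((real^'n^'m) \<times> (real^'n)) measure)"
    unfolding borel_prod by (intro borel_measurable_continuous_onI continuous_intros)
  from measurable_compose[OF measurable_Pair[OF assms] this] show ?thesis by simp
qed

lemma transpose_block_matrix:
  "transpose (block_matrix A B C D) = block_matrix (transpose A) (transpose C) (transpose B) (transpose D)"
  by (auto simp: block_matrix_def transpose_def vec_eq_iff split: sum.split)

text \<open>The kernel is a complex scalar times a real matrix. Tested against (u, 0), its real-part
  block matrix becomes the transposed real matrix followed by complex scaling, with the scalar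
  conjugated by passing to the adjoint.\<close>

lemma transpose_Re_part_matrix_mult:
  fixes G :: "real^'m::finite^'m"
  shows "transpose (Re_part_matrix (map_matrix (\<lambda>x. z * complex_of_real x) G)) *v join_vec u 0 =
    cscale (cnj z) (join_vec (transpose G *v u) 0)"
proof -
  have "map_matrix Re (map_matrix (\<lambda>x. z * complex_of_real x) G) = Re z *\<^sub>R G"
    "- map_matrix Im (map_matrix (\<lambda>x. z * complex_of_real x) G) = (- Im z) *\<^sub>R G"
    by (simp_all add: map_matrix_def vec_eq_iff)
  moreover have "transpose (c *\<^sub>R G) *v u = c *\<^sub>R (transpose G *v u)"
    "transpose (- (c *\<^sub>R G)) *v u = - (c *\<^sub>R (transpose G *v u))"
    "transpose (0 :: real^'m^'m) *v u' = 0" for c u'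
    by (simp_all add: transpose_def matrix_vector_mult_def vec_eq_iff sum_distrib_left sum_negf mult.assoc)
  ultimately show ?thesis
    by (simp add: Re_part_matrix_def transpose_block_matrix block_matrix_mult_vec vec_sum_eq_iff)
qed

lemma mat_powr_invertible_apply: "s > 0 \<Longrightarrow> mat_powr s A *v u = 0 \<longleftrightarrow> u = 0"
  using mat_powr_inverse[of s A] by (metis matrix_vector_mul_assoc matrix_vector_mul_lid matrix_vector_mult_0_right)

lemma (in prob_space) integral_PiM_iid:
  fixes f :: "'a \<Rightarrow> complex"
  assumes "f \<in> borel_measurable M" "\<And>x. cmod (f x) \<le> 1"
  shows "(\<integral>x. (\<Prod>l<n. f (x l)) \<partial>(\<Pi>\<^sub>M l\<in>{..<n}. M)) = (\<integral>x. f x \<partial>M) ^ n"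
proof -
  have "integrable M f"
    using assms by (intro integrable_const_bound[where B=1]) auto
  interpret product_prob_space "\<lambda>_ :: nat. M" "{..<n}" by unfold_locales
  have "(\<integral>x. (\<Prod>l\<in>{..<n}. f (x l)) \<partial>(\<Pi>\<^sub>M l\<in>{..<n}. M)) = (\<Prod>l\<in>{..<n}. \<integral>x. f x \<partial>M)"
    by (intro product_integral_prod \<open>integrable M f\<close>) auto
  then show ?thesis by simp
qed

context stable_random_measure
begin

text \<open>Reading off the first m coordinates and pairing with u is pairing the full integral with
  (u, 0); the matrices of the simple functions are then moved to this vector by
  transposition.\<close>

lemma has_Re_integral_stoch_int:
  assumes Re_Im: "\<And>A \<omega>. A \<in> finite_measure_sets \<Longrightarrow> M A \<omega> = Re_Im_vec (Mt A \<omega>)"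
    and Y: "has_Re_integral P Mt f Y"
  shows "Y \<in> borel_measurable P"
    and "stoch_int (\<lambda>s. transpose (Re_part_matrix (f s)) *v join_vec u 0) (\<lambda>\<omega>. Y \<omega> \<bullet> u)"
proof -
  let ?M = "\<lambda>A \<omega>. Re_Im_vec (Mt A \<omega>)"
  define g where "g s = Re_part_matrix (f s)" for s
  define w where "w = join_vec u (0 :: real^'m)"
  obtain Z where Z: "has_random_integral P ?M g Z" and YZ: "Y = (\<lambda>\<omega>. \<chi> j. Z \<omega> $ Inl j)"
    using Y unfolding has_Re_integral_def g_def by blast
  obtain N R A where g[measurable]: "g \<in> borel_measurable borel" and Zm[measurable]: "Z \<in> borel_measurable P"
    and simple: "\<And>k. simple_sets (N k) (A k)"
    and lim: "AE s in lborel. (\<lambda>k. simple_fun (N k) (R k) (A k) s) \<longlonglongrightarrow> g s"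
    and conv: "tendsto_in_prob P (\<lambda>k. simple_integral ?M (N k) (R k) (A k)) Z"
    using Z unfolding has_random_integral_def by blast
  show "Y \<in> borel_measurable P"
    unfolding YZ by (rule borel_measurable_continuous_on[OF _ Zm]) (intro continuous_intros)
  have Yw: "Y \<omega> \<bullet> u = Z \<omega> \<bullet> w" for \<omega>
    by (simp add: YZ w_def inner_join_vec)
  have cont: "continuous_on UNIV (\<lambda>X :: real^('m + 'm)^('m + 'm). transpose X *v w)"
    unfolding transpose_def by (intro continuous_intros)
  define xs where "xs k = map (\<lambda>j. (A k j, transpose (R k j) *v w)) [0..<N k]" for k
  have FMS: "A k j \<in> finite_measure_sets" if "j < N k" for k j
    using simple[of k] that by (simp add: simple_sets_def)
  then have simple_xs: "simple_list (xs k)" for k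
    by (auto simp: simple_list_def xs_def)
  have fun_xs: "list_fun (xs k) s = transpose (simple_fun (N k) (R k) (A k) s) *v w" for k s
  proof -
    have "transpose (\<Sum>j<n. c j *\<^sub>R R j) *v w = (\<Sum>j<n. c j *\<^sub>R (transpose (R j) *v w))"
      for n :: nat and c and R :: "nat \<Rightarrow> real^('m + 'm)^('m + 'm)"
    proof (induction n)
      case (Suc n)
      have "transpose (X + c *\<^sub>R S) *v w = transpose X *v w + c *\<^sub>R (transpose S *v w)"
        for X S :: "real^('m + 'm)^('m + 'm)" and c
        by (simp add: transpose_def matrix_vector_mult_def vec_eq_iff sum.distrib sum_distrib_left algebra_simps)
      then show ?case using Suc by simp
    qed (simp add: transpose_def matrix_vector_mult_def vec_eq_iff)
    then show ?thesis
      by (simp only: list_fun_def xs_def simple_fun_def prod.case map_map comp_def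
          interv_sum_list_conv_sum_set_nat set_upt atLeast0LessThan)
  qed
  have int_xs: "list_int (xs k) \<omega> = simple_integral ?M (N k) (R k) (A k) \<omega> \<bullet> w" for k \<omega>
  proof -
    have "list_int (xs k) \<omega> = (\<Sum>j<N k. M (A k j) \<omega> \<bullet> (transpose (R k j) *v w))"
      by (simp add: list_int_def xs_def split_def comp_def interv_sum_list_conv_sum_set_nat atLeast0LessThan)
    also have "\<dots> = (\<Sum>j<N k. (R k j *v ?M (A k j) \<omega>) \<bullet> w)"
      by (intro sum.cong refl) (simp add: inner_matrix_mult_vec Re_Im[OF FMS])
    finally show ?thesis
      by (simp add: simple_integral_def inner_sum_left)
  qed
  show "stoch_int (\<lambda>s. transpose (Re_part_matrix (f s)) *v join_vec u 0) (\<lambda>\<omega>. Y \<omega> \<bullet> u)"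
    unfolding g_def[symmetric] w_def[symmetric] Yw stoch_int_def
  proof (intro conjI exI[of _ xs] allI impI simple_xs)
    show "(\<lambda>s. transpose (g s) *v w) \<in> borel_measurable borel"
      by (rule borel_measurable_continuous_on[OF cont g])
    show "(\<lambda>\<omega>. Z \<omega> \<bullet> w) \<in> borel_measurable P" by measurable
    show "AE s in lborel. (\<lambda>k. list_fun (xs k) s) \<longlonglongrightarrow> transpose (g s) *v w"
      using lim
    proof eventually_elim
      case (elim s)
      from continuous_on_tendsto_compose[OF cont elim] show ?case
        by (simp add: fun_xs)
    qed
    fix \<epsilon> :: real assume \<epsilon>: "\<epsilon> > 0"
    \<comment> \<open>By the Cauchy-Schwarz inequality a deviation beyond \<open>\<epsilon>\<close>
      after pairing with \<open>w\<close> needs one beyond this \<open>\<delta>\<close> before; the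
      added 1 covers \<open>w = 0\<close>.\<close>
    define \<delta> where "\<delta> = \<epsilon> / (norm w + 1)"
    have \<delta>: "\<delta> > 0" using \<epsilon> by (auto simp: \<delta>_def intro!: divide_pos_pos add_nonneg_pos)
    let ?S = "\<lambda>k. simple_integral ?M (N k) (R k) (A k)"
    have S: "?S k \<in> borel_measurable P" for k
    proof -
      have "(\<lambda>\<omega>. \<Sum>j<N k. R k j *v M (A k j) \<omega>) \<in> borel_measurable P"
        using FMS by (intro borel_measurable_sum borel_measurable_matrix_mult_vec) auto
      also have "(\<lambda>\<omega>. \<Sum>j<N k. R k j *v M (A k j) \<omega>) = ?S k"
        by (auto simp: simple_integral_def fun_eq_iff Re_Im[OF FMS] intro!: sum.cong)
      finally show ?thesis .
    qed
    show "(\<lambda>k. measure P {\<omega> \<in> space P. \<bar>list_int (xs k) \<omega> - Z \<omega> \<bullet> w\<bar> > \<epsilon>}) \<longlonglongrightarrow> 0"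
    proof (rule tendsto_sandwich[OF _ _ tendsto_const])
      show "(\<lambda>k. measure P {\<omega> \<in> space P. dist (?S k \<omega>) (Z \<omega>) > \<delta>}) \<longlonglongrightarrow> 0"
        using conv \<delta> by (simp add: tendsto_in_prob_def)
      show "eventually (\<lambda>k. measure P {\<omega> \<in> space P. \<bar>list_int (xs k) \<omega> - Z \<omega> \<bullet> w\<bar> > \<epsilon>}
          \<le> measure P {\<omega> \<in> space P. dist (?S k \<omega>) (Z \<omega>) > \<delta>}) sequentially"
      proof (intro always_eventually allI finite_measure_mono subsetI)
        fix k \<omega> assume "\<omega> \<in> {\<omega> \<in> space P. \<bar>list_int (xs k) \<omega> - Z \<omega> \<bullet> w\<bar> > \<epsilon>}"
        then have \<omega>: "\<omega> \<in> space P" "\<epsilon> < \<bar>(?S k \<omega> - Z \<omega>) \<bullet> w\<bar>"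
          by (auto simp: int_xs inner_diff_left)
        have "\<epsilon> < norm (?S k \<omega> - Z \<omega>) * norm w"
          using \<omega>(2) Cauchy_Schwarz_ineq2[of "?S k \<omega> - Z \<omega>" w] by linarith
        also have "\<dots> \<le> norm (?S k \<omega> - Z \<omega>) * (norm w + 1)"
          by (intro mult_left_mono) auto
        finally have "\<delta> < norm (?S k \<omega> - Z \<omega>)"
          unfolding \<delta>_def by (subst pos_divide_less_eq) (auto intro: add_nonneg_pos)
        then show "\<omega> \<in> {\<omega> \<in> space P. dist (?S k \<omega>) (Z \<omega>) > \<delta>}"
          using \<omega> by (simp add: dist_norm)
      next
        show "{\<omega> \<in> space P. dist (?S k \<omega>) (Z \<omega>) > \<delta>} \<in> sets P" for k
          using S[of k] by measurable
      qed
    qed simp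
  qed
qed

end

section \<open>The kernel of the field acting on a test vector\<close>

locale harmonizable_field = stable_random_measure \<mu> B P M
  for \<mu> :: "(real^('m::finite + 'm)) measure" and B :: "real^'m^'m"
    and P :: "'w measure" and M :: "(real^'d) set \<Rightarrow> 'w \<Rightarrow> real^('m + 'm)" +
  fixes Mt :: "(real^'d) set \<Rightarrow> 'w \<Rightarrow> complex^'m" and D :: "real^'m^'m" and E :: "real^'d^'d"
    and \<phi> :: "real^'d \<Rightarrow> real" and X :: "real^'d \<Rightarrow> 'w \<Rightarrow> real^'m"
  assumes Re_Im: "\<And>A \<omega>. A \<in> finite_measure_sets \<Longrightarrow> M A \<omega> = Re_Im_vec (Mt A \<omega>)"
    and continuous_\<phi>: "continuous_on UNIV \<phi>"
    and homogeneous_\<phi>: "homogeneous (transpose E) \<phi>"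
    and \<phi>_pos: "\<And>x. x \<noteq> 0 \<Longrightarrow> \<phi> x > 0"
    and X_int: "\<And>t. has_Re_integral P Mt (harmonizable_kernel \<phi> E D B t) (X t)"
begin

definition W :: "real^'d \<Rightarrow> real^'m^'m" where
  "W s = transpose (mat_powr (\<phi> s) (- D) ** mat_powr (\<phi> s) (- (trace E *\<^sub>R B)))"

text \<open>The integrand representing X t \<bullet> u: the transposed kernel applied to (u, 0). All
  dependence on t is in the complex scalar, and transposition puts the power of B outermost in
  \<open>W\<close>, where homogeneity of \<open>log_char \<mu>\<close> can reach it.\<close>

definition V :: "real^'d \<Rightarrow> real^'m \<Rightarrow> real^'d \<Rightarrow> real^('m + 'm)" where
  "V t u s = cscale (cnj (iexp (t \<bullet> s) - 1)) (join_vec (W s *v u) 0)"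

lemma measurable_X [measurable]: "X t \<in> borel_measurable P"
  by (rule has_Re_integral_stoch_int(1)[OF Re_Im X_int])

lemma stoch_int_X: "stoch_int (V t u) (\<lambda>\<omega>. X t \<omega> \<bullet> u)"
  using has_Re_integral_stoch_int(2)[OF Re_Im X_int, of t u]
  by (simp only: harmonizable_kernel_def transpose_Re_part_matrix_mult V_def[abs_def] W_def)

lemma char_X:
  shows "(CLINT \<omega>|P. iexp (\<Sum>j\<in>J. X (t j) \<omega> \<bullet> u j)) =
      exp (\<integral>s. log_char \<mu> (\<Sum>j\<in>J. V (t j) (u j) s) \<partial>lborel)"
    and "integrable lborel (\<lambda>s. log_char \<mu> (\<Sum>j\<in>J. V (t j) (u j) s))"
proof -
  have "stoch_int (\<lambda>s. \<Sum>j\<in>J. V (t j) (u j) s) (\<lambda>\<omega>. \<Sum>j\<in>J. X (t j) \<omega> \<bullet> u j)"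
    by (intro stoch_int_sum stoch_int_X)
  from char_stoch_int[OF this]
  show "(CLINT \<omega>|P. iexp (\<Sum>j\<in>J. X (t j) \<omega> \<bullet> u j)) =
      exp (\<integral>s. log_char \<mu> (\<Sum>j\<in>J. V (t j) (u j) s) \<partial>lborel)"
    and "integrable lborel (\<lambda>s. log_char \<mu> (\<Sum>j\<in>J. V (t j) (u j) s))"
    by auto
qed

lemma measurable_V: "V t u \<in> borel_measurable borel"
  using stoch_int_X by (simp add: stoch_int_def)

section \<open>Operator-self-similarity\<close>

lemma V_scale:
  assumes "W s *v u' = A *v (W s' *v u)" "t \<bullet> s = t' \<bullet> s'"
  shows "V t u' s = direct_sum A *v V t' u s'"
  using assms by (simp add: V_def direct_sum_cscale direct_sum_mult_join_vec)

lemma direct_sum_sum_V: "(\<Sum>j\<in>J. direct_sum A *v V (t j) (u j) s) = direct_sum A *v (\<Sum>j\<in>J. V (t j) (u j) s)"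
  by (induction J rule: infinite_finite_induct) (auto simp: matrix_vector_right_distrib)

text \<open>Homogeneity multiplies \<phi> s by r. The new factor r^(-D) cancels against r^D on the
  left; the new factor r^(-qB) commutes with the power of \<phi> s to the same matrix, is moved to
  the right end and is read as (r^(-q))^B. Transposition brings it to the front.\<close>

lemma W_scaling:
  assumes r: "r > 0" and s: "s \<noteq> 0"
  shows "W (mat_powr r (transpose E) *v s) *v (transpose (mat_powr r D) *v u) =
    mat_powr (r powr - trace E) (transpose B) *v (W s *v u)"
proof -
  have \<phi>: "\<phi> (mat_powr r (transpose E) *v s) = r * \<phi> s"
    using homogeneous_\<phi> r s by (simp add: homogeneous_def)
  have pos: "\<phi> s > 0" using \<phi>_pos[OF s] .
  have "mat_powr r D ** (mat_powr (r * \<phi> s) (- D) ** mat_powr (r * \<phi> s) (- (trace E *\<^sub>R B))) =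
      (mat_powr r D ** mat_powr r (- D)) ** mat_powr (\<phi> s) (- D) **
        (mat_powr (\<phi> s) (- (trace E *\<^sub>R B)) ** mat_powr r (- (trace E *\<^sub>R B)))"
    using r pos mat_powr_mult[of r "\<phi> s" "- D"] mat_powr_mult[of "\<phi> s" r "- (trace E *\<^sub>R B)"]
    by (simp add: matrix_mul_assoc mult.commute)
  also have "mat_powr r D ** mat_powr r (- D) = mat 1"
    using r by (simp add: mat_powr_uminus mat_powr_inverse')
  also have "mat_powr r (- (trace E *\<^sub>R B)) = mat_powr (r powr - trace E) B"
    using mat_powr_scaleR[OF r, of "- trace E" B] by simp
  finally have eq: "mat_powr r D ** (mat_powr (r * \<phi> s) (- D) ** mat_powr (r * \<phi> s) (- (trace E *\<^sub>R B))) =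
      (mat_powr (\<phi> s) (- D) ** mat_powr (\<phi> s) (- (trace E *\<^sub>R B))) ** mat_powr (r powr - trace E) B"
    by (simp add: matrix_mul_assoc)
  have "W (mat_powr r (transpose E) *v s) ** transpose (mat_powr r D) =
      transpose (mat_powr (r powr - trace E) B) ** W s"
    unfolding W_def \<phi> matrix_transpose_mul[symmetric] eq ..
  then show ?thesis
    by (simp add: matrix_vector_mul_assoc transpose_mat_powr)
qed

text \<open>Substituting by a power of the adjoint of E contributes the Jacobian r^q, while
  homogeneity of \<open>log_char \<mu>\<close> contributes r^(-q).\<close>

lemma integral_V_scaling:
  assumes r: "r > 0"
  shows "(\<integral>s. log_char \<mu> (\<Sum>j\<in>J. V (t j) (transpose (mat_powr r D) *v u j) s) \<partial>lborel) =
    (\<integral>s. log_char \<mu> (\<Sum>j\<in>J. V (mat_powr r E *v t j) (u j) s) \<partial>lborel)"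
proof -
  let ?T = "mat_powr r (transpose E)"
  let ?F = "\<lambda>s. log_char \<mu> (\<Sum>j\<in>J. V (t j) (transpose (mat_powr r D) *v u j) s)"
  have F[measurable]: "?F \<in> borel_measurable borel"
    by (intro measurable_compose[OF _ measurable_log_char] borel_measurable_sum measurable_V)
  have tr: "trace (transpose E) = trace E"
    by (simp add: trace_def transpose_def)
  have "r powr trace E *\<^sub>R ?F (?T *v s) = log_char \<mu> (\<Sum>j\<in>J. V (mat_powr r E *v t j) (u j) s)"
    if s: "s \<noteq> 0" for s
  proof -
    let ?A = "mat_powr (r powr - trace E) (transpose B)"
    have "V (t j) (transpose (mat_powr r D) *v u j) (?T *v s) = direct_sum ?A *v V (mat_powr r E *v t j) (u j) s" for j
      by (rule V_scale[OF W_scaling[OF r s]]) (simp add: inner_matrix_mult_vec transpose_mat_powr)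
    then have "?F (?T *v s) = complex_of_real (r powr - trace E) * log_char \<mu> (\<Sum>j\<in>J. V (mat_powr r E *v t j) (u j) s)"
      using r by (simp add: direct_sum_sum_V log_char_homogeneous)
    then show ?thesis
      using r by (simp add: scaleR_conv_of_real powr_minus flip: mult.assoc of_real_mult)
  qed
  \<comment> \<open>The scaling of \<phi> is available only off the origin, which is a null
    set.\<close>
  moreover have "AE s in lborel. s \<noteq> (0 :: real^'d)"
    by (rule AE_lborel_singleton)
  ultimately have ae: "AE s in lborel. r powr trace E *\<^sub>R ?F (?T *v s) = log_char \<mu> (\<Sum>j\<in>J. V (mat_powr r E *v t j) (u j) s)"
    by (auto elim: eventually_mono)
  have [measurable]: "(*v) ?T \<in> borel_measurable borel"
    by (intro borel_measurable_continuous_onI matrix_vector_mult_linear_continuous_on)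
  have G: "(\<lambda>s. log_char \<mu> (\<Sum>j\<in>J. V (mat_powr r E *v t j) (u j) s)) \<in> borel_measurable lborel"
    using measurable_compose[OF borel_measurable_sum[OF measurable_V] measurable_log_char] by simp
  have "(\<integral>s. ?F s \<partial>lborel) = (\<integral>s. r powr trace E *\<^sub>R ?F (?T *v s) \<partial>lborel)"
    using integral_lborel_mat_powr[OF r F, of "transpose E"] by (simp add: tr)
  also have "\<dots> = (\<integral>s. log_char \<mu> (\<Sum>j\<in>J. V (mat_powr r E *v t j) (u j) s) \<partial>lborel)"
    by (rule integral_cong_AE[OF _ G ae]) measurable
  finally show ?thesis .
qed

lemma self_similar: "operator_self_similar P X E D"
  unfolding operator_self_similar_def fdd_eq_def
proof (intro allI impI)
  fix r :: real and J :: "(real^'d) set" assume r: "r > 0" and J: "finite J"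
  show "distr P (\<Pi>\<^sub>M t\<in>J. borel) (\<lambda>\<omega>. \<lambda>t\<in>J. X (mat_powr r E *v t) \<omega>) =
      distr P (\<Pi>\<^sub>M t\<in>J. borel) (\<lambda>\<omega>. \<lambda>t\<in>J. mat_powr r D *v X t \<omega>)"
  proof (rule char_eq_imp_distr_vec_eq[OF prob_space_axioms prob_space_axioms J])
    fix u
    have "(CLINT \<omega>|P. iexp (\<Sum>t\<in>J. X (mat_powr r E *v t) \<omega> \<bullet> u t)) =
        (CLINT \<omega>|P. iexp (\<Sum>t\<in>J. X t \<omega> \<bullet> (transpose (mat_powr r D) *v u t)))"
      using integral_V_scaling[OF r, where t="\<lambda>t. t"] by (simp only: char_X)
    then show "(CLINT \<omega>|P. iexp (\<Sum>t\<in>J. X (mat_powr r E *v t) \<omega> \<bullet> u t)) =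
        (CLINT \<omega>|P. iexp (\<Sum>t\<in>J. (mat_powr r D *v X t \<omega>) \<bullet> u t))"
      by (simp only: inner_matrix_mult_vec)
  qed measurable
qed

section \<open>Strict operator-stability\<close>

lemma log_char_V_stable:
  assumes comm: "D ** B = B ** D" and r: "r > 0"
  shows "log_char \<mu> (\<Sum>j\<in>J. V (t j) (transpose (mat_powr r B) *v u j) s) =
    r * log_char \<mu> (\<Sum>j\<in>J. V (t j) (u j) s)"
proof -
  \<comment> \<open>To reach the random measure, r^B has to pass both powers of \<phi>; commutation
    of D and B lets it pass the first one.\<close>
  have "mat_powr r B ** (mat_powr c (- D) ** mat_powr c (- (trace E *\<^sub>R B))) =
      (mat_powr c (- D) ** mat_powr c (- (trace E *\<^sub>R B))) ** mat_powr r B" for c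
  proof -
    have 1: "mat_powr r B ** mat_powr c (- D) = mat_powr c (- D) ** mat_powr r B"
    proof (rule mat_powr_commute, rule mat_powr_commute[symmetric])
      show "- D ** B = B ** - D"
        by (simp add: linear_neg[OF linear_matrix_mult_left] linear_neg[OF linear_matrix_mult_right] comm)
    qed
    have 2: "mat_powr r B ** mat_powr c (- (trace E *\<^sub>R B)) = mat_powr c (- (trace E *\<^sub>R B)) ** mat_powr r B"
    proof (rule mat_powr_commute, rule mat_powr_commute[symmetric])
      show "- (trace E *\<^sub>R B) ** B = B ** - (trace E *\<^sub>R B)"
        by (simp add: linear_neg[OF linear_matrix_mult_left] linear_neg[OF linear_matrix_mult_right]
            linear_cmul[OF linear_matrix_mult_left] linear_cmul[OF linear_matrix_mult_right])
    qed
    show ?thesis by (metis 1 2 matrix_mul_assoc)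
  qed
  then have "W s ** transpose (mat_powr r B) = transpose (mat_powr r B) ** W s"
    by (simp add: W_def flip: matrix_transpose_mul)
  then have "V (t j) (transpose (mat_powr r B) *v u j) s = direct_sum (mat_powr r (transpose B)) *v V (t j) (u j) s" for j
    by (intro V_scale) (simp_all add: matrix_vector_mul_assoc transpose_mat_powr)
  then show ?thesis
    using r by (simp add: direct_sum_sum_V log_char_homogeneous)
qed

text \<open>With arbitrary test vectors at finitely many points, this one identity covers the linear
  combinations in \<open>field_exponent\<close> as well as the joint laws.\<close>

lemma char_X_stable:
  assumes comm: "D ** B = B ** D" and n: "n \<ge> 1"
  shows "(CLINT \<omega>|P. iexp (\<Sum>j\<in>J. X (t j) \<omega> \<bullet> (transpose (mat_powr (real n) (- B)) *v u j))) ^ n =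
    (CLINT \<omega>|P. iexp (\<Sum>j\<in>J. X (t j) \<omega> \<bullet> u j))"
proof -
  have n': "real n > 0" using n by simp
  have "log_char \<mu> (\<Sum>j\<in>J. V (t j) (transpose (mat_powr (real n) (- B)) *v u j) s) =
      inverse (real n) * log_char \<mu> (\<Sum>j\<in>J. V (t j) (u j) s)" for s
    unfolding mat_powr_uminus[OF n'] using n' by (intro log_char_V_stable comm) simp
  then show ?thesis
    unfolding char_X using n' by (simp add: mult.assoc[symmetric] flip: exp_of_nat_mult)
qed

lemma exponent:
  assumes comm: "D ** B = B ** D"
  shows "field_exponent P X B"
  unfolding field_exponent_def operator_stable_exponent_def
proof (intro allI impI exI[of _ 0])
  fix k n :: nat and c :: "nat \<Rightarrow> real" and t :: "nat \<Rightarrow> real^'d" assume n: "n \<ge> 1"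
  define Y where "Y \<omega> = (\<Sum>j<k. c j *\<^sub>R X (t j) \<omega>)" for \<omega>
  have Y[measurable]: "Y \<in> borel_measurable P" unfolding Y_def by measurable
  define \<nu> where "\<nu> = distr P borel Y"
  have \<nu>: "distribution \<nu>" by (simp add: distribution_def \<nu>_def prob_space_distr)
  interpret \<nu>: prob_space \<nu> using \<nu> by (simp add: distribution_def)
  interpret prod: product_prob_space "\<lambda>_ :: nat. \<nu>" "{..<n}" by unfold_locales
  have sum: "(\<lambda>x. \<Sum>i<n. x i) \<in> borel_measurable (\<Pi>\<^sub>M i\<in>{..<n}. \<nu>)"
    unfolding \<nu>_def by measurable
  have Yu: "Y \<omega> \<bullet> u = (\<Sum>j<k. X (t j) \<omega> \<bullet> (c j *\<^sub>R u))" for \<omega> u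
    by (simp add: Y_def inner_sum_left)
  have char_\<nu>: "char_fun \<nu> u = (CLINT \<omega>|P. iexp (\<Sum>j<k. X (t j) \<omega> \<bullet> (c j *\<^sub>R u)))" for u
    unfolding char_fun_def \<nu>_def by (simp add: integral_distr Yu)
  have "distr (\<Pi>\<^sub>M i\<in>{..<n}. \<nu>) borel (\<lambda>x. mat_powr (real n) (- B) *v (\<Sum>i<n. x i) + 0) = distr P borel Y"
  proof (rule char_eq_imp_distr_eq[OF prod.P.prob_space_axioms prob_space_axioms])
    fix u
    let ?u = "transpose (mat_powr (real n) (- B)) *v u"
    have "(CLINT x|(\<Pi>\<^sub>M i\<in>{..<n}. \<nu>). iexp ((mat_powr (real n) (- B) *v (\<Sum>i<n. x i) + 0) \<bullet> u)) =
        char_fun (distr (\<Pi>\<^sub>M i\<in>{..<n}. \<nu>) borel (\<lambda>x. \<Sum>i<n. x i)) ?u"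
      unfolding char_fun_def using sum by (simp add: integral_distr inner_matrix_mult_vec)
    also have "\<dots> = char_fun \<nu> ?u ^ n"
      by (rule char_fun_distr_sum[OF \<nu>])
    also have "\<dots> = (CLINT \<omega>|P. iexp (\<Sum>j<k. X (t j) \<omega> \<bullet> (c j *\<^sub>R u)))"
      unfolding char_\<nu> matrix_vector_mult_scaleR[symmetric] by (rule char_X_stable[OF comm n])
    finally show "(CLINT x|(\<Pi>\<^sub>M i\<in>{..<n}. \<nu>). iexp ((mat_powr (real n) (- B) *v (\<Sum>i<n. x i) + 0) \<bullet> u)) =
        (CLINT \<omega>|P. iexp (Y \<omega> \<bullet> u))"
      by (simp add: Yu)
  qed (use sum in measurable)
  then show "distr (\<Pi>\<^sub>M i\<in>{..<n}. distr P borel (\<lambda>\<omega>. \<Sum>j<k. c j *\<^sub>R X (t j) \<omega>)) borel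
      (\<lambda>x. mat_powr (real n) (- B) *v (\<Sum>i<n. x i) + 0) = distr P borel (\<lambda>\<omega>. \<Sum>j<k. c j *\<^sub>R X (t j) \<omega>)"
    by (simp add: \<nu>_def Y_def[abs_def])
qed

lemma strictly_stable:
  assumes comm: "D ** B = B ** D"
  shows "strictly_operator_stable_field P X"
  unfolding strictly_operator_stable_field_def strictly_operator_stable_def
proof (intro allI impI)
  fix k n :: nat and t :: "nat \<Rightarrow> real^'d" assume n: "n \<ge> 1"
  define A where "A = mat_powr (real n) (- B)"
  define A' where "A' = mat_powr (real n) B"
  have AA': "A ** A' = mat 1" "A' ** A = mat 1"
    using n by (simp_all add: A_def A'_def mat_powr_uminus mat_powr_inverse mat_powr_inverse')
  \<comment> \<open>The norming operator on the product space is block diagonal with n^(-B) in every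
    block.\<close>
  define L where "L i j = (if i = j then A else 0)" for i j :: nat
  define N where "N = (\<Pi>\<^sub>M j\<in>{..<k}. borel :: (real^'m) measure)"
  define Y where "Y \<omega> = (\<lambda>j\<in>{..<k}. X (t j) \<omega>)" for \<omega>
  have Y[measurable]: "Y \<in> measurable P N" unfolding Y_def N_def by measurable
  define \<nu> where "\<nu> = distr P N Y"
  interpret \<nu>: prob_space \<nu> unfolding \<nu>_def by (rule prob_space_distr[OF Y])
  interpret prod: product_prob_space "\<lambda>_ :: nat. \<nu>" "{..<n}" by unfold_locales
  have inv: "block_invertible k L"
    unfolding block_invertible_def
  proof (intro exI[of _ "\<lambda>i j. if i = j then A' else 0"] allI impI)
    fix i j assume "i < k" "j < k"
    have "(\<Sum>l<k. L i l ** (if l = j then A' else 0)) = (\<Sum>l<k. if l = i then A ** (if i = j then A' else 0) else 0)"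
      by (rule sum.cong) (auto simp: L_def)
    also have "\<dots> = A ** (if i = j then A' else 0)"
      using \<open>i < k\<close> by simp
    finally have 1: "(\<Sum>l<k. L i l ** (if l = j then A' else 0)) = A ** (if i = j then A' else 0)" .
    have "(\<Sum>l<k. (if i = l then A' else 0) ** L l j) = (\<Sum>l<k. if l = i then A' ** (if i = j then A else 0) else 0)"
      by (rule sum.cong) (auto simp: L_def)
    also have "\<dots> = A' ** (if i = j then A else 0)"
      using \<open>i < k\<close> by simp
    finally have 2: "(\<Sum>l<k. (if i = l then A' else 0) ** L l j) = A' ** (if i = j then A else 0)" .
    show "(\<Sum>l<k. L i l ** (if l = j then A' else 0)) = (if i = j then mat 1 else 0) \<and>
        (\<Sum>l<k. (if i = l then A' else 0) ** L l j) = (if i = j then mat 1 else 0)"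
      unfolding 1 2 using AA' by auto
  qed
  have block: "block_apply k L y = (\<lambda>i\<in>{..<k}. A *v y i)" for y
  proof -
    have "(\<Sum>j<k. L i j *v y j) = (\<Sum>j<k. if j = i then A *v y i else 0)" for i
      by (intro sum.cong) (auto simp: L_def)
    then show ?thesis by (auto simp: block_apply_def fun_eq_iff)
  qed
  have comp: "(\<lambda>x. x l j) \<in> borel_measurable (\<Pi>\<^sub>M l\<in>{..<n}. \<nu>)" if "l < n" "j < k" for l j
  proof -
    have "(\<lambda>x. x l) \<in> measurable (\<Pi>\<^sub>M l\<in>{..<n}. \<nu>) N"
      using measurable_component_singleton[of l "{..<n}" "\<lambda>_. \<nu>"] that by (simp add: \<nu>_def)
    moreover have "(\<lambda>y. y j) \<in> borel_measurable N"
      unfolding N_def using that by (intro measurable_component_singleton) simp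
    ultimately show ?thesis by (rule measurable_compose)
  qed
  have "distr (\<Pi>\<^sub>M l\<in>{..<n}. \<nu>) (\<Pi>\<^sub>M j\<in>{..<k}. borel) (\<lambda>x. \<lambda>j\<in>{..<k}. A *v (\<Sum>l<n. x l j)) =
      distr P (\<Pi>\<^sub>M j\<in>{..<k}. borel) (\<lambda>\<omega>. \<lambda>j\<in>{..<k}. X (t j) \<omega>)"
  proof (rule char_eq_imp_distr_vec_eq[OF prod.P.prob_space_axioms prob_space_axioms])
    show "(\<lambda>x. A *v (\<Sum>l<n. x l j)) \<in> borel_measurable (\<Pi>\<^sub>M l\<in>{..<n}. \<nu>)" if "j \<in> {..<k}" for j
      using comp that by (intro borel_measurable_matrix_mult_vec borel_measurable_sum) auto
    fix u :: "nat \<Rightarrow> real^'m"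
    let ?u = "\<lambda>j :: nat. transpose A *v u j"
    let ?f = "\<lambda>y :: nat \<Rightarrow> real^'m. iexp (\<Sum>j<k. y j \<bullet> ?u j)"
    have f: "?f \<in> borel_measurable N"
      unfolding N_def by measurable
    have "(\<Sum>j<k. (A *v (\<Sum>l<n. x l j)) \<bullet> u j) = (\<Sum>l<n. \<Sum>j<k. x l j \<bullet> ?u j)" for x :: "nat \<Rightarrow> nat \<Rightarrow> real^'m"
      by (subst sum.swap) (simp add: inner_matrix_mult_vec inner_sum_left)
    then have "(CLINT x|(\<Pi>\<^sub>M l\<in>{..<n}. \<nu>). iexp (\<Sum>j<k. (A *v (\<Sum>l<n. x l j)) \<bullet> u j)) =
        (CLINT x|(\<Pi>\<^sub>M l\<in>{..<n}. \<nu>). (\<Prod>l<n. ?f (x l)))"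
      by (simp only: of_real_sum sum_distrib_left exp_sum[OF finite_lessThan])
    also have "\<dots> = (CLINT y|\<nu>. ?f y) ^ n"
      using f by (intro \<nu>.integral_PiM_iid) (auto simp: \<nu>_def)
    also have "(CLINT y|\<nu>. ?f y) = (CLINT \<omega>|P. iexp (\<Sum>j<k. X (t j) \<omega> \<bullet> ?u j))"
      unfolding \<nu>_def by (subst integral_distr[OF Y f]) (simp add: Y_def)
    also have "\<dots> ^ n = (CLINT \<omega>|P. iexp (\<Sum>j<k. X (t j) \<omega> \<bullet> u j))"
      unfolding A_def by (rule char_X_stable[OF comm n])
    finally show "(CLINT x|(\<Pi>\<^sub>M l\<in>{..<n}. \<nu>). iexp (\<Sum>j<k. (A *v (\<Sum>l<n. x l j)) \<bullet> u j)) =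
        (CLINT \<omega>|P. iexp (\<Sum>j<k. X (t j) \<omega> \<bullet> u j))" .
  qed measurable
  with inv show "\<exists>L. block_invertible k L \<and>
      distr (\<Pi>\<^sub>M l\<in>{..<n}. distr P (\<Pi>\<^sub>M j\<in>{..<k}. borel) (\<lambda>\<omega>. \<lambda>j\<in>{..<k}. X (t j) \<omega>)) (\<Pi>\<^sub>M j\<in>{..<k}. borel)
        (\<lambda>x. block_apply k L (\<lambda>j. \<Sum>l<n. x l j)) =
      distr P (\<Pi>\<^sub>M j\<in>{..<k}. borel) (\<lambda>\<omega>. \<lambda>j\<in>{..<k}. X (t j) \<omega>)"
    by (intro exI[of _ L]) (simp add: block \<nu>_def N_def Y_def[abs_def])
qed

section \<open>Stationary increments\<close>

lemma stationary:
  assumes inv: "\<And>A. A \<in> phase_rotations \<Longrightarrow> distr \<mu> borel (\<lambda>x. A *v x) = \<mu>"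
  shows "stationary_increments P X"
  unfolding stationary_increments_def fdd_eq_def
proof (intro allI impI)
  fix a :: "real^'d" and J :: "(real^'d) set" assume J: "finite J"
  have V_uminus: "V t (- u) s = - V t u s" for t u s
    by (simp add: V_def vec_sum_eq_iff linear_neg[OF matrix_vector_mul_linear])
  have char: "(CLINT \<omega>|P. iexp (\<Sum>t\<in>J. (X (f t) \<omega> - X b \<omega>) \<bullet> u t)) =
      exp (\<integral>s. log_char \<mu> (\<Sum>t\<in>J. V (f t) (u t) s - V b (u t) s) \<partial>lborel)" for f b u
  proof -
    have "stoch_int (\<lambda>s. \<Sum>t\<in>J. V (f t) (u t) s + V b (- u t) s) (\<lambda>\<omega>. \<Sum>t\<in>J. X (f t) \<omega> \<bullet> u t + X b \<omega> \<bullet> (- u t))"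
      by (intro stoch_int_sum stoch_int_add stoch_int_X)
    from char_stoch_int(3)[OF this] show ?thesis
      by (simp add: V_uminus inner_diff_left)
  qed
  \<comment> \<open>A shift by \<open>a\<close> multiplies the kernel by a phase depending on s but
    not on t. It can be pulled out of the sum over t at each s, where rotation invariance removes
    it.\<close>
  have "V (t + a) u s - V a u s = cscale (cnj (iexp (a \<bullet> s))) (V t u s - V 0 u s)" for t u s
    by (simp add: V_def inner_add_left distrib_left exp_add algebra_simps
        flip: cscale_mult cscale_diff_left)
  then have "(\<Sum>t\<in>J. V (t + a) (u t) s - V a (u t) s) =
      cscale (cnj (iexp (a \<bullet> s))) (\<Sum>t\<in>J. V t (u t) s - V 0 (u t) s)" for u s
    by (simp add: cscale_sum_right)
  then have rot: "log_char \<mu> (\<Sum>t\<in>J. V (t + a) (u t) s - V a (u t) s) =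
      log_char \<mu> (\<Sum>t\<in>J. V t (u t) s - V 0 (u t) s)" for u s
    using log_char_rotation_invariant[OF inv] by simp
  show "distr P (\<Pi>\<^sub>M t\<in>J. borel) (\<lambda>\<omega>. \<lambda>t\<in>J. X (t + a) \<omega> - X a \<omega>) =
      distr P (\<Pi>\<^sub>M t\<in>J. borel) (\<lambda>\<omega>. \<lambda>t\<in>J. X t \<omega> - X 0 \<omega>)"
  proof (rule char_eq_imp_distr_vec_eq[OF prob_space_axioms prob_space_axioms J])
    show "(CLINT \<omega>|P. iexp (\<Sum>t\<in>J. (X (t + a) \<omega> - X a \<omega>) \<bullet> u t)) =
        (CLINT \<omega>|P. iexp (\<Sum>t\<in>J. (X t \<omega> - X 0 \<omega>) \<bullet> u t))" for u
      unfolding char rot ..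
  qed measurable
qed

section \<open>Fullness\<close>

lemma W_mult_eq_0_iff: "s \<noteq> 0 \<Longrightarrow> W s *v u = 0 \<longleftrightarrow> u = 0"
  using \<phi>_pos[of s]
  by (simp add: W_def matrix_transpose_mul transpose_mat_powr matrix_vector_mul_assoc[symmetric]
      mat_powr_invertible_apply del: matrix_vector_mul_assoc)

lemma join_vec_eq_0_iff: "join_vec a 0 = 0 \<longleftrightarrow> a = 0"
  by (simp add: vec_sum_eq_iff vec_eq_iff)

text \<open>A constant projection would have a characteristic function of modulus 1, so the integral
  of \<open>h\<close> over the kernel would vanish. By positivity of \<open>h\<close> and
  invertibility of \<open>W\<close> the oscillating factor would be 0 almost everywhere, but it is
  nonzero on the open slab 0 < t \<bullet> s < 1.\<close>

lemma X_full: "full_field P X"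
  unfolding full_field_def full_def
proof (intro allI impI notI)
  fix t :: "real^'d" and a :: "real^'m" and c
  assume t: "t \<noteq> 0" and a: "a \<noteq> 0" and ae: "AE x in distr P borel (X t). a \<bullet> x = c"
  have ae': "AE \<omega> in P. a \<bullet> X t \<omega> = c"
    using ae by (subst (asm) AE_distr_iff) auto
  have "(CLINT \<omega>|P. iexp (X t \<omega> \<bullet> a)) = (CLINT \<omega>|P. iexp c)"
    using ae' by (intro integral_cong_AE measurable_iexp) (auto simp: inner_commute elim: eventually_mono)
  then have "iexp c = exp (\<integral>s. log_char \<mu> (V t a s) \<partial>lborel)"
    using char_stoch_int(3)[OF stoch_int_X, of t a] by (simp add: prob_space)
  then have "exp (Re (\<integral>s. log_char \<mu> (V t a s) \<partial>lborel)) = 1"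
    by (metis norm_exp_eq_Re norm_exp_i_times)
  then have "(\<integral>s. h (V t a s) \<partial>lborel) = 0"
    using char_stoch_int(2)[OF stoch_int_X, of t a] by (simp add: h_def flip: integral_Re)
  then have "AE s in lborel. h (V t a s) = 0"
    using integral_nonneg_eq_0_iff_AE[OF char_stoch_int(1)[OF stoch_int_X, of t a]] h_nonneg by simp
  moreover have "AE s in lborel. s \<noteq> (0 :: real^'d)"
    by (rule AE_lborel_singleton)
  ultimately have "AE s in lborel. s \<notin> {s. 0 < t \<bullet> s \<and> t \<bullet> s < 1}"
  proof eventually_elim
    case (elim s)
    have "V t a s = 0"
      using h_pos[of "V t a s"] elim(1) by fastforce
    then have "iexp (t \<bullet> s) = 1"
      using a elim(2) by (simp add: V_def cscale_eq_0_iff join_vec_eq_0_iff W_mult_eq_0_iff)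
    then have "sin (t \<bullet> s) = 0"
      by (metis Im_exp Im_i_times Re_complex_of_real Re_i_times Im_complex_of_real exp_zero mult_cancel_right1 one_complex.sel(2) minus_zero)
    then show ?case
      using sin_gt_zero[of "t \<bullet> s"] pi_gt3 by auto
  qed
  moreover have "open {s. 0 < t \<bullet> s \<and> t \<bullet> s < 1}"
    by (intro open_Collect_conj open_Collect_less continuous_intros)
  ultimately have "{s. 0 < t \<bullet> s \<and> t \<bullet> s < 1} \<in> null_sets lborel"
    by (subst AE_iff_null_sets) auto
  then have "negligible {s. 0 < t \<bullet> s \<and> t \<bullet> s < 1}"
    by (simp add: negligible_iff_null_sets null_sets_completionI)
  \<comment> \<open>On this multiple of t the inner product with t is 1/2, so the slab is
    nonempty.\<close>
  moreover have "(1 / (2 * (t \<bullet> t))) *\<^sub>R t \<in> {s. 0 < t \<bullet> s \<and> t \<bullet> s < 1}"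
    using t by simp
  ultimately show False
    using open_not_negligible[of "{s. 0 < t \<bullet> s \<and> t \<bullet> s < 1}"] \<open>open _\<close> by blast
qed

end

section \<open>Convergence in probability\<close>

text \<open>Averaging 1 - cos (y x) over a standard Gaussian y gives 1 - exp (-x^2 / 2), which
  exceeds a positive constant when |x| > \<epsilon>. Exchanging the integrals bounds the probability
  by an average of characteristic functions, and that average tends to 0 by dominated
  convergence.\<close>

lemma (in prob_space) char_tendsto_1_imp_tendsto_0_in_prob:
  fixes Y :: "nat \<Rightarrow> 'a \<Rightarrow> real"
  assumes Y[measurable]: "\<And>n. Y n \<in> borel_measurable M"
    and lim: "\<And>y. (\<lambda>n. CLINT \<omega>|M. iexp (y * Y n \<omega>)) \<longlonglongrightarrow> 1"
    and \<epsilon>: "\<epsilon> > 0"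
  shows "(\<lambda>n. measure M {\<omega> \<in> space M. \<bar>Y n \<omega>\<bar> > \<epsilon>}) \<longlonglongrightarrow> 0"
proof -
  let ?\<gamma> = "std_normal_distribution"
  interpret \<gamma>: real_distribution ?\<gamma> by (rule real_dist_normal_dist)
  interpret PP: pair_prob_space M ?\<gamma> ..
  define K where "K n = (\<integral>\<omega>. 1 - exp (- (Y n \<omega>)\<^sup>2 / 2) \<partial>M)" for n
  have cosM: "integrable M (\<lambda>\<omega>. cos (y * Y n \<omega>))" for y n
    by (rule integrable_const_bound[where B=1]) auto
  have cos\<gamma>: "integrable ?\<gamma> (\<lambda>y. cos (y * x))" for x
    by (rule \<gamma>.integrable_const_bound[where B=1]) auto
  have gauss: "(\<integral>y. 1 - cos (y * x) \<partial>?\<gamma>) = 1 - exp (- x\<^sup>2 / 2)" for x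
  proof -
    have "integrable ?\<gamma> (\<lambda>y. iexp (x * y))"
      by (rule \<gamma>.integrable_const_bound[where B=1]) auto
    then have "(\<integral>y. cos (y * x) \<partial>?\<gamma>) = Re (char ?\<gamma> x)"
      by (simp add: char_def Re_exp mult.commute flip: integral_Re)
    then show ?thesis
      using cos\<gamma> \<gamma>.prob_space by (simp add: char_std_normal_distribution)
  qed
  have K_eq: "K n = (\<integral>y. 1 - (\<integral>\<omega>. cos (y * Y n \<omega>) \<partial>M) \<partial>?\<gamma>)" for n
  proof -
    have "K n = (\<integral>\<omega>. (\<integral>y. 1 - cos (y * Y n \<omega>) \<partial>?\<gamma>) \<partial>M)"
      by (simp only: K_def gauss)
    also have "\<dots> = (\<integral>y. (\<integral>\<omega>. 1 - cos (y * Y n \<omega>) \<partial>M) \<partial>?\<gamma>)"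
    proof (rule PP.Fubini_integral[symmetric])
      show "integrable (M \<Otimes>\<^sub>M ?\<gamma>) (\<lambda>(\<omega>, y). 1 - cos (y * Y n \<omega>))"
        by (rule PP.P.integrable_const_bound[where B=2])
          (auto simp: abs_le_iff split_beta intro: order_trans[OF _ cos_ge_minus_one])
    qed
    finally show ?thesis
      using cosM by (simp add: prob_space)
  qed
  have "(\<lambda>n. \<integral>y. 1 - (\<integral>\<omega>. cos (y * Y n \<omega>) \<partial>M) \<partial>?\<gamma>) \<longlonglongrightarrow> (\<integral>y. 0 \<partial>?\<gamma>)"
  proof (rule integral_dominated_convergence[where w="\<lambda>_. 2"])
    have "(\<lambda>n. \<integral>\<omega>. cos (y * Y n \<omega>) \<partial>M) \<longlonglongrightarrow> 1" for y
    proof -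
      have "integrable M (\<lambda>\<omega>. iexp (y * Y n \<omega>))" for n
        by (rule integrable_const_bound[where B=1]) auto
      then have "(\<integral>\<omega>. cos (y * Y n \<omega>) \<partial>M) = Re (CLINT \<omega>|M. iexp (y * Y n \<omega>))" for n
        by (simp add: Re_exp flip: integral_Re)
      then show ?thesis using tendsto_Re[OF lim[of y]] by simp
    qed
    then have "(\<lambda>n. 1 - (\<integral>\<omega>. cos (y * Y n \<omega>) \<partial>M)) \<longlonglongrightarrow> 1 - 1" for y
      by (intro tendsto_intros)
    then show "AE y in ?\<gamma>. (\<lambda>n. 1 - (\<integral>\<omega>. cos (y * Y n \<omega>) \<partial>M)) \<longlonglongrightarrow> 0"
      by simp
    show "AE y in ?\<gamma>. norm (1 - (\<integral>\<omega>. cos (y * Y n \<omega>) \<partial>M)) \<le> 2" for n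
    proof (rule AE_I2)
      fix y
      have "\<bar>\<integral>\<omega>. cos (y * Y n \<omega>) \<partial>M\<bar> \<le> (\<integral>\<omega>. \<bar>cos (y * Y n \<omega>)\<bar> \<partial>M)"
        using integral_norm_bound[of M "\<lambda>\<omega>. cos (y * Y n \<omega>)"] by simp
      also have "\<dots> \<le> (\<integral>\<omega>. 1 \<partial>M)"
        using cosM by (intro integral_mono) auto
      finally show "norm (1 - (\<integral>\<omega>. cos (y * Y n \<omega>) \<partial>M)) \<le> 2"
        by (simp add: prob_space)
    qed
  qed auto
  then have "(\<lambda>n. K n / (1 - exp (- \<epsilon>\<^sup>2 / 2))) \<longlonglongrightarrow> 0"
    using K_eq by (intro tendsto_divide_zero) simp
  then show ?thesis
  proof (rule tendsto_sandwich[OF _ _ tendsto_const, rotated -1])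
    have "measure M {\<omega> \<in> space M. \<bar>Y n \<omega>\<bar> > \<epsilon>} \<le> K n / (1 - exp (- \<epsilon>\<^sup>2 / 2))" for n
    proof -
      let ?A = "{\<omega> \<in> space M. \<bar>Y n \<omega>\<bar> > \<epsilon>}"
      have pos: "1 - exp (- \<epsilon>\<^sup>2 / 2) > 0" using \<epsilon> by simp
      have "(\<integral>\<omega>. (1 - exp (- \<epsilon>\<^sup>2 / 2)) * indicator ?A \<omega> \<partial>M) \<le> K n"
        unfolding K_def
      proof (rule integral_mono)
        show "integrable M (\<lambda>\<omega>. (1 - exp (- \<epsilon>\<^sup>2 / 2)) * indicator ?A \<omega>)"
          by (intro integrable_mult_right integrable_real_indicator) (auto simp: emeasure_eq_measure)
        show "integrable M (\<lambda>\<omega>. 1 - exp (- (Y n \<omega>)\<^sup>2 / 2))"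
          by (rule integrable_const_bound[where B=1]) auto
        fix \<omega>
        show "(1 - exp (- \<epsilon>\<^sup>2 / 2)) * indicator ?A \<omega> \<le> 1 - exp (- (Y n \<omega>)\<^sup>2 / 2)"
        proof (cases "\<omega> \<in> ?A")
          case True
          then have "\<epsilon>\<^sup>2 \<le> \<bar>Y n \<omega>\<bar>\<^sup>2"
            using \<epsilon> by (intro power_mono) auto
          then show ?thesis using True by simp
        qed simp
      qed
      also have "(\<integral>\<omega>. (1 - exp (- \<epsilon>\<^sup>2 / 2)) * indicator ?A \<omega> \<partial>M) = (1 - exp (- \<epsilon>\<^sup>2 / 2)) * measure M ?A"
        by (simp add: Int_absorb2 subset_eq)
      finally show ?thesis
        using pos by (simp add: pos_le_divide_eq mult.commute)
    qed
    then show "eventually (\<lambda>n. measure M {\<omega> \<in> space M. \<bar>Y n \<omega>\<bar> > \<epsilon>} \<le> K n / (1 - exp (- \<epsilon>\<^sup>2 / 2))) sequentially"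
      by simp
  qed simp
qed

lemma (in prob_space) char_tendsto_1_imp_tendsto_in_prob:
  fixes Y :: "nat \<Rightarrow> 'a \<Rightarrow> real^'n" and Z :: "'a \<Rightarrow> real^'n"
  assumes Y[measurable]: "\<And>n. Y n \<in> borel_measurable M" and Z[measurable]: "Z \<in> borel_measurable M"
    and lim: "\<And>u. (\<lambda>n. CLINT \<omega>|M. iexp ((Y n \<omega> - Z \<omega>) \<bullet> u)) \<longlonglongrightarrow> 1"
  shows "tendsto_in_prob M Y Z"
  unfolding tendsto_in_prob_def
proof (intro allI impI)
  fix \<epsilon> :: real assume \<epsilon>: "\<epsilon> > 0"
  \<comment> \<open>The norm is at most the sum of the absolute coordinates, so a deviation beyond
    \<epsilon> forces one coordinate beyond \<epsilon> divided by the dimension.\<close>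
  define \<delta> where "\<delta> = \<epsilon> / CARD('n)"
  have \<delta>: "\<delta> > 0" using \<epsilon> by (simp add: \<delta>_def)
  let ?A = "\<lambda>i n. {\<omega> \<in> space M. \<bar>(Y n \<omega> - Z \<omega>) $ i\<bar> > \<delta>}"
  have nth: "(\<lambda>\<omega>. (Y n \<omega> - Z \<omega>) $ i) \<in> borel_measurable M" for i n
    by (rule measurable_compose[OF _ borel_measurable_nth]) measurable
  have A: "?A i n \<in> sets M" for i n
    by (intro borel_measurable_less borel_measurable_abs borel_measurable_const nth)
  show "(\<lambda>n. measure M {\<omega> \<in> space M. dist (Y n \<omega>) (Z \<omega>) > \<epsilon>}) \<longlonglongrightarrow> 0"
  proof (rule tendsto_sandwich[OF _ _ tendsto_const])
    have "(\<lambda>n. measure M (?A i n)) \<longlonglongrightarrow> 0" for i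
    proof (rule char_tendsto_1_imp_tendsto_0_in_prob[OF _ _ \<delta>])
      show "(\<lambda>n. CLINT \<omega>|M. iexp (y * (Y n \<omega> - Z \<omega>) $ i)) \<longlonglongrightarrow> 1" for y
        using lim[of "axis i y"] by (simp add: inner_axis mult.commute)
    qed (rule nth)
    then have "(\<lambda>n. \<Sum>i\<in>UNIV. measure M (?A i n)) \<longlonglongrightarrow> (\<Sum>i\<in>(UNIV :: 'n set). 0)"
      by (rule tendsto_sum)
    then show "(\<lambda>n. \<Sum>i\<in>UNIV. measure M (?A i n)) \<longlonglongrightarrow> 0" by simp
    have "measure M {\<omega> \<in> space M. dist (Y n \<omega>) (Z \<omega>) > \<epsilon>} \<le> (\<Sum>i\<in>UNIV. measure M (?A i n))" for n
    proof -
      have "{\<omega> \<in> space M. dist (Y n \<omega>) (Z \<omega>) > \<epsilon>} \<subseteq> (\<Union>i\<in>UNIV. ?A i n)"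
      proof (rule subsetI, rule ccontr)
        fix \<omega> assume \<omega>: "\<omega> \<in> {\<omega> \<in> space M. dist (Y n \<omega>) (Z \<omega>) > \<epsilon>}" "\<omega> \<notin> (\<Union>i\<in>UNIV. ?A i n)"
        have "dist (Y n \<omega>) (Z \<omega>) \<le> (\<Sum>i\<in>UNIV. \<bar>(Y n \<omega> - Z \<omega>) $ i\<bar>)"
          unfolding dist_norm by (rule norm_le_l1_cart)
        also have "\<dots> \<le> (\<Sum>i\<in>(UNIV :: 'n set). \<delta>)"
          using \<omega> by (intro sum_mono) (auto simp: not_less)
        also have "\<dots> = \<epsilon>" by (simp add: \<delta>_def)
        finally show False using \<omega> by simp
      qed
      then have "measure M {\<omega> \<in> space M. dist (Y n \<omega>) (Z \<omega>) > \<epsilon>} \<le> measure M (\<Union>i\<in>UNIV. ?A i n)"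
        using A by (intro finite_measure_mono) auto
      also have "\<dots> \<le> (\<Sum>i\<in>UNIV. measure M (?A i n))"
        using A by (intro finite_measure_subadditive_finite) auto
      finally show ?thesis .
    qed
    then show "eventually (\<lambda>n. measure M {\<omega> \<in> space M. dist (Y n \<omega>) (Z \<omega>) > \<epsilon>}
        \<le> (\<Sum>i\<in>UNIV. measure M (?A i n))) sequentially"
      by simp
  qed simp
qed

text \<open>
  Shifting \<open>\<tau>\<close> by \<open>d = (\<pi> / |s|\<^sup>2) s\<close> changes the sign of \<open>iexp (\<tau> \<bullet> s)\<close>, and for large \<open>|s|\<close> the
  shift hardly moves the set \<open>S\<close>.
\<close>

lemma measure_phase_ge_quarter:
  fixes S :: "(real^'d) set"
  assumes S: "compact S" "emeasure lborel S = ennreal m" "m > 0"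
  shows "\<exists>R>0. \<forall>s. norm s > R \<longrightarrow> ennreal (m / 4) \<le> emeasure lborel {\<tau> \<in> S. 1 \<le> cmod (iexp (\<tau> \<bullet> s) - 1)}"
proof -
  have S_borel: "S \<in> sets borel" using S(1) by (simp add: borel_compact)
  obtain U where U: "open U" "S \<subseteq> U" "emeasure lborel (U - S) < ennreal (m / 2)"
    using outer_regular_lborel[OF S_borel, of "m / 2"] S(3) by auto
  obtain \<delta> where \<delta>: "\<delta> > 0" "(\<Union>x\<in>S. ball x \<delta>) \<subseteq> U"
    using compact_subset_open_imp_ball_epsilon_subset[OF S(1) U(1,2)] by blast
  show ?thesis
  proof (intro exI[of _ "pi / \<delta>"] conjI allI impI)
    show "pi / \<delta> > 0" using \<delta> by simp
    fix s :: "real^'d" assume s: "norm s > pi / \<delta>"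
    have s0: "norm s > 0" using s \<delta> by (meson divide_pos_pos pi_gt_zero less_trans)
    define d where "d = (pi / (norm s)\<^sup>2) *\<^sub>R s"
    have "norm d = pi / norm s"
      using s0 by (simp add: d_def power2_eq_square)
    also have "\<dots> < \<delta>"
      using s s0 \<delta> by (simp add: field_simps)
    finally have norm_d: "norm d < \<delta>" .
    have ds: "d \<bullet> s = pi"
      using s0 by (simp add: d_def dot_square_norm)
    let ?G = "{\<tau> \<in> S. 1 \<le> cmod (iexp (\<tau> \<bullet> s) - 1)}"
    have cont: "continuous_on UNIV (\<lambda>\<tau>. cmod (iexp (\<tau> \<bullet> s) - 1))"
      by (intro continuous_intros)
    have "closed {\<tau>. 1 \<le> cmod (iexp (\<tau> \<bullet> s) - 1)}"
      by (intro closed_Collect_le cont continuous_intros)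
    then have G: "?G \<in> sets borel"
      using S_borel by (simp add: Collect_conj_eq borel_closed)
    have "(\<lambda>\<tau>. d + \<tau>) ` (S - ?G) \<subseteq> ?G \<union> (U - S)"
    proof (rule image_subsetI)
      fix \<tau> assume \<tau>: "\<tau> \<in> S - ?G"
      then have "d + \<tau> \<in> U"
        using \<delta>(2) norm_d by (force simp: dist_norm)
      moreover have "1 \<le> cmod (iexp ((d + \<tau>) \<bullet> s) - 1)"
      proof -
        have "iexp ((d + \<tau>) \<bullet> s) = - iexp (\<tau> \<bullet> s)"
          by (simp add: inner_add_left ds distrib_left exp_add)
        \<comment> \<open>After the change of sign the modulus is at least 2 - |iexp (\<tau>
          \<bullet> s) - 1|, and outside \<open>?G\<close> this exceeds 1.\<close>
        then have "iexp ((d + \<tau>) \<bullet> s) - 1 = - (2 + (iexp (\<tau> \<bullet> s) - 1))"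
          by simp
        then have "cmod (iexp ((d + \<tau>) \<bullet> s) - 1) = cmod (2 + (iexp (\<tau> \<bullet> s) - 1))"
          by (simp only: norm_minus_cancel)
        also have "\<dots> \<ge> cmod 2 - cmod (iexp (\<tau> \<bullet> s) - 1)"
          by (rule norm_diff_ineq)
        finally show ?thesis using \<tau> by auto
      qed
      ultimately show "d + \<tau> \<in> ?G \<union> (U - S)" by auto
    qed
    then have "emeasure lborel ((\<lambda>\<tau>. d + \<tau>) ` (S - ?G)) \<le> emeasure lborel (?G \<union> (U - S))"
      using G U(1) S_borel by (intro emeasure_mono) auto
    also have "\<dots> \<le> emeasure lborel ?G + emeasure lborel (U - S)"
      using G U(1) S_borel by (intro emeasure_subadditive) auto
    also have "emeasure lborel ((\<lambda>\<tau>. d + \<tau>) ` (S - ?G)) = emeasure lborel (S - ?G)"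
    proof -
      have "emeasure lborel (S - ?G) = emeasure (distr lborel borel ((+) (- d))) (S - ?G)"
        by (simp add: lborel_distr_plus)
      also have "\<dots> = emeasure lborel ((+) (- d) -` (S - ?G))"
        using S_borel G by (subst emeasure_distr) auto
      also have "(+) (- d) -` (S - ?G) = (\<lambda>\<tau>. d + \<tau>) ` (S - ?G)"
        by (force simp: image_iff)
      finally show ?thesis by simp
    qed
    finally have shift: "emeasure lborel (S - ?G) \<le> emeasure lborel ?G + emeasure lborel (U - S)" .
    \<comment> \<open>Together with the shift estimate this gives m \<le> 2 |G| + m / 2, which is
      where the quarter comes from.\<close>
    have "ennreal m = emeasure lborel ?G + emeasure lborel (S - ?G)"
      using G S_borel by (subst plus_emeasure) (auto simp: S(2)[symmetric] intro!: arg_cong[where f="emeasure lborel"])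
    also have "\<dots> \<le> emeasure lborel ?G + (emeasure lborel ?G + ennreal (m / 2))"
      using shift U(3) by (intro add_left_mono order_trans[OF shift]) auto
    finally have le: "ennreal m \<le> emeasure lborel ?G + (emeasure lborel ?G + ennreal (m / 2))" .
    have "emeasure lborel ?G \<le> ennreal m"
      unfolding S(2)[symmetric] using S_borel by (intro emeasure_mono) auto
    then obtain g where g: "g \<ge> 0" "emeasure lborel ?G = ennreal g"
      by (cases "emeasure lborel ?G") (auto simp: top_unique)
    have "ennreal m \<le> ennreal (g + (g + m / 2))"
      using le g(1) S(3) unfolding g(2) by (simp flip: ennreal_plus)
    then have "m \<le> g + (g + m / 2)"
      using g S(3) by (subst (asm) ennreal_le_iff) auto
    then show "ennreal (m / 4) \<le> emeasure lborel ?G"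
      unfolding g(2) by (intro ennreal_leI) simp
  qed
qed

text \<open>The second-order Taylor remainder is at most half of |x| for |x| \<le> 1. This reverse
  of |iexp x - 1| \<le> |x| allows kernels at different times to be compared for small
  phases.\<close>

lemma abs_le_2_cmod_iexp_minus_1:
  assumes "\<bar>x\<bar> \<le> 1"
  shows "\<bar>x\<bar> \<le> 2 * cmod (iexp x - 1)"
proof -
  have "cmod (iexp x - 1 - \<i> * x) \<le> \<bar>x\<bar>\<^sup>2 / 2"
    using iexp_approx1[of x 1] by (simp add: fact_numeral power2_eq_square algebra_simps)
  also have "\<dots> \<le> \<bar>x\<bar> / 2"
    using assms mult_left_mono[of "\<bar>x\<bar>" 1 "\<bar>x\<bar>"] by (simp add: power2_eq_square)
  finally have "cmod (iexp x - 1 - \<i> * x) \<le> \<bar>x\<bar> / 2" .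
  moreover have "\<bar>x\<bar> \<le> cmod (iexp x - 1) + cmod (iexp x - 1 - \<i> * x)"
    using norm_triangle_ineq4[of "iexp x - 1" "iexp x - 1 - \<i> * x"] by (simp add: norm_mult)
  ultimately show ?thesis by linarith
qed

section \<open>Stochastic continuity\<close>

lemma ennreal_finite_nonzero_cases:
  assumes "x < \<infinity>" "x \<noteq> 0"
  obtains a where "x = ennreal a" "a > 0"
proof (cases x)
  case (real r)
  then have "r > 0" using assms(2) by (cases "r = 0") auto
  with real show ?thesis by (intro that)
qed (use assms in simp)

lemma ex_compact_pos_measure_subset:
  fixes A :: "(real^'d) set"
  assumes A: "A \<in> sets borel" "bounded A" "emeasure lborel A \<noteq> 0"
  obtains S m where "S \<subseteq> A" "compact S" "emeasure lborel S = ennreal m" "m > 0"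
proof -
  have fin: "emeasure lborel A < \<infinity>"
    by (rule emeasure_bounded_finite[OF A(2)])
  then obtain a where a: "emeasure lborel A = ennreal a" "a > 0"
    using A(3) by (rule ennreal_finite_nonzero_cases)
  obtain T where T: "closed T" "T \<subseteq> A" "emeasure lebesgue (A - T) < ennreal a"
    by (rule sets_lebesgue_inner_closed[of A a]) (use A(1) a in auto)
  have "compact T"
    using T A(2) by (auto simp: compact_eq_bounded_closed intro: bounded_subset)
  have "emeasure lborel T < \<infinity>"
    using emeasure_mono[OF T(2), of lborel] A(1) fin by auto
  moreover have "emeasure lborel T \<noteq> 0"
  proof
    assume "emeasure lborel T = 0"
    then have "emeasure lborel (A - T) = emeasure lborel A"
      using T A(1) by (intro emeasure_Diff_null_set null_setsI) auto
    then show False using T A(1) a by simp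
  qed
  ultimately obtain m where "emeasure lborel T = ennreal m" "m > 0"
    by (rule ennreal_finite_nonzero_cases)
  with T \<open>compact T\<close> show thesis by (intro that)
qed

context harmonizable_field
begin

lemma measurable_W: "(\<lambda>s. W s *v u) \<in> borel_measurable borel"
proof -
  have \<phi>[measurable]: "\<phi> \<in> borel_measurable borel"
    by (intro borel_measurable_continuous_onI continuous_\<phi>)
  have "(\<lambda>s. mat_powr (\<phi> s) A) \<in> borel_measurable borel" for A :: "real^'m^'m"
    by (rule measurable_compose[OF \<phi> borel_measurable_mat_powr])
  moreover have "W s *v u = mat_powr (\<phi> s) (transpose (- (trace E *\<^sub>R B))) *v (mat_powr (\<phi> s) (transpose (- D)) *v u)" for s
    by (simp add: W_def matrix_transpose_mul transpose_mat_powr matrix_vector_mul_assoc)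
  ultimately show ?thesis
    by (simp only:) (intro borel_measurable_matrix_mult_vec; simp)
qed

definition w :: "real^'m \<Rightarrow> real^'d \<Rightarrow> real^('m + 'm)" where
  "w u s = join_vec (W s *v u) 0"

lemma V_eq: "V t u s = cscale (cnj (iexp (t \<bullet> s) - 1)) (w u s)"
  by (simp add: V_def w_def)

lemma measurable_w [measurable]: "w u \<in> borel_measurable borel"
proof -
  have "continuous_on UNIV (\<lambda>a :: real^'m. join_vec a 0)"
    by (rule linear_continuous_on) (simp add: linear_conv_bounded_linear[symmetric] linear_join_vec_zero)
  from borel_measurable_continuous_on[OF this measurable_W] show ?thesis
    unfolding w_def[abs_def] .
qed

lemma measurable_h_V_pair: "(\<lambda>(s, t). h (V t u s)) \<in> borel_measurable (borel \<Otimes>\<^sub>M borel)"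
proof -
  have "(\<lambda>p. cscale (fst p) (snd p)) \<in> borel_measurable (borel \<Otimes>\<^sub>M borel :: (complex \<times> (real^('m + 'm))) measure)"
    unfolding borel_prod by (intro borel_measurable_continuous_onI continuous_intros)
  moreover have "(\<lambda>p :: (real^'d) \<times> (real^'d). cnj (iexp (snd p \<bullet> fst p) - 1)) \<in> borel_measurable (borel \<Otimes>\<^sub>M borel)"
    unfolding borel_prod by (intro borel_measurable_continuous_onI continuous_intros)
  moreover have "(\<lambda>p :: (real^'d) \<times> (real^'d). w u (fst p)) \<in> borel_measurable (borel \<Otimes>\<^sub>M borel)"
    by measurable
  ultimately have "(\<lambda>p. h (cscale (cnj (iexp (snd p \<bullet> fst p) - 1)) (w u (fst p)))) \<in> borel_measurable (borel \<Otimes>\<^sub>M borel)"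
    by (intro measurable_compose[OF _ measurable_h]) (rule measurable_compose[OF measurable_Pair, of _ _ _ _ _ "\<lambda>p. cscale (fst p) (snd p)", simplified])
  then show ?thesis
    by (simp add: V_eq split_beta)
qed

lemma integrable_h_V: "integrable lborel (\<lambda>s. h (V t u s))"
  by (rule char_stoch_int(1)[OF stoch_int_X])

text \<open>Dividing by z' reduces to scaling by a number of modulus at most 1. Kernels at different
  times can then be compared through the moduli of their oscillating factors alone.\<close>

lemma ex_h_cscale_mono: "\<exists>C\<ge>0. \<forall>z z' x. cmod z \<le> cmod z' \<longrightarrow> h (cscale z x) \<le> C * h (cscale z' x)"
proof -
  obtain C where C: "C \<ge> 0" "\<And>z x. cmod z \<le> 1 \<Longrightarrow> h (cscale z x) \<le> C * h x"
    using ex_h_cscale_bound by blast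
  have "h (cscale z x) \<le> C * h (cscale z' x)" if "cmod z \<le> cmod z'" for z z' x
  proof (cases "z' = 0")
    case False
    then have "cscale z x = cscale (z / z') (cscale z' x)"
      by (simp flip: cscale_mult)
    then show ?thesis
      using C(2)[of "z / z'" "cscale z' x"] that False by (simp add: norm_divide)
  qed (use that in simp)
  with C(1) show ?thesis by blast
qed

text \<open>
  The existence of \<open>X t\<close> for all \<open>t\<close> already forces integrability of \<open>h (w u s)\<close> at infinity:
  \<open>\<integral> h (V t u s) ds\<close> is bounded for \<open>t\<close> in a set of positive measure, and averaging over \<open>t\<close> in this
  set removes the oscillating factor \<open>iexp (t \<bullet> s) - 1\<close>.
\<close>

lemma integrable_h_w_at_infinity:
  "\<exists>R>0. integrable lborel (\<lambda>s. indicator {s. R < norm s} s * h (w u s))"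
proof -
  obtain C where C: "C \<ge> 0" "\<And>z z' x. cmod z \<le> cmod z' \<Longrightarrow> h (cscale z x) \<le> C * h (cscale z' x)"
    using ex_h_cscale_mono by blast
  define F where "F t = (\<integral>\<^sup>+s. ennreal (h (V t u s)) \<partial>lborel)" for t
  have pair[measurable]: "(\<lambda>(s, t). h (V t u s)) \<in> borel_measurable (lborel \<Otimes>\<^sub>M lborel)"
    unfolding measurable_cong_sets[OF sets_pair_measure_cong[OF sets_lborel sets_lborel] refl]
    by (rule measurable_h_V_pair)
  have F[measurable]: "F \<in> borel_measurable borel"
  proof -
    have "(\<lambda>(t, s). ennreal (h (V t u s))) \<in> borel_measurable (lborel \<Otimes>\<^sub>M lborel)"
      using measurable_compose[OF measurable_pair_swap[OF pair] measurable_ennreal]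
      by (simp add: split_beta)
    from lborel.borel_measurable_nn_integral[OF this] show ?thesis
      by (simp add: F_def[abs_def])
  qed
  have F_fin: "F t < \<infinity>" for t
    using integrable_h_V[of t u] by (simp add: F_def integrable_iff_bounded h_nonneg less_top)
  \<comment> \<open>\<open>F\<close> is finite at each t but has no evident bound. The unit ball is
    exhausted by sublevel sets, so one of them has positive measure.\<close>
  define A where "A n = {t \<in> cball 0 1. F t \<le> ennreal (real n)}" for n :: nat
  have A[measurable]: "A n \<in> sets borel" for n
    unfolding A_def by measurable
  have "(\<Union>n. A n) = cball 0 1"
  proof -
    have "\<exists>n :: nat. F t \<le> ennreal (real n)" for t
    proof -
      obtain r where "r \<ge> 0" "F t = ennreal r" using F_fin[of t] by (cases "F t") auto
      moreover obtain n :: nat where "r \<le> real n" using real_arch_simple by blast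
      ultimately show ?thesis by (auto intro: ennreal_leI)
    qed
    then show ?thesis by (auto simp: A_def)
  qed
  have "\<exists>n. emeasure lborel (A n) \<noteq> 0"
  proof (rule ccontr)
    assume "\<nexists>n. emeasure lborel (A n) \<noteq> 0"
    then have "(\<Union>n. A n) \<in> null_sets lborel"
      by (intro null_sets_UN null_setsI) auto
    then have "negligible (cball (0 :: real^'d) 1)"
      using \<open>(\<Union>n. A n) = cball 0 1\<close> by (simp add: negligible_iff_null_sets null_sets_completionI)
    then have "negligible (ball (0 :: real^'d) 1)"
      by (rule negligible_subset) auto
    then show False
      using open_not_negligible[of "ball (0 :: real^'d) 1"] by simp
  qed
  then obtain n where "emeasure lborel (A n) \<noteq> 0" ..
  moreover have "bounded (A n)"
    by (rule bounded_subset[of "cball 0 1"]) (auto simp: A_def)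
  ultimately obtain S m where S: "S \<subseteq> A n" "compact S" "emeasure lborel S = ennreal m" "m > 0"
    using ex_compact_pos_measure_subset[OF A] by metis
  have S_borel[measurable]: "S \<in> sets borel" using S(2) by (simp add: borel_compact)
  obtain R where R: "R > 0"
    "\<And>s. norm s > R \<Longrightarrow> ennreal (m / 4) \<le> emeasure lborel {\<tau> \<in> S. 1 \<le> cmod (iexp (\<tau> \<bullet> s) - 1)}"
    using measure_phase_ge_quarter[OF S(2-4)] by blast
  define I where "I s = indicator {s. R < norm s} s * h (w u s)" for s
  have I_meas[measurable]: "I \<in> borel_measurable borel"
    unfolding I_def[abs_def] by measurable
  have "(\<integral>\<^sup>+s. ennreal (m / 4) * ennreal (I s) \<partial>lborel)
      \<le> (\<integral>\<^sup>+s. (\<integral>\<^sup>+t. indicator S t * (ennreal C * ennreal (h (V t u s))) \<partial>lborel) \<partial>lborel)"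
  proof (rule nn_integral_mono)
    fix s :: "real^'d"
    show "ennreal (m / 4) * ennreal (I s) \<le> (\<integral>\<^sup>+t. indicator S t * (ennreal C * ennreal (h (V t u s))) \<partial>lborel)"
    proof (cases "R < norm s")
      case True
      \<comment> \<open>On this part of S the oscillating factor has modulus at least 1, so h (w u
        s) \<le> C h (V t u s); its measure is at least m / 4 for every s with |s| > R.\<close>
      let ?G = "{\<tau> \<in> S. 1 \<le> cmod (iexp (\<tau> \<bullet> s) - 1)}"
      have "closed {\<tau>. 1 \<le> cmod (iexp (\<tau> \<bullet> s) - 1)}"
        by (intro closed_Collect_le continuous_intros)
      then have G: "?G \<in> sets lborel"
        using S_borel by (simp add: Collect_conj_eq borel_closed)
      have "ennreal (m / 4) * ennreal (I s) \<le> emeasure lborel ?G * ennreal (h (w u s))"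
        using R(2)[OF True] True by (intro mult_mono) (auto simp: I_def)
      also have "\<dots> = (\<integral>\<^sup>+t. ennreal (h (w u s)) * indicator ?G t \<partial>lborel)"
        using G by (simp add: nn_integral_cmult_indicator mult.commute)
      also have "\<dots> \<le> (\<integral>\<^sup>+t. indicator S t * (ennreal C * ennreal (h (V t u s))) \<partial>lborel)"
      proof (rule nn_integral_mono)
        fix t
        have "h (w u s) \<le> C * h (V t u s)" if "t \<in> ?G"
          using C(2)[of 1 "cnj (iexp (t \<bullet> s) - 1)" "w u s"] that
          unfolding V_eq complex_mod_cnj by simp
        then show "ennreal (h (w u s)) * indicator ?G t \<le> indicator S t * (ennreal C * ennreal (h (V t u s)))"
          using C(1) by (auto simp: indicator_def ennreal_mult'[symmetric] intro: ennreal_leI)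
      qed
      finally show ?thesis .
    qed (simp add: I_def)
  qed
  also have "\<dots> = (\<integral>\<^sup>+t. (\<integral>\<^sup>+s. indicator S t * (ennreal C * ennreal (h (V t u s))) \<partial>lborel) \<partial>lborel)"
  proof (rule lborel_pair.Fubini'[symmetric])
    have "(\<lambda>(s, t). indicator S t * (ennreal C * ennreal (h (V t u s)))) =
        (\<lambda>p. indicator S (snd p) * (ennreal C * ennreal ((\<lambda>(s, t). h (V t u s)) p)))"
      by (auto simp: fun_eq_iff)
    also have "\<dots> \<in> borel_measurable (lborel \<Otimes>\<^sub>M lborel)"
      by (intro borel_measurable_times_ennreal measurable_compose[OF measurable_snd borel_measurable_indicator]
          measurable_compose[OF pair measurable_ennreal] borel_measurable_const) simp
    finally show "(\<lambda>(s, t). indicator S t * (ennreal C * ennreal (h (V t u s))))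
        \<in> borel_measurable (lborel \<Otimes>\<^sub>M lborel)" .
  qed
  also have "\<dots> = (\<integral>\<^sup>+t. indicator S t * (ennreal C * F t) \<partial>lborel)"
  proof (rule nn_integral_cong)
    fix t
    have [measurable]: "(\<lambda>s. h (V t u s)) \<in> borel_measurable borel"
      by (rule measurable_compose[OF measurable_V measurable_h])
    show "(\<integral>\<^sup>+s. indicator S t * (ennreal C * ennreal (h (V t u s))) \<partial>lborel) = indicator S t * (ennreal C * F t)"
      by (simp add: nn_integral_cmult F_def)
  qed
  also have "\<dots> \<le> (\<integral>\<^sup>+t. (ennreal C * ennreal (real n)) * indicator S t \<partial>lborel)"
  proof (rule nn_integral_mono)
    fix t
    show "indicator S t * (ennreal C * F t) \<le> (ennreal C * ennreal (real n)) * indicator S t"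
      using S(1) by (auto simp: indicator_def A_def intro!: mult_left_mono)
  qed
  also have "\<dots> < \<infinity>"
    using S(3) by (simp add: nn_integral_cmult_indicator ennreal_mult_less_top)
  finally have "ennreal (m / 4) * (\<integral>\<^sup>+s. ennreal (I s) \<partial>lborel) < \<infinity>"
    by (simp add: nn_integral_cmult)
  then have "(\<integral>\<^sup>+s. ennreal (I s) \<partial>lborel) < \<infinity>"
    using S(4) by (auto simp: ennreal_mult_less_top)
  then have "integrable lborel I"
    by (intro integrableI_nonneg) (auto simp: I_def h_nonneg)
  with R(1) show ?thesis
    unfolding I_def[abs_def] by blast
qed

text \<open>For large s the oscillating factor is at most 2 and h (w u s) is integrable. For the
  other s, including those near the origin, the kernel is dominated by the kernel at one of finitely
  many fixed times \<open>e i\<close>, whose integrability is known because X (e i) exists.\<close>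

lemma V_dominated:
  "\<exists>\<delta>>0. \<exists>g. integrable lborel g \<and> (\<forall>t s. norm t \<le> \<delta> \<longrightarrow> h (V t u s) \<le> g s)"
proof -
  obtain C where C: "C \<ge> 0" "\<And>z z' x. cmod z \<le> cmod z' \<Longrightarrow> h (cscale z x) \<le> C * h (cscale z' x)"
    using ex_h_cscale_mono by blast
  obtain R where R: "R > 0" "integrable lborel (\<lambda>s. indicator {s. R < norm s} s * h (w u s))"
    using integrable_h_w_at_infinity by blast
  \<comment> \<open>The length 1 / R keeps |e i \<bullet> s| \<le> 1 for |s| \<le> R. With i the
    largest coordinate of s, the next constant gives |t \<bullet> s| \<le> |e i \<bullet> s| / 2.
    The factor 4 in \<open>g\<close> bounds h (2 w) by 4 h w.\<close>
  define e :: "'d \<Rightarrow> real^'d" where "e i = axis i (1 / R)" for i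
  define \<delta> where "\<delta> = 1 / (2 * R * CARD('d))"
  define g where "g s = C * (\<Sum>i\<in>UNIV. h (V (e i) u s)) + 4 * C * (indicator {s. R < norm s} s * h (w u s))" for s
  have "\<delta> > 0" using R by (simp add: \<delta>_def)
  moreover have "integrable lborel g"
    unfolding g_def[abs_def]
    by (intro Bochner_Integration.integrable_add integrable_mult_right Bochner_Integration.integrable_sum
        integrable_h_V R)
  moreover have "h (V t u s) \<le> g s" if t: "norm t \<le> \<delta>" for t s
  proof (cases "R < norm s")
    case True
    have "h (V t u s) \<le> C * h (cscale 2 (w u s))"
      unfolding V_eq
    proof (rule C(2))
      show "cmod (cnj (iexp (t \<bullet> s) - 1)) \<le> cmod 2"
        using cmod_iexp_diff_le(2)[of "t \<bullet> s" 0] by (simp only: complex_mod_cnj) simp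
    qed
    also have "cscale 2 (w u s) = w u s + w u s"
      using cscale_of_real[of 2 "w u s"] by (simp add: scaleR_2)
    also have "C * h (w u s + w u s) \<le> C * (4 * h (w u s))"
      using h_quasi[of "w u s" "w u s"] C(1) by (intro mult_left_mono) auto
    also have "\<dots> \<le> g s"
      using True C(1) by (simp add: g_def sum_nonneg h_nonneg)
    finally show ?thesis .
  next
    case False
    have "Max (range (\<lambda>j. \<bar>s $ j\<bar>)) \<in> range (\<lambda>j. \<bar>s $ j\<bar>)"
      by (intro Max_in) auto
    then obtain i where "Max (range (\<lambda>j. \<bar>s $ j\<bar>)) = \<bar>s $ i\<bar>"
      by blast
    then have i: "\<bar>s $ j\<bar> \<le> \<bar>s $ i\<bar>" for j
      by (metis Max_ge finite_class.finite_UNIV finite_imageI rangeI)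
    have ei: "e i \<bullet> s = s $ i / R"
      by (simp add: e_def inner_axis')
    have "\<bar>s $ i\<bar> \<le> R"
      using component_le_norm_cart[of s i] False by simp
    then have small: "\<bar>e i \<bullet> s\<bar> \<le> 1"
      using R by (simp add: ei)
    have "norm s \<le> (\<Sum>j\<in>UNIV. \<bar>s $ j\<bar>)"
      by (rule norm_le_l1_cart)
    also have "\<dots> \<le> (\<Sum>j\<in>(UNIV :: 'd set). \<bar>s $ i\<bar>)"
      by (intro sum_mono i)
    finally have norm_s: "norm s \<le> (\<Sum>j\<in>(UNIV :: 'd set). \<bar>s $ i\<bar>)" .
    have "cmod (iexp (t \<bullet> s) - 1) \<le> \<bar>t \<bullet> s\<bar>"
      using cmod_iexp_diff_le(1)[of "t \<bullet> s" 0] by simp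
    also have "\<dots> \<le> norm t * norm s"
      by (rule Cauchy_Schwarz_ineq2)
    also have "\<dots> \<le> \<delta> * (\<Sum>j\<in>(UNIV :: 'd set). \<bar>s $ i\<bar>)"
      using t norm_s \<open>\<delta> > 0\<close> by (intro mult_mono) auto
    also have "\<dots> = \<bar>e i \<bullet> s\<bar> / 2"
      using R by (simp add: \<delta>_def ei field_simps)
    also have "\<dots> \<le> cmod (iexp (e i \<bullet> s) - 1)"
      using abs_le_2_cmod_iexp_minus_1[OF small] by simp
    finally have le: "cmod (cnj (iexp (t \<bullet> s) - 1)) \<le> cmod (cnj (iexp (e i \<bullet> s) - 1))"
      by (simp only: complex_mod_cnj)
    have "h (V t u s) \<le> C * h (V (e i) u s)"
      unfolding V_eq by (rule C(2)[OF le])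
    also have "\<dots> \<le> C * (\<Sum>i\<in>UNIV. h (V (e i) u s))"
      using C(1) by (intro mult_left_mono member_le_sum h_nonneg) auto
    also have "\<dots> \<le> g s"
      using C(1) by (simp add: g_def h_nonneg)
    finally show ?thesis .
  qed
  ultimately show ?thesis by blast
qed

lemma integral_h_V_tendsto_0:
  assumes \<tau>: "\<tau> \<longlonglongrightarrow> 0"
  shows "(\<lambda>n. \<integral>s. h (V (\<tau> n) u s) \<partial>lborel) \<longlonglongrightarrow> 0"
proof -
  obtain \<delta> g where \<delta>: "\<delta> > 0" and g: "integrable lborel g"
    and dom: "\<And>t s. norm t \<le> \<delta> \<Longrightarrow> h (V t u s) \<le> g s"
    using V_dominated by blast
  have "eventually (\<lambda>n. norm (\<tau> n) < \<delta>) sequentially"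
    using tendsto_norm[OF \<tau>] \<delta> by (intro order_tendstoD) auto
  then obtain N where N: "\<And>n. n \<ge> N \<Longrightarrow> norm (\<tau> n) < \<delta>"
    by (auto simp: eventually_sequentially)
  have "(\<lambda>n. \<integral>s. h (V (\<tau> (n + N)) u s) \<partial>lborel) \<longlonglongrightarrow> (\<integral>s. 0 \<partial>(lborel :: (real^'d) measure))"
  proof (rule integral_dominated_convergence[OF _ _ g])
    have "(\<lambda>n. h (V (\<tau> (n + N)) u s)) \<longlonglongrightarrow> h (cscale (cnj (iexp (0 \<bullet> s) - 1)) (w u s))" for s
    proof -
      have "continuous_on UNIV (\<lambda>t. h (cscale (cnj (iexp (t \<bullet> s) - 1)) (w u s)))"
        by (rule continuous_on_compose2[OF continuous_h]) (auto intro!: continuous_intros)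
      from continuous_on_tendsto_compose[OF this LIMSEQ_ignore_initial_segment[OF \<tau>, of N]]
      show ?thesis by (simp add: V_eq)
    qed
    then show "AE s in lborel. (\<lambda>n. h (V (\<tau> (n + N)) u s)) \<longlonglongrightarrow> 0" by simp
    show "(\<lambda>s. h (V (\<tau> (n + N)) u s)) \<in> borel_measurable lborel" for n
      using measurable_compose[OF measurable_V measurable_h] by simp
    show "AE s in lborel. norm (h (V (\<tau> (n + N)) u s)) \<le> g s" for n
      using dom[of "\<tau> (n + N)"] N[of "n + N"] by (auto simp: h_nonneg less_imp_le)
  qed simp
  then show ?thesis
    by (simp add: LIMSEQ_offset)
qed

text \<open>Increments need not be stationary here, but the difference of the kernels at \<tau> n
  and t has the same modulus of its scalar factor as the kernel at \<tau> n - t. Domination by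
  modulus thus reduces continuity at t to convergence of the kernels at 0.\<close>

lemma X_stochastically_continuous: "stochastically_continuous P X"
  unfolding stochastically_continuous_def
proof (intro allI impI)
  fix t and \<tau> :: "nat \<Rightarrow> real^'d" assume \<tau>: "\<tau> \<longlonglongrightarrow> t"
  show "tendsto_in_prob P (\<lambda>n. X (\<tau> n)) (X t)"
  proof (rule char_tendsto_1_imp_tendsto_in_prob[OF measurable_X measurable_X])
    fix u
    obtain C where C: "C \<ge> 0" "\<And>x. cmod (log_char \<mu> x) \<le> C * h x"
      using ex_log_char_bound by blast
    obtain C' where C': "C' \<ge> 0" "\<And>z z' x. cmod z \<le> cmod z' \<Longrightarrow> h (cscale z x) \<le> C' * h (cscale z' x)"
      using ex_h_cscale_mono by blast
    define v where "v n s = V (\<tau> n) u s + V t (- u) s" for n s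
    have v: "stoch_int (v n) (\<lambda>\<omega>. (X (\<tau> n) \<omega> - X t \<omega>) \<bullet> u)" for n
      using stoch_int_add[OF stoch_int_X[of "\<tau> n" u] stoch_int_X[of t "- u"]]
      by (simp add: v_def[abs_def] inner_diff_left)
    have h_v: "h (v n s) \<le> C' * h (V (\<tau> n - t) u s)" for n s
    proof -
      have "w (- u) s = - w u s"
        by (simp add: w_def vec_sum_eq_iff linear_neg[OF matrix_vector_mul_linear])
      then have "v n s = cscale (cnj (iexp (\<tau> n \<bullet> s)) - cnj (iexp (t \<bullet> s))) (w u s)"
        by (simp add: v_def V_eq cscale_diff_left vec_sum_eq_iff algebra_simps)
      moreover have "iexp (\<tau> n \<bullet> s) - iexp (t \<bullet> s) = iexp (t \<bullet> s) * (iexp ((\<tau> n - t) \<bullet> s) - 1)"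
        by (simp add: inner_diff_left algebra_simps flip: exp_add)
      then have "cmod (cnj (iexp (\<tau> n \<bullet> s)) - cnj (iexp (t \<bullet> s))) = cmod (cnj (iexp ((\<tau> n - t) \<bullet> s) - 1))"
        by (simp only: complex_cnj_diff[symmetric] complex_mod_cnj norm_mult norm_exp_i_times mult_1)
      ultimately show ?thesis
        unfolding V_eq using C'(2) by simp
    qed
    have "(\<lambda>n. \<integral>s. log_char \<mu> (v n s) \<partial>lborel) \<longlonglongrightarrow> 0"
    proof (rule Lim_null_comparison[OF always_eventually], rule allI)
      fix n
      have "cmod (\<integral>s. log_char \<mu> (v n s) \<partial>lborel) \<le> (\<integral>s. cmod (log_char \<mu> (v n s)) \<partial>lborel)"
        by (rule integral_norm_bound)
      also have "\<dots> \<le> (\<integral>s. C * C' * h (V (\<tau> n - t) u s) \<partial>lborel)"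
      proof (rule integral_mono)
        show "integrable lborel (\<lambda>s. cmod (log_char \<mu> (v n s)))"
          by (intro integrable_norm char_stoch_int(2)[OF v])
        show "integrable lborel (\<lambda>s. C * C' * h (V (\<tau> n - t) u s))"
          by (intro integrable_mult_right integrable_h_V)
        show "cmod (log_char \<mu> (v n s)) \<le> C * C' * h (V (\<tau> n - t) u s)" for s
          using C(2)[of "v n s"] mult_left_mono[OF h_v[of n s] C(1)] by (simp add: mult.assoc)
      qed
      finally show "norm (\<integral>s. log_char \<mu> (v n s) \<partial>lborel) \<le> C * C' * (\<integral>s. h (V (\<tau> n - t) u s) \<partial>lborel)"
        by simp
    next
      have "(\<lambda>n. \<tau> n - t) \<longlonglongrightarrow> 0"
        using \<tau> by (simp add: LIM_zero)
      from tendsto_mult_left[OF integral_h_V_tendsto_0[OF this], of "C * C'"]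
      show "(\<lambda>n. C * C' * (\<integral>s. h (V (\<tau> n - t) u s) \<partial>lborel)) \<longlonglongrightarrow> 0"
        by simp
    qed
    then have "(\<lambda>n. exp (\<integral>s. log_char \<mu> (v n s) \<partial>lborel)) \<longlonglongrightarrow> exp 0"
      by (rule tendsto_exp)
    then show "(\<lambda>n. CLINT \<omega>|P. iexp ((X (\<tau> n) \<omega> - X t \<omega>) \<bullet> u)) \<longlonglongrightarrow> 1"
      by (simp add: char_stoch_int(3)[OF v])
  qed
qed

end

theorem proposition5p2:
  fixes \<mu> :: "(real^('m::finite + 'm)) measure"
    and B D :: "real^'m^'m"
    and E :: "real^'d::finite^'d"
    and \<phi> :: "real^'d \<Rightarrow> real"
    and P :: "'w measure"
    and M :: "(real^'d) set \<Rightarrow> 'w \<Rightarrow> real^('m + 'm)"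
    and Mt :: "(real^'d) set \<Rightarrow> 'w \<Rightarrow> complex^'m"
    and X :: "real^'d \<Rightarrow> 'w \<Rightarrow> real^'m"
  assumes "distribution \<mu>"
    and "full \<mu>"
    and "strictly_operator_stable_exponent \<mu> (direct_sum B)"
    and "indep_scattered_random_measure P \<mu> M"
    and "\<And>A \<omega>. A \<in> finite_measure_sets \<Longrightarrow> M A \<omega> = Re_Im_vec (Mt A \<omega>)"
    and "D \<in> Q_matrices"
    and "E \<in> Q_matrices"
    and "min_Re_eigenvalue E > max_Re_eigenvalue D"
    and "continuous_on UNIV \<phi>"
    and "homogeneous (transpose E) \<phi>"
    and "\<And>x. \<phi> x \<ge> 0"
    and "\<And>x. x \<noteq> 0 \<Longrightarrow> \<phi> x > 0"
    and "\<And>t. has_Re_integral P Mt (harmonizable_kernel \<phi> E D B t) (X t)"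
  shows "(D ** B = B ** D \<longrightarrow>
            operator_self_similar P X E D \<and>
            strictly_operator_stable_field P X \<and> field_exponent P X B) \<and>
         ((\<forall>A\<in>phase_rotations. distr \<mu> borel (\<lambda>x. A *v x) = \<mu>) \<longrightarrow>
            stationary_increments P X) \<and>
         (full_field P X \<and> stochastically_continuous P X)"
proof -
  interpret harmonizable_field \<mu> B P M Mt D E \<phi> X
    by unfold_locales (use assms in auto)
  show ?thesis
    using self_similar strictly_stable exponent stationary X_full X_stochastically_continuous by blast
qed

end
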